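(* Consider the stochastic system $$\mathrm{d}x(t)=(Ax(t)+Bu(t))\,\mathrm{d}t+[\Psi(x(t)),\,D]\,\mathrm{d}W(t),\quad t\ge 0,\qquad x(0)=x_0,$$ with $A\in\mathbb{R}^{n\times n}$, $B\in\mathbb{R}^{n\times m}$, $D\in\mathbb{R}^{n\times \ell_2}$, $\Psi(x)=[C_1x,\ldots,C_{\ell_1}x]$, $C_i\in\mathbb{R}^{n\times n}$. Assume that there exist a nonnegative-definite Hermitian matrix $R\in\mathbb{C}^{n\times n}\setminus\{0\}$ and a scalar $\phi_{\mathrm{L}}>0$ such that $$A^{\mathrm{T}}R+RA+\sum_{i=1}^{\ell_1}C_i^{\mathrm{T}}RC_i\ \ge\ \phi_{\mathrm{L}}R\qquad\text{and}\qquad \mathrm{tr}(D^{\mathrm{T}}RD)>0 .$$ Let $\beta_{\mathrm{U}}\triangleq\lambda_{\max}(B^{\mathrm{T}}RB)$. If the control policy $\{u(t)\}_{t\ge0}$ is $\mathcal{F}_t$-adapted and satisfies $$\frac1t\int_0^t\mathbb{E}[\|u(\tau)\|^2]\,\mathrm{d}\tau\le\hat u\quad\text{for all } t>0$$ with a constant $\hat u\ge 0$ such that $$\hat u<\begin{cases}\phi_{\mathrm{L}}\,\mathrm{tr}(D^{\mathrm{T}}RD)/\beta_{\mathrm{U}}, & \text{if }\beta_{\mathrm{U}}\ne0,\\ \infty, & \text{otherwise,}\end{cases}$$ then the second moment of the state diverges, that is, $$\lim_{t\to\infty}\mathbb{E}[\|x(t)\|^2]=\infty,$$ for any initial state $x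_0\in\mathbb{R}^n$.
   Context: Fix a probability space $(\Omega,\mathcal{F},\mathbb{P})$ with a filtration $\{\mathcal{F}_t\}_{t\ge0}$. $\{W(t)=[W_1(t),\ldots,W_\ell(t)]^{\mathrm{T}}\in\mathbb{R}^\ell\}_{t\ge0}$ is an $\ell$-dimensional Wiener process with respect to $\{\mathcal{F}_t\}$: each $W_i$ is $\mathcal{F}_t$-adapted, the components are independent, and increments $W(t)-W(s)$, $t\geq s$, are independent of $\mathcal{F}_s$. Here $\ell=\ell_1+\ell_2$; the first $\ell_1$ components of $W$ act as multiplicative noise (through $\Psi$) and the last $\ell_2$ components as additive noise (through $D$), i.e. $[\Psi(x(t)),D]\,\mathrm{d}W(t)=\sum_{i=1}^{\ell_1}C_ix(t)\,\mathrm{d}W_i(t)+D\,[\mathrm{d}W_{\ell_1+1}(t),\ldots,\mathrm{d}W_{\ell}(t)]^{\mathrm{T}}$. The stochastic differential equation is understood in the Ito sense: $x(t)\in\mathbb{R}^n$ is the (continuous, $\mathcal{F}_t$-adapted) state process solving the corresponding integral equation with deterministic initial value $x_0$, and $u(t)\in\mathbb{R}^m$ is the control input process (measurable, so that the integrals make sense). $\|\cdot\|$ is the Euclidean norm, $\lambda_{\max}(H)$ is the largest eigenvalue of a Hermitian matrix $H$, and $H_1\ge H_2$ for Hermitian matrices means that $H_1-H_2$ is nonnegative-definite. *)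

theory Defs
  imports "HOL-Probability.Probability"
begin

section \<open>Hermitian matrices\<close>

abbreviation cmat :: "real^'n^'m \<Rightarrow> complex^'n^'m" where
  "cmat A \<equiv> map_matrix complex_of_real A"

definition hermitian :: "complex^'n^'n \<Rightarrow> bool" where
  "hermitian H \<longleftrightarrow> transpose (map_matrix cnj H) = H"

text \<open>For Hermitian \<open>H\<close> the form \<open>v\<^sup>* H v\<close> is real, so taking the real part loses nothing.\<close>

definition nonneg_definite :: "complex^'n^'n \<Rightarrow> bool" where
  "nonneg_definite H \<longleftrightarrow>
     hermitian H \<and> (\<forall>v. 0 \<le> Re (\<Sum>i\<in>UNIV. cnj (v $ i) * (H *v v) $ i))"

text \<open>\<open>loewner_ge H1 H2\<close> is \<open>H1 \<ge> H2\<close> in the order of Hermitian matrices. It is not the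
  library's componentwise \<open>\<le>\<close> on vectors.\<close>

definition loewner_ge :: "complex^'n^'n \<Rightarrow> complex^'n^'n \<Rightarrow> bool" where
  "loewner_ge H1 H2 \<longleftrightarrow> hermitian H1 \<and> hermitian H2 \<and> nonneg_definite (H1 - H2)"

text \<open>Meant for Hermitian \<open>H\<close>: all eigenvalues are then real, so the set below is the whole
  spectrum, which is finite and nonempty.\<close>

definition lambda_max :: "complex^'n^'n \<Rightarrow> real" where
  "lambda_max H = Max {r. \<exists>v. v \<noteq> 0 \<and> H *v v = complex_of_real r *s v}"


section \<open>Filtrations and Wiener processes\<close>

text \<open>Only times \<open>t \<ge> 0\<close> matter. The usual conditions (completeness, right-continuity) are not
  assumed. (The library's \<open>filtration\<close> locale would constrain \<open>F t\<close> at negative \<open>t\<close>.)\<close>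

definition is_filtration :: "'a measure \<Rightarrow> (real \<Rightarrow> 'a measure) \<Rightarrow> bool" where
  "is_filtration M F \<longleftrightarrow>
     (\<forall>t\<ge>0. subalgebra M (F t)) \<and> (\<forall>s\<ge>0. \<forall>t\<ge>s. subalgebra (F t) (F s))"

definition measurable_adapted ::
    "'a measure \<Rightarrow> (real \<Rightarrow> 'a measure) \<Rightarrow> (real \<Rightarrow> 'a \<Rightarrow> 'v::topological_space) \<Rightarrow> bool" where
  "measurable_adapted M F X \<longleftrightarrow>
     (\<lambda>(t, \<omega>). X t \<omega>) \<in> borel_measurable (restrict_space borel {0..} \<Otimes>\<^sub>M M) \<and>
     (\<forall>t\<ge>0. X t \<in> borel_measurable (F t))"

text \<open>\<open>W i t\<close> is component \<open>i \<in> I\<close> at time \<open>t\<close>. Independence of the components is that of the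
  whole processes \<open>(W i t)\<close>, \<open>t \<ge> 0\<close>, and it is the joint increment of all components that is
  independent of \<open>F s\<close>.\<close>

definition wiener_process ::
    "'a measure \<Rightarrow> (real \<Rightarrow> 'a measure) \<Rightarrow> 'i set \<Rightarrow> ('i \<Rightarrow> real \<Rightarrow> 'a \<Rightarrow> real) \<Rightarrow> bool" where
  "wiener_process M F I W \<longleftrightarrow>
     (\<forall>i\<in>I. \<forall>t\<ge>0. W i t \<in> borel_measurable (F t)) \<and>
     (\<forall>i\<in>I. AE \<omega> in M. W i 0 \<omega> = 0) \<and>
     (\<forall>i\<in>I. AE \<omega> in M. continuous_on {0..} (\<lambda>t. W i t \<omega>)) \<and>
     (\<forall>i\<in>I. \<forall>s\<ge>0. \<forall>t>s.
        distributed M lborel (\<lambda>\<omega>. W i t \<omega> - W i s \<omega>) (normal_density 0 (sqrt (t - s)))) \<and>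
     prob_space.indep_vars M (\<lambda>i. \<Pi>\<^sub>M t\<in>{0..}. borel) (\<lambda>i \<omega>. \<lambda>t\<in>{0..}. W i t \<omega>) I \<and>
     (\<forall>s\<ge>0. \<forall>t\<ge>s. prob_space.indep_set M (sets (F s))
        {(\<lambda>\<omega>. \<lambda>i\<in>I. W i t \<omega> - W i s \<omega>) -` A \<inter> space M | A. A \<in> sets (\<Pi>\<^sub>M i\<in>I. borel)})"


section \<open>The Ito integral\<close>

text \<open>A simple process is given by times \<open>p 0 \<le> \<dots> \<le> p N\<close> and bounded, \<open>F (p k)\<close>-measurable
  values \<open>\<xi> k\<close> on \<open>(p k, p (k+1)]\<close>.\<close>

definition simple_integrand ::
    "'a measure \<Rightarrow> (real \<Rightarrow> 'a measure) \<Rightarrow> nat \<Rightarrow> (nat \<Rightarrow> real) \<Rightarrow>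
     (nat \<Rightarrow> 'a \<Rightarrow> 'v::euclidean_space) \<Rightarrow> bool" where
  "simple_integrand M F N p \<xi> \<longleftrightarrow>
     0 \<le> p 0 \<and> (\<forall>k<N. p k \<le> p (Suc k)) \<and>
     (\<forall>k<N. \<xi> k \<in> borel_measurable (F (p k)) \<and> bounded (\<xi> k ` space M))"

definition simple_process ::
    "nat \<Rightarrow> (nat \<Rightarrow> real) \<Rightarrow> (nat \<Rightarrow> 'a \<Rightarrow> 'v::euclidean_space) \<Rightarrow> real \<Rightarrow> 'a \<Rightarrow> 'v" where
  "simple_process N p \<xi> s \<omega> = (\<Sum>k<N. indicator {p k<..p (Suc k)} s *\<^sub>R \<xi> k \<omega>)"

definition simple_integral ::
    "(real \<Rightarrow> 'a \<Rightarrow> real) \<Rightarrow> nat \<Rightarrow> (nat \<Rightarrow> real) \<Rightarrow>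
     (nat \<Rightarrow> 'a \<Rightarrow> 'v::euclidean_space) \<Rightarrow> real \<Rightarrow> 'a \<Rightarrow> 'v" where
  "simple_integral w N p \<xi> t \<omega> =
     (\<Sum>k<N. (w (min t (p (Suc k))) \<omega> - w (min t (p k)) \<omega>) *\<^sub>R \<xi> k \<omega>)"

text \<open>\<open>J = \<integral>\<^sub>0\<^sup>t H dw\<close> for a scalar Wiener process \<open>w\<close> and a measurable adapted integrand \<open>H\<close> with
  \<open>\<integral>\<^sub>0\<^sup>t \<parallel>H\<parallel>\<^sup>2 ds < \<infinity>\<close> almost surely: \<open>J\<close> is the limit in probability of the integrals of simple
  processes \<open>H\<^sub>n\<close> for which \<open>\<integral>\<^sub>0\<^sup>t \<parallel>H - H\<^sub>n\<parallel>\<^sup>2 ds\<close> tends to 0 in probability. This determines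
  \<open>J\<close> up to almost sure equality.\<close>

definition has_ito_integral ::
    "'a measure \<Rightarrow> (real \<Rightarrow> 'a measure) \<Rightarrow> (real \<Rightarrow> 'a \<Rightarrow> real) \<Rightarrow> real \<Rightarrow>
     (real \<Rightarrow> 'a \<Rightarrow> 'v::euclidean_space) \<Rightarrow> ('a \<Rightarrow> 'v) \<Rightarrow> bool" where
  "has_ito_integral M F w t H J \<longleftrightarrow>
     measurable_adapted M F H \<and>
     (AE \<omega> in M. (\<integral>\<^sup>+s\<in>{0..t}. ennreal ((norm (H s \<omega>))\<^sup>2) \<partial>lborel) < \<infinity>) \<and>
     J \<in> borel_measurable M \<and>
     (\<exists>N p \<xi>. (\<forall>n. simple_integrand M F (N n) (p n) (\<xi> n)) \<and>
        (\<forall>\<epsilon>>0. (\<lambda>n. measure M {\<omega>\<in>space M. ennreal \<epsilon> <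
            (\<integral>\<^sup>+s\<in>{0..t}. ennreal ((norm (H s \<omega> - simple_process (N n) (p n) (\<xi> n) s \<omega>))\<^sup>2)
               \<partial>lborel)}) \<longlonglongrightarrow> 0) \<and>
        (\<forall>\<epsilon>>0. (\<lambda>n. measure M {\<omega>\<in>space M. \<epsilon> <
            norm (J \<omega> - simple_integral w (N n) (p n) (\<xi> n) t \<omega>)}) \<longlonglongrightarrow> 0))"


section \<open>Stochastic differential equations\<close>

text \<open>\<open>x\<close> solves \<open>dx(t) = b(t) dt + \<Sum>\<^sub>i \<sigma>\<^sub>i(t) dW\<^sub>i(t)\<close>, \<open>x(0) = x0\<close>, where \<open>b\<close> and \<open>\<sigma>\<close> may be built
  from \<open>x\<close> itself. Paths are continuous almost surely. Joint measurability of \<open>x\<close> is automatic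
  when all paths are continuous.\<close>

definition sde_solution ::
    "'a measure \<Rightarrow> (real \<Rightarrow> 'a measure) \<Rightarrow> 'i set \<Rightarrow> ('i \<Rightarrow> real \<Rightarrow> 'a \<Rightarrow> real) \<Rightarrow>
     (real \<Rightarrow> 'a \<Rightarrow> 'v) \<Rightarrow> ('i \<Rightarrow> real \<Rightarrow> 'a \<Rightarrow> 'v) \<Rightarrow> 'v \<Rightarrow>
     (real \<Rightarrow> 'a \<Rightarrow> 'v::euclidean_space) \<Rightarrow> bool" where
  "sde_solution M F I W b \<sigma> x0 x \<longleftrightarrow>
     measurable_adapted M F x \<and>
     (AE \<omega> in M. continuous_on {0..} (\<lambda>t. x t \<omega>)) \<and>
     (AE \<omega> in M. \<forall>t\<ge>0. set_integrable lborel {0..t} (\<lambda>s. b s \<omega>)) \<and>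
     (\<forall>t\<ge>0. \<exists>J. (\<forall>i\<in>I. has_ito_integral M F (W i) t (\<sigma> i) (J i)) \<and>
        (AE \<omega> in M. x t \<omega> = x0 + (LINT s:{0..t}|lborel. b s \<omega>) + (\<Sum>i\<in>I. J i \<omega>)))"

text \<open>The noise index set: \<open>Inl i\<close> with \<open>i = 1, \<dots>, \<ell>\<^sub>1\<close> are the multiplicative components of \<open>W\<close>,
  \<open>Inr j\<close> the additive ones. A natural number \<open>\<ell>\<^sub>1\<close> rather than an index type admits \<open>\<ell>\<^sub>1 = 0\<close>.\<close>

abbreviation noise_index :: "nat \<Rightarrow> (nat + 'l) set" where
  "noise_index l1 \<equiv> {1..l1} <+> UNIV"

definition linear_sde_solution ::
    "'a measure \<Rightarrow> (real \<Rightarrow> 'a measure) \<Rightarrow> nat \<Rightarrow> (nat + 'l::finite \<Rightarrow> real \<Rightarrow> 'a \<Rightarrow> real) \<Rightarrow>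
     real^'n^'n \<Rightarrow> real^'m^'n \<Rightarrow> (nat \<Rightarrow> real^'n^'n) \<Rightarrow> real^'l^'n \<Rightarrow>
     (real \<Rightarrow> 'a \<Rightarrow> real^'m) \<Rightarrow> real^'n \<Rightarrow> (real \<Rightarrow> 'a \<Rightarrow> real^'n) \<Rightarrow> bool" where
  "linear_sde_solution M F l1 W A B C D u x0 x \<longleftrightarrow>
     sde_solution M F (noise_index l1) W
       (\<lambda>s \<omega>. A *v x s \<omega> + B *v u s \<omega>)
       (case_sum (\<lambda>i s \<omega>. C i *v x s \<omega>) (\<lambda>j s \<omega>. column j D))
       x0 x"

end

theory Submission
  imports Defs
begin

text \<open>Let \<open>S = Re R\<close>, write the drift as \<open>b = A x + B u\<close> and the diffusion coefficients as \<open>\<sigma>\<^sub>i\<close>. Everything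
  rests on the energy identity
  \<open>E\<langle>x\<^sub>t, S x\<^sub>t\<rangle> = \<langle>x\<^sub>0, S x\<^sub>0\<rangle> + E \<integral>\<^sub>0\<^sup>t (2\<langle>b, S x\<rangle> + \<Sum>\<^sub>i \<langle>\<sigma>\<^sub>i, S \<sigma>\<^sub>i\<rangle>) ds\<close>.
  For a quadratic form it does not need the Ito formula: split \<open>x = y + m\<close> with \<open>y = x\<^sub>0 + \<integral> b ds\<close>, and use
  Fubini for \<open>y\<close>, the Ito isometry for \<open>m\<close> and the martingale property of \<open>m\<close> for the cross term.

  The stochastic integrals are only given as limits in probability, so \<open>E |x\<^sub>t|\<^sup>2 < \<infinity>\<close> has to be shown first.
  The energy \<open>Q\<^sub>t = \<integral>\<^sub>0\<^sup>t |x|\<^sup>2 ds\<close> replaces stopping times: dropping the steps of a simple process after which its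
  own quadratic variation exceeds \<open>c\<close> keeps it predictable, and in the limit gives
  \<open>E (|J|\<^sup>2; Q < c) \<le> E (min c Q)\<close> for \<open>J = \<integral> H dW\<close> with quadratic variation \<open>Q\<close>. Gronwall's lemma then bounds
  the truncated moments uniformly in \<open>c\<close>.

  Finally \<open>2\<langle>B u, S x\<rangle> \<ge> - \<phi>\<langle>x, S x\<rangle> - \<langle>B u, S B u\<rangle> / \<phi>\<close> and \<open>\<langle>B u, S B u\<rangle> \<le> \<beta> |u|\<^sup>2\<close> turn the identity into
  \<open>E\<langle>x\<^sub>t, S x\<^sub>t\<rangle> \<ge> (tr (D\<^sup>T S D) - \<beta> c / \<phi>) t\<close>, where \<open>c\<close> bounds the mean control energy; the factor of \<open>t\<close> is
  positive by assumption.\<close>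

section \<open>Square integrable functions\<close>

text \<open>The integral equation is given one time at a time: for each t there is some J, fixed
  only up to a null set and required to be measurable only with respect to \<open>M\<close>. Hence
  the martingale property is stated as E(Z . J_t) = E(Z . J_s) for test variables Z known at time s,
  and \<open>m\<close> is taken to be x - y, which is jointly measurable. In the cross term the test
  variable is the drift b_s, adapted because x and u are; Fubini brings it into that position.

  Gronwall's lemma needs a quantity known to be finite. E(min m Q_t) is at most m, and its integral
  inequality has constants free of m, so that the level m can be sent to infinity afterwards.

  The growth term \<open>\<phi>\<langle>x, S x\<rangle>\<close> is spent entirely on absorbing the
  control. What is left is the constant input of the additive noise, which is why the lower bound
  grows linearly in t and holds for every initial state, including 0.

  Replacing R by its real part is harmless: the state is real, and the imaginary part of a Hermitian
  matrix is antisymmetric, so it contributes nothing to the form at real vectors.\<close>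

definition sq_int :: "'b measure \<Rightarrow> ('b \<Rightarrow> 'v::euclidean_space) \<Rightarrow> bool" where
  "sq_int N f \<longleftrightarrow> f \<in> borel_measurable N \<and> integrable N (\<lambda>x. (norm (f x))\<^sup>2)"

text \<open>The square of the L2 norm, left without the root so that the Ito isometry is an equation
  between such numbers. A Bochner integral that does not exist is 0, so the value is meaningful only
  together with \<open>sq_int\<close>.\<close>

definition sq_norm :: "'b measure \<Rightarrow> ('b \<Rightarrow> 'v::euclidean_space) \<Rightarrow> real" where
  "sq_norm N f = (\<integral>x. (norm (f x))\<^sup>2 \<partial>N)"

lemma sq_int_measurable [measurable_dest]: "sq_int N f \<Longrightarrow> f \<in> borel_measurable N"
  by (simp add: sq_int_def)

lemma sq_int_integrable: "sq_int N f \<Longrightarrow> integrable N (\<lambda>x. (norm (f x))\<^sup>2)"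
  by (simp add: sq_int_def)

lemma sq_norm_nonneg [simp]: "0 \<le> sq_norm N f"
  by (simp add: sq_norm_def)

lemma norm_add_sq_le: "(norm (a + b))\<^sup>2 \<le> 2 * (norm a)\<^sup>2 + 2 * (norm b)\<^sup>2"
  for a b :: "'v::real_normed_vector"
proof -
  have "(norm (a + b))\<^sup>2 \<le> (norm a + norm b)\<^sup>2"
    by (intro power_mono norm_triangle_ineq) auto
  also have "\<dots> \<le> 2 * (norm a)\<^sup>2 + 2 * (norm b)\<^sup>2"
    using sum_squares_bound[of "norm a" "norm b"] by (simp add: power2_sum)
  finally show ?thesis .
qed

lemma norm_diff_sq_le: "(norm (a - b))\<^sup>2 \<le> 2 * (norm a)\<^sup>2 + 2 * (norm b)\<^sup>2"
  for a b :: "'v::real_normed_vector"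
  using norm_add_sq_le[of a "-b"] by simp

lemma abs_inner_le_sq: "\<bar>a \<bullet> b\<bar> \<le> (norm a)\<^sup>2 + (norm b)\<^sup>2"
  for a b :: "'v::real_inner"
proof -
  have "\<bar>a \<bullet> b\<bar> \<le> norm a * norm b" by (rule Cauchy_Schwarz_ineq2)
  also have "\<dots> \<le> (norm a)\<^sup>2 + (norm b)\<^sup>2"
    using sum_squares_bound[of "norm a" "norm b"] mult_nonneg_nonneg[OF norm_ge_zero norm_ge_zero, of a b] by linarith
  finally show ?thesis .
qed

lemma sq_int_bound:
  assumes "f \<in> borel_measurable N" "integrable N g" "AE x in N. (norm (f x))\<^sup>2 \<le> g x"
  shows "sq_int N f"
  unfolding sq_int_def
proof
  show "integrable N (\<lambda>x. (norm (f x))\<^sup>2)"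
    using assms by (intro Bochner_Integration.integrable_bound[OF assms(2)]) auto
qed (use assms in auto)

lemma sq_int_add [intro]: "sq_int N f \<Longrightarrow> sq_int N g \<Longrightarrow> sq_int N (\<lambda>x. f x + g x)"
  by (rule sq_int_bound[where g="\<lambda>x. 2 * (norm (f x))\<^sup>2 + 2 * (norm (g x))\<^sup>2"])
     (auto simp: sq_int_def norm_add_sq_le)

lemma sq_int_diff [intro]: "sq_int N f \<Longrightarrow> sq_int N g \<Longrightarrow> sq_int N (\<lambda>x. f x - g x)"
  by (rule sq_int_bound[where g="\<lambda>x. 2 * (norm (f x))\<^sup>2 + 2 * (norm (g x))\<^sup>2"])
     (auto simp: sq_int_def norm_diff_sq_le)

lemma sq_int_sum [intro]: "(\<And>i. i \<in> A \<Longrightarrow> sq_int N (f i)) \<Longrightarrow> sq_int N (\<lambda>x. \<Sum>i\<in>A. f i x)"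
  by (induction A rule: infinite_finite_induct) (auto simp: sq_int_def[of N "\<lambda>x. 0"])

lemma sq_int_const [intro]: "finite_measure N \<Longrightarrow> sq_int N (\<lambda>x. c)"
  by (simp add: sq_int_def finite_measure.integrable_const)

lemma sq_int_linear:
  assumes "bounded_linear T" "sq_int N f"
  shows "sq_int N (\<lambda>x. T (f x))"
proof -
  obtain K where K: "\<And>x. norm (T x) \<le> norm x * K"
    using bounded_linear.bounded[OF assms(1)] by blast
  have T [measurable]: "T \<in> borel_measurable borel"
    using assms(1) by (intro borel_measurable_continuous_onI linear_continuous_on)
  show ?thesis
  proof (rule sq_int_bound[where g="\<lambda>x. K\<^sup>2 * (norm (f x))\<^sup>2"])
    have "(norm (T (f x)))\<^sup>2 \<le> (norm (f x) * K)\<^sup>2" for x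
      by (intro power_mono K) auto
    then show "AE x in N. (norm (T (f x)))\<^sup>2 \<le> K\<^sup>2 * (norm (f x))\<^sup>2"
      by (simp add: power_mult_distrib mult.commute)
  qed (use assms in \<open>auto simp: sq_int_def\<close>)
qed

lemma sq_int_inner:
  assumes "sq_int N f" "sq_int N g"
  shows "integrable N (\<lambda>x. f x \<bullet> g x)"
  by (rule Bochner_Integration.integrable_bound
        [where f="\<lambda>x. (norm (f x))\<^sup>2 + (norm (g x))\<^sup>2"])
     (use assms abs_inner_le_sq in \<open>auto simp: sq_int_def\<close>)

lemma sq_int_imp_integrable:
  assumes "finite_measure N" "sq_int N f"
  shows "integrable N f"
proof (rule Bochner_Integration.integrable_bound[where f="\<lambda>x. 1 + (norm (f x))\<^sup>2"])
  have "norm (f x) \<le> 1 + (norm (f x))\<^sup>2" for x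
    using sum_squares_bound[of "norm (f x)" 1] norm_ge_zero[of "f x"] by (simp del: norm_ge_zero)
  then show "AE x in N. norm (f x) \<le> norm (1 + (norm (f x))\<^sup>2)" by auto
qed (use assms in \<open>auto simp: sq_int_def finite_measure.integrable_const\<close>)

lemma sq_norm_commute: "sq_norm N (\<lambda>x. f x - g x) = sq_norm N (\<lambda>x. g x - f x)"
  by (simp add: sq_norm_def norm_minus_commute)

lemma sq_norm_add_le:
  assumes "sq_int N f" "sq_int N g"
  shows "sq_norm N (\<lambda>x. f x + g x) \<le> 2 * sq_norm N f + 2 * sq_norm N g"
proof -
  have "sq_norm N (\<lambda>x. f x + g x) \<le> (\<integral>x. 2 * (norm (f x))\<^sup>2 + 2 * (norm (g x))\<^sup>2 \<partial>N)"
    unfolding sq_norm_def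
    by (intro integral_mono sq_int_integrable[OF sq_int_add[OF assms]] norm_add_sq_le)
       (use assms in \<open>auto simp: sq_int_def\<close>)
  then show ?thesis using assms by (simp add: sq_norm_def sq_int_def)
qed

lemma sq_norm_triangle:
  assumes "sq_int N f" "sq_int N g" "sq_int N h"
  shows "sq_norm N (\<lambda>x. f x - h x) \<le> 2 * sq_norm N (\<lambda>x. f x - g x) + 2 * sq_norm N (\<lambda>x. g x - h x)"
  using sq_norm_add_le[of N "\<lambda>x. f x - g x" "\<lambda>x. g x - h x"] assms by auto

lemma sq_norm_scaled_le:
  assumes "sq_int N f" "sq_int N g" "\<And>y. norm (g y) \<le> K * norm (f y)"
  shows "sq_norm N g \<le> K\<^sup>2 * sq_norm N f"
proof -
  have "sq_norm N g \<le> (\<integral>y. K\<^sup>2 * (norm (f y))\<^sup>2 \<partial>N)"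
    unfolding sq_norm_def
  proof (intro integral_mono sq_int_integrable assms integrable_mult_right)
    fix y
    have "(norm (g y))\<^sup>2 \<le> (K * norm (f y))\<^sup>2" by (intro power_mono assms) auto
    then show "(norm (g y))\<^sup>2 \<le> K\<^sup>2 * (norm (f y))\<^sup>2" by (simp add: power_mult_distrib)
  qed
  then show ?thesis by (simp add: sq_norm_def)
qed

lemma nn_integral_sq_norm:
  "sq_int N f \<Longrightarrow> (\<integral>\<^sup>+x. ennreal ((norm (f x))\<^sup>2) \<partial>N) = ennreal (sq_norm N f)"
  by (auto simp: sq_int_def sq_norm_def nn_integral_eq_integral)

lemma sq_intI_nn:
  assumes "f \<in> borel_measurable N" "(\<integral>\<^sup>+x. ennreal ((norm (f x))\<^sup>2) \<partial>N) < \<infinity>"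
  shows "sq_int N f"
  using assms unfolding sq_int_def by (auto intro!: integrableI_bounded)

text \<open>Pointwise Cauchy-Schwarz leaves the integral of a product of norms; its square is then
  estimated as a nonnegative integral in \<open>ennreal\<close>.\<close>

lemma inner_integral_Cauchy_Schwarz:
  assumes f: "sq_int N f" and g: "sq_int N g"
  shows "\<bar>\<integral>x. f x \<bullet> g x \<partial>N\<bar> \<le> sqrt (sq_norm N f) * sqrt (sq_norm N g)"
proof -
  have [measurable]: "f \<in> borel_measurable N" "g \<in> borel_measurable N"
    using f g by (auto simp: sq_int_def)
  have i: "integrable N (\<lambda>x. norm (f x) * norm (g x))"
    by (rule Bochner_Integration.integrable_bound[where f="\<lambda>x. (norm (f x))\<^sup>2 + (norm (g x))\<^sup>2"])
       (use f g abs_inner_le_sq[of "norm _" "norm _"] in \<open>auto simp: sq_int_def\<close>)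
  have "\<bar>\<integral>x. f x \<bullet> g x \<partial>N\<bar> \<le> (\<integral>x. norm (f x) * norm (g x) \<partial>N)" (is "_ \<le> ?r")
    by (rule order_trans[OF integral_abs_bound])
       (intro integral_mono integrable_abs sq_int_inner f g i Cauchy_Schwarz_ineq2)
  also have "?r \<le> sqrt (sq_norm N f * sq_norm N g)"
  proof (rule real_le_rsqrt)
    have "(ennreal ?r)\<^sup>2 = (\<integral>\<^sup>+x. ennreal (norm (f x)) * ennreal (norm (g x)) \<partial>N)\<^sup>2"
      using i by (simp add: nn_integral_eq_integral flip: ennreal_mult)
    also have "\<dots> \<le> (\<integral>\<^sup>+x. ennreal (norm (f x))^2 \<partial>N) * (\<integral>\<^sup>+x. ennreal (norm (g x))^2 \<partial>N)"
      by (rule Cauchy_Schwarz_nn_integral) auto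
    also have "\<dots> = ennreal (sq_norm N f * sq_norm N g)"
      using nn_integral_sq_norm[OF f] nn_integral_sq_norm[OF g]
      by (simp add: ennreal_power ennreal_mult)
    finally show "?r\<^sup>2 \<le> sq_norm N f * sq_norm N g"
      by (subst (asm) ennreal_power) (auto simp: integral_nonneg)
  qed
  finally show ?thesis by (simp add: real_sqrt_mult)
qed

text \<open>Continuity of the L2 inner product. It carries the isometry and the martingale property
  from simple processes to their L2 limits.\<close>

lemma inner_integral_tendsto:
  assumes X: "\<And>n. sq_int N (X n)" "sq_int N X'" "(\<lambda>n. sq_norm N (\<lambda>x. X n x - X' x)) \<longlonglongrightarrow> 0"
    and Y: "\<And>n. sq_int N (Y n)" "sq_int N Y'" "(\<lambda>n. sq_norm N (\<lambda>x. Y n x - Y' x)) \<longlonglongrightarrow> 0"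
  shows "(\<lambda>n. \<integral>x. X n x \<bullet> Y n x \<partial>N) \<longlonglongrightarrow> (\<integral>x. X' x \<bullet> Y' x \<partial>N)"
proof -
  define a where "a n = sqrt (sq_norm N (\<lambda>x. X n x - X' x))" for n
  define b where "b n = sqrt (sq_norm N (\<lambda>x. Y n x - Y' x))" for n
  have a: "a \<longlonglongrightarrow> 0" and b: "b \<longlonglongrightarrow> 0"
    unfolding a_def b_def using tendsto_real_sqrt[OF X(3)] tendsto_real_sqrt[OF Y(3)] by auto
  have d: "sq_int N (\<lambda>x. X n x - X' x)" "sq_int N (\<lambda>x. Y n x - Y' x)" for n
    using X Y by auto
  have "(\<lambda>n. (\<integral>x. X n x \<bullet> Y n x \<partial>N) - (\<integral>x. X' x \<bullet> Y' x \<partial>N)) \<longlonglongrightarrow> 0"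
  proof (rule Lim_null_comparison)
    show "(\<lambda>n. a n * b n + a n * sqrt (sq_norm N Y') + sqrt (sq_norm N X') * b n) \<longlonglongrightarrow> 0"
      by (rule tendsto_eq_intros a b refl | simp)+
    show "\<forall>\<^sub>F n in sequentially. norm ((\<integral>x. X n x \<bullet> Y n x \<partial>N) - (\<integral>x. X' x \<bullet> Y' x \<partial>N))
       \<le> a n * b n + a n * sqrt (sq_norm N Y') + sqrt (sq_norm N X') * b n"
    proof (rule always_eventually, rule allI)
      fix n
      note i = sq_int_inner[OF d(1)[of n] d(2)[of n]] sq_int_inner[OF d(1)[of n] Y(2)]
        sq_int_inner[OF X(2) d(2)[of n]] sq_int_inner[OF X(2) Y(2)]
      \<comment> \<open>With dX = X n - X' and dY = Y n - Y', the difference of the products is dX .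
        dY + dX . Y' + X' . dY; Cauchy-Schwarz bounds each term.\<close>
      have "(\<lambda>x. X n x \<bullet> Y n x) = (\<lambda>x. ((X n x - X' x) \<bullet> (Y n x - Y' x) + (X n x - X' x) \<bullet> Y' x)
         + (X' x \<bullet> (Y n x - Y' x) + X' x \<bullet> Y' x))"
        by (simp add: inner_diff_left inner_diff_right)
      then have "(\<integral>x. X n x \<bullet> Y n x \<partial>N) =
         ((\<integral>x. (X n x - X' x) \<bullet> (Y n x - Y' x) \<partial>N) + (\<integral>x. (X n x - X' x) \<bullet> Y' x \<partial>N))
         + ((\<integral>x. X' x \<bullet> (Y n x - Y' x) \<partial>N) + (\<integral>x. X' x \<bullet> Y' x \<partial>N))"
        using i by (simp only: Bochner_Integration.integral_add Bochner_Integration.integrable_add)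
      then show "norm ((\<integral>x. X n x \<bullet> Y n x \<partial>N) - (\<integral>x. X' x \<bullet> Y' x \<partial>N))
       \<le> a n * b n + a n * sqrt (sq_norm N Y') + sqrt (sq_norm N X') * b n"
        using inner_integral_Cauchy_Schwarz[OF d(1)[of n] d(2)[of n]]
          inner_integral_Cauchy_Schwarz[OF d(1)[of n] Y(2)]
          inner_integral_Cauchy_Schwarz[OF X(2) d(2)[of n]]
        unfolding a_def b_def real_norm_def by linarith
    qed
  qed
  then show ?thesis by (rule LIM_zero_cancel)
qed

lemma sq_norm_tendsto:
  assumes X: "\<And>n. sq_int N (X n)" "sq_int N X'" "(\<lambda>n. sq_norm N (\<lambda>x. X n x - X' x)) \<longlonglongrightarrow> 0"
  shows "(\<lambda>n. sq_norm N (X n)) \<longlonglongrightarrow> sq_norm N X'"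
  using inner_integral_tendsto[OF X X] by (simp add: sq_norm_def power2_norm_eq_inner)

section \<open>Wiener increments\<close>

locale wiener = prob_space M for M :: "'a measure" +
  fixes F :: "real \<Rightarrow> 'a measure" and I :: "'i set" and W :: "'i \<Rightarrow> real \<Rightarrow> 'a \<Rightarrow> real"
  assumes filt: "is_filtration M F" and wien: "wiener_process M F I W"
begin

lemma space_F [simp]: "0 \<le> t \<Longrightarrow> space (F t) = space M"
  using filt by (auto simp: is_filtration_def subalgebra_def)

lemma measurable_F_M: "0 \<le> t \<Longrightarrow> f \<in> measurable (F t) N \<Longrightarrow> f \<in> measurable M N"
  using filt measurable_from_subalg unfolding is_filtration_def by blast

lemma measurable_F_mono: "0 \<le> s \<Longrightarrow> s \<le> t \<Longrightarrow> f \<in> measurable (F s) N \<Longrightarrow> f \<in> measurable (F t) N"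
  using filt measurable_from_subalg unfolding is_filtration_def by blast

lemma W_F: "i \<in> I \<Longrightarrow> 0 \<le> s \<Longrightarrow> s \<le> t \<Longrightarrow> W i s \<in> borel_measurable (F t)"
  using wien measurable_F_mono[of s t "W i s" borel] by (auto simp: wiener_process_def)

lemma W_M: "i \<in> I \<Longrightarrow> 0 \<le> s \<Longrightarrow> W i s \<in> borel_measurable M"
  using W_F[of i s s] measurable_F_M by auto

lemma increment_moments:
  assumes i: "i \<in> I" and st: "0 \<le> s" "s \<le> t"
  shows "integrable M (\<lambda>w. W i t w - W i s w)" (is "integrable M ?X")
    and "expectation (\<lambda>w. W i t w - W i s w) = 0"
    and "integrable M (\<lambda>w. (W i t w - W i s w)\<^sup>2)" (is ?C)
    and "expectation (\<lambda>w. (W i t w - W i s w)\<^sup>2) = t - s" (is ?D)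
proof -
  have "integrable M ?X \<and> expectation ?X = 0 \<and> ?C \<and> ?D"
  \<comment> \<open>\<open>wiener_process\<close> provides a normal density only for s < t; for s =
    t the increment is identically 0.\<close>
  proof (cases "s = t")
    case False
    with st have pos: "0 < sqrt (t - s)" by simp
    have D: "distributed M lborel ?X (normal_density 0 (sqrt (t - s)))"
      using wien i st False by (auto simp: wiener_process_def)
    have e: "expectation ?X = 0"
      using normal_distributed_expectation[OF pos D] .
    have "variance ?X = t - s"
      using normal_distributed_variance[OF pos D] st by simp
    then have v: "expectation (\<lambda>w. (?X w)\<^sup>2) = t - s"
      using e by simp
    have m1: "integrable lborel (\<lambda>x. normal_density 0 (sqrt (t - s)) x * x)"
      by (rule integrable_normal_moment_nz_1[OF pos])
    have m2: "integrable lborel (\<lambda>x. normal_density 0 (sqrt (t - s)) x * (x - 0)^2)"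
      by (rule integrable_normal_moment[OF pos])
    have "integrable M (\<lambda>w. ?X w)"
      using m1 by (subst distributed_integrable[OF D, of "\<lambda>x. x", symmetric]) auto
    moreover have "integrable M (\<lambda>w. (?X w)\<^sup>2)"
      using m2 by (subst distributed_integrable[OF D, of "\<lambda>x. x\<^sup>2", symmetric]) auto
    ultimately show ?thesis using e v by blast
  qed (simp add: prob_space)
  then show "integrable M ?X" "expectation ?X = 0" ?C ?D by blast+
qed

lemma indep_increments:
  assumes i: "i \<in> I" and j: "j \<in> I" and ij: "i \<noteq> j" and st: "0 \<le> s" "s \<le> t"
  shows "indep_var borel (\<lambda>w. W i t w - W i s w) borel (\<lambda>w. W j t w - W j s w)"
proof -
  let ?P = "\<Pi>\<^sub>M t\<in>{0..}. (borel :: real measure)"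
  have "indep_vars (\<lambda>i. ?P) (\<lambda>i w. \<lambda>t\<in>{0..}. W i t w) I"
    using wien by (simp add: wiener_process_def)
  moreover have "(\<lambda>f. f t - f s) \<in> borel_measurable ?P"
    using st by (intro borel_measurable_diff measurable_component_singleton) auto
  ultimately have "indep_vars (\<lambda>i. borel) (\<lambda>i w. (\<lambda>t\<in>{0..}. W i t w) t - (\<lambda>t\<in>{0..}. W i t w) s) I"
    by (intro indep_vars_compose2[where Y="\<lambda>i f. f t - f s" and M'="\<lambda>i. ?P"])
  then have ind: "indep_vars (\<lambda>i. borel) (\<lambda>i w. W i t w - W i s w) I"
    using st by simp
  show ?thesis
    using indep_var_compose[OF indep_var_restrict[OF ind, of "{i}" "{j}"],
        of "\<lambda>f. f i" borel "\<lambda>f. f j" borel] i j ij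
    by (simp add: comp_def)
qed

text \<open>The definition of a Wiener process speaks of events: those of \<open>F s\<close> and the
  preimages under the joint increment. X and a function g of the joint increment generate smaller
  sigma-algebras, so they inherit the independence.\<close>

lemma indep_F_increments:
  assumes s: "0 \<le> s" "s \<le> t" and X: "X \<in> borel_measurable (F s)"
    and g: "g \<in> borel_measurable (\<Pi>\<^sub>M i\<in>I. (borel :: real measure))"
  shows "indep_var borel X borel (\<lambda>w. g (\<lambda>i\<in>I. W i t w - W i s w) :: real)"
proof -
  let ?D = "\<lambda>w. \<lambda>i\<in>I. W i t w - W i s w"
  let ?P = "\<Pi>\<^sub>M i\<in>I. (borel :: real measure)"
  have D [measurable]: "?D \<in> measurable M ?P"
    using s W_M by (intro measurable_restrict borel_measurable_diff) auto
  have ind: "indep_set (sets (F s)) {?D -` A \<inter> space M | A. A \<in> sets ?P}"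
    using wien s by (simp add: wiener_process_def)
  have sub: "sigma_sets (space M) {X -` A \<inter> space M |A. A \<in> sets borel} \<subseteq> sets (F s)"
  proof -
    have "sigma_sets (space (F s)) {X -` A \<inter> space M |A. A \<in> sets borel} \<subseteq> sets (F s)"
      using measurable_sets[OF X] s by (intro sets.sigma_sets_subset) auto
    then show ?thesis using s by simp
  qed
  have sa: "sigma_sets (space M) {(\<lambda>w. g (?D w)) -` A \<inter> space M |A. A \<in> sets (borel::real measure)}
     \<subseteq> {?D -` A \<inter> space M | A. A \<in> sets ?P}"
  proof -
    \<comment> \<open>The preimages already form a sigma-algebra, so closing the smaller family
      under sigma operations does not leave them.\<close>
    have v: "sets (vimage_algebra (space M) ?D ?P) = {?D -` A \<inter> space M | A. A \<in> sets ?P}"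
      using measurable_space[OF D] by (intro sets_vimage_algebra2) auto
    have "{(\<lambda>w. g (?D w)) -` A \<inter> space M |A. A \<in> sets (borel::real measure)}
       \<subseteq> {?D -` A \<inter> space M | A. A \<in> sets ?P}"
    proof safe
      fix A :: "real set" assume "A \<in> sets borel"
      then have "g -` A \<inter> space ?P \<in> sets ?P" using g by measurable
      moreover have "(\<lambda>w. g (?D w)) -` A \<inter> space M = ?D -` (g -` A \<inter> space ?P) \<inter> space M"
        using measurable_space[OF D] by auto
      ultimately show "\<exists>Aa. (\<lambda>w. g (?D w)) -` A \<inter> space M = ?D -` Aa \<inter> space M \<and> Aa \<in> sets ?P"
        by blast
    qed
    then show ?thesis
      using sets.sigma_sets_subset[of _ "vimage_algebra (space M) ?D ?P"] v by simp
  qed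
  show ?thesis
    unfolding indep_var_eq
  proof (intro conjI)
    show "random_variable borel X" using measurable_F_M[OF s(1) X] .
    show "random_variable borel (\<lambda>w. g (?D w))" using g by measurable
    show "indep_set (sigma_sets (space M) {X -` A \<inter> space M |A. A \<in> sets borel})
       (sigma_sets (space M) {(\<lambda>w. g (?D w)) -` A \<inter> space M |A. A \<in> sets (borel::real measure)})"
      using ind sub sa unfolding indep_sets2_eq by (meson subset_iff)
  qed
qed

lemma increment_orthogonal_F:
  assumes i: "i \<in> I" and st: "0 \<le> s" "s \<le> t"
    and X: "X \<in> borel_measurable (F s)" "integrable M X"
  shows "integrable M (\<lambda>w. X w * (W i t w - W i s w))" (is ?A)
    and "expectation (\<lambda>w. X w * (W i t w - W i s w)) = 0" (is ?B)
proof -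
  have "indep_var borel X borel (\<lambda>w. W i t w - W i s w)"
    using indep_F_increments[OF st X(1), of "\<lambda>f. f i"] i by simp
  note indep_var_integrable[OF this X(2)] indep_var_lebesgue_integral[OF this X(2)]
  then show ?A ?B using increment_moments[OF i st] by simp_all
qed

text \<open>The product of two components' increments is a function of the joint increment. This is
  where the independence of \<open>F s\<close> from all components together is used; independence of
  each component separately would not give it.\<close>

lemma increment_product_F:
  assumes i: "i \<in> I" and j: "j \<in> I" and st: "0 \<le> s" "s \<le> t"
    and X: "X \<in> borel_measurable (F s)" "integrable M X"
  shows "integrable M (\<lambda>w. X w * ((W i t w - W i s w) * (W j t w - W j s w)))" (is ?A)
    and "expectation (\<lambda>w. X w * ((W i t w - W i s w) * (W j t w - W j s w))) =
      expectation X * (if i = j then t - s else 0)" (is ?B)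
proof -
  let ?Y = "\<lambda>w. (W i t w - W i s w) * (W j t w - W j s w)"
  have Y: "integrable M ?Y" "expectation ?Y = (if i = j then t - s else 0)"
  proof -
    have "integrable M ?Y \<and> expectation ?Y = (if i = j then t - s else 0)"
    proof (cases "i = j")
      case True
      then show ?thesis using increment_moments[OF i st] by (simp add: power2_eq_square)
    next
      case False
      note indep_increments[OF i j False st]
      from indep_var_integrable[OF this] indep_var_lebesgue_integral[OF this] False
      show ?thesis using increment_moments[OF i st] increment_moments[OF j st] by simp
    qed
    then show "integrable M ?Y" "expectation ?Y = (if i = j then t - s else 0)" by blast+
  qed
  have "indep_var borel X borel ?Y"
    using indep_F_increments[OF st X(1), of "\<lambda>f. f i * f j"] i j by simp
  note indep_var_integrable[OF this X(2) Y(1)] indep_var_lebesgue_integral[OF this X(2) Y(1)]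
  then show ?A ?B using Y by simp_all
qed

lemma integrable_bounded_mult:
  assumes "X \<in> borel_measurable M" "\<And>w. w \<in> space M \<Longrightarrow> \<bar>X w\<bar> \<le> K" "integrable M Y"
  shows "integrable M (\<lambda>w. X w * Y w :: real)"
proof (rule Bochner_Integration.integrable_bound[where f="\<lambda>w. K * Y w"])
  have "\<bar>X w\<bar> * \<bar>Y w\<bar> \<le> \<bar>K\<bar> * \<bar>Y w\<bar>" if "w \<in> space M" for w
    using assms(2)[OF that] by (intro mult_right_mono) auto
  then show "AE w in M. norm (X w * Y w) \<le> norm (K * Y w)"
    by (auto simp: abs_mult)
qed (use assms in auto)

lemma two_interval_le:
  assumes i: "i \<in> I" and j: "j \<in> I" and ab: "0 \<le> a" "a \<le> b" and cd: "c \<le> d" and ac: "a \<le> c"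
    and X: "X \<in> borel_measurable (F c)" "\<And>w. w \<in> space M \<Longrightarrow> \<bar>X w\<bar> \<le> K"
  shows "integrable M (\<lambda>w. X w * ((W i b w - W i a w) * (W j d w - W j c w))) \<and>
    expectation (\<lambda>w. X w * ((W i b w - W i a w) * (W j d w - W j c w))) =
      (if i = j then max 0 (min b d - max a c) else 0) * expectation X"
proof -
  have c0: "0 \<le> c" using ab ac by simp
  note XM = measurable_F_M[OF c0 X(1)]
  have Xi: "integrable M X"
    using integrable_bounded_mult[OF XM X(2), of "\<lambda>_. 1"] by (simp add: integrable_const)
  have incr: "integrable M (\<lambda>w. X w * (W k v w - W k u w))" if "k \<in> I" "0 \<le> u" "u \<le> v" for k u v
    by (rule integrable_bounded_mult[OF XM X(2) increment_moments(1)]) (use that in auto)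
  have Xm: "(\<lambda>w. X w * (W k v w - W k u w)) \<in> borel_measurable (F r)"
    if "k \<in> I" "0 \<le> u" "u \<le> v" "v \<le> r" "c \<le> r" for k u v r
    using that measurable_F_mono[OF c0 \<open>c \<le> r\<close> X(1)] W_F[of k u r] W_F[of k v r] by auto
  \<comment> \<open>The last factor is an increment that starts at v', when everything in front of
    it is already known.\<close>
  have Z: "integrable M (\<lambda>w. X w * (W k v w - W k u w) * (W l r w - W l v' w))"
    "expectation (\<lambda>w. X w * (W k v w - W k u w) * (W l r w - W l v' w)) = 0"
    if "k \<in> I" "l \<in> I" "0 \<le> u" "u \<le> v" "v \<le> v'" "c \<le> v'" "v' \<le> r" for k l u v v' r
    using increment_orthogonal_F[of l v' r, OF _ _ _ Xm[of k u v v'] incr[of k u v]] that by auto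
  show ?thesis
  proof (cases "b \<le> c")
    case True
    then show ?thesis
      using Z[of i j a b c d] i j ab cd ac by (simp add: mult.assoc)
  next
    case False
    define e where "e = min b d"
    have e: "c \<le> e" "e \<le> b" "e \<le> d" "e = b \<or> e = d" using False cd by (auto simp: e_def)
    \<comment> \<open>Splitting at c and at e leaves one product over the common interval from c to
      e, and three in which one increment lies after all the rest. The product of the two parts
      after e is missing because e is b or d, so one of these parts is 0.\<close>
    have eq: "X w * ((W i b w - W i a w) * (W j d w - W j c w)) =
       X w * (W i c w - W i a w) * (W j d w - W j c w)
       + X w * ((W i e w - W i c w) * (W j e w - W j c w))
       + X w * (W i e w - W i c w) * (W j d w - W j e w)
       + X w * (W j e w - W j c w) * (W i b w - W i e w)" for w
      using e(4) by (auto simp: algebra_simps)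
    note z1 = Z[of i j a c c d, OF i j ab(1) ac order_refl order_refl cd]
    note z2 = increment_product_F[OF i j c0 e(1) X(1) Xi]
    note z3 = Z[of i j c e e d, OF i j c0 e(1) order_refl e(1) e(3)]
    note z4 = Z[of j i c e e b, OF j i c0 e(1) order_refl e(1) e(2)]
    have "max 0 (min b d - max a c) = e - c" using e ac by (auto simp: e_def)
    then show ?thesis
      unfolding eq using z1 z2 z3 z4 by simp
  qed
qed

text \<open>The intervals are arbitrary because two simple processes need not share a partition; no
  common refinement is ever formed. X is known at the later left endpoint, as is the product of two
  coefficients.\<close>

lemma two_interval:
  assumes i: "i \<in> I" and j: "j \<in> I" and ab: "0 \<le> a" "a \<le> b" and cd: "0 \<le> c" "c \<le> d"
    and X: "X \<in> borel_measurable (F (max a c))" "\<And>w. w \<in> space M \<Longrightarrow> \<bar>X w\<bar> \<le> K"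
  shows "integrable M (\<lambda>w. X w * ((W i b w - W i a w) * (W j d w - W j c w)))" (is ?A)
    and "expectation (\<lambda>w. X w * ((W i b w - W i a w) * (W j d w - W j c w))) =
      (if i = j then max 0 (min b d - max a c) else 0) * expectation X" (is ?B)
proof -
  have "?A \<and> ?B"
  proof (cases "a \<le> c")
    case True
    then show ?thesis using two_interval_le[of i j a b c d X K] assms by (simp add: max_absorb2)
  next
    case False
    then have "max a c = a" by simp
    then show ?thesis using two_interval_le[of j i c d a b X K] assms False
      by (simp add: max.commute min.commute mult.commute eq_commute[of i j])
  qed
  then show ?A ?B by blast+
qed

end

section \<open>Integrals of simple processes\<close>

text \<open>Time as a finite measure space of its own, so that the facts about \<open>sq_int\<close>
  and Fubini apply alike to paths, random variables and processes.\<close>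

abbreviation lb :: "real \<Rightarrow> real measure" where
  "lb t \<equiv> restrict_space lborel {0..t}"

text \<open>Processes take the time first, while the product space has the sample point as its first
  coordinate.\<close>

abbreviation proc :: "(real \<Rightarrow> 'a \<Rightarrow> 'v) \<Rightarrow> 'a \<times> real \<Rightarrow> 'v" where
  "proc H \<equiv> \<lambda>z. H (snd z) (fst z)"

lemma finite_measure_lb [simp, intro]: "finite_measure (lb t)"
  by (rule finite_measureI) (simp add: emeasure_restrict_space emeasure_lborel_Icc_eq)

lemma sigma_finite_lb [simp, intro]: "sigma_finite_measure (lb t)"
  using finite_measure_lb finite_measure.axioms(1) by blast

lemma measure_lb_UNIV: "0 \<le> t \<Longrightarrow> measure (lb t) (space (lb t)) = t"
  by (simp add: measure_restrict_space)

lemma measurable_lb_borel: "f \<in> borel_measurable borel \<Longrightarrow> f \<in> borel_measurable (lb t)"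
  by (simp add: measurable_restrict_space1)

lemma borel_measurable_proc:
  assumes "measurable_adapted M F H"
  shows "proc H \<in> borel_measurable (M \<Otimes>\<^sub>M lb t)"
proof -
  have H: "(\<lambda>(s, w). H s w) \<in> borel_measurable (restrict_space borel {0..} \<Otimes>\<^sub>M M)"
    using assms by (simp add: measurable_adapted_def)
  have "(\<lambda>x. x) \<in> measurable (lb t) (restrict_space borel {0..})"
    by (rule measurable_restrict_space2) (auto simp: space_restrict_space intro: measurable_restrict_space1)
  then have "(\<lambda>z. (snd z, fst z)) \<in> measurable (M \<Otimes>\<^sub>M lb t) (restrict_space borel {0..} \<Otimes>\<^sub>M M)"
    by (intro measurable_Pair measurable_fst measurable_compose[OF measurable_snd])
  from measurable_compose[OF this H] show ?thesis by simp
qed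

lemma integral_double_sum:
  fixes f :: "'i \<Rightarrow> 'j \<Rightarrow> 'b \<Rightarrow> 'v::euclidean_space"
  assumes "\<And>k l. k \<in> A \<Longrightarrow> l \<in> B \<Longrightarrow> integrable Q (f k l)"
  shows "(\<integral>z. (\<Sum>k\<in>A. \<Sum>l\<in>B. f k l z) \<partial>Q) = (\<Sum>k\<in>A. \<Sum>l\<in>B. integral\<^sup>L Q (f k l))"
proof -
  have "(\<integral>z. (\<Sum>k\<in>A. \<Sum>l\<in>B. f k l z) \<partial>Q) = (\<Sum>k\<in>A. \<integral>z. (\<Sum>l\<in>B. f k l z) \<partial>Q)"
    by (rule Bochner_Integration.integral_sum) (auto intro!: Bochner_Integration.integrable_sum simp: assms)
  also have "\<dots> = (\<Sum>k\<in>A. \<Sum>l\<in>B. integral\<^sup>L Q (f k l))"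
    by (intro sum.cong refl Bochner_Integration.integral_sum) (simp add: assms)
  finally show ?thesis .
qed

lemma simple_integrand_nonneg:
  assumes "simple_integrand M F N p X" "k \<le> N"
  shows "0 \<le> p k"
  using assms(2)
proof (induction k)
  case (Suc k)
  then have "0 \<le> p k" "p k \<le> p (Suc k)" using assms(1) by (auto simp: simple_integrand_def)
  then show ?case by simp
qed (use assms in \<open>auto simp: simple_integrand_def\<close>)

lemma simple_integrand_mono:
  assumes "simple_integrand M F N p X" "j \<le> k" "k \<le> N"
  shows "p j \<le> p k"
  using assms(2,3)
proof (induction k rule: dec_induct)
  case (step k)
  then have "p j \<le> p k" "p k \<le> p (Suc k)" using assms(1) by (auto simp: simple_integrand_def)
  then show ?case by simp
qed auto

lemma simple_integrand_bound:
  assumes "simple_integrand M F N p X" "k < N"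
  obtains K where "0 \<le> K" "\<And>w. w \<in> space M \<Longrightarrow> norm (X k w) \<le> K"
proof -
  have "bounded (X k ` space M)" using assms by (auto simp: simple_integrand_def)
  then obtain K where K: "K > 0" "\<And>w. w \<in> space M \<Longrightarrow> norm (X k w) \<le> K"
    unfolding bounded_pos by auto
  show ?thesis by (rule that[of K]) (use K in auto)
qed

text \<open>The overlap length here is the one found for Wiener increments in
  \<open>two_interval\<close>, with right endpoints cut at t. Their agreement is the Ito isometry
  for a pair of steps.\<close>

lemma interval_overlap:
  assumes "0 \<le> a" "0 \<le> c"
  shows "(\<integral>s. indicator {a<..b} s * indicator {c<..d} s \<partial>lb t) = max 0 (min t (min b d) - max a c)"
proof -
  have "(\<integral>s. indicator {a<..b} s * indicator {c<..d} s \<partial>lb t) = (\<integral>s. indicat_real {max a c<..min t (min b d)} s \<partial>lborel)"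
    using assms by (simp only: integral_restrict_space sets_lborel sets.Int_space_eq2 space_lborel
        borel_closed closed_atLeastAtMost Int_UNIV_right)
      (intro Bochner_Integration.integral_cong; auto simp: indicator_def)
  also have "\<dots> = max 0 (min t (min b d) - max a c)"
    by (cases "max a c \<le> min t (min b d)") (auto simp: max_def)
  finally show ?thesis .
qed

context wiener
begin

abbreviation MT :: "real \<Rightarrow> ('a \<times> real) measure" where
  "MT t \<equiv> M \<Otimes>\<^sub>M lb t"

lemma finite_pair: "finite_measure (MT t)"
  by (intro finite_measure_pair_measure finite_measure_axioms finite_measure_lb)

lemma pair_sigma: "pair_sigma_finite M (lb t)"
  by (simp add: pair_sigma_finite_def sigma_finite_measure_axioms)

lemma simple_integrand_M:
  assumes "simple_integrand M F N p X" "k < N"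
  shows "X k \<in> borel_measurable M"
  using measurable_F_M[of "p k"] simple_integrand_nonneg[OF assms(1), of k] assms
  by (auto simp: simple_integrand_def)

lemma simple_integrand_F:
  assumes "simple_integrand M F N p X" "k < N" "p k \<le> s"
  shows "X k \<in> borel_measurable (F s)"
  using measurable_F_mono[of "p k" s] simple_integrand_nonneg[OF assms(1), of k] assms
  by (auto simp: simple_integrand_def)

lemma sq_int_simple_process:
  assumes "simple_integrand M F N p X"
  shows "sq_int (MT t) (proc (simple_process N p X))"
  unfolding simple_process_def
proof (rule sq_int_sum)
  fix k assume k: "k \<in> {..<N}"
  with assms have [measurable]: "X k \<in> borel_measurable M" by (intro simple_integrand_M) auto
  have [measurable]: "(indicator {p k<..p (Suc k)} :: real \<Rightarrow> real) \<in> borel_measurable (lb t)"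
    by (intro measurable_lb_borel) auto
  obtain K where K: "0 \<le> K" "\<And>w. w \<in> space M \<Longrightarrow> norm (X k w) \<le> K"
    using simple_integrand_bound[OF assms, of k] k by auto
  show "sq_int (MT t) (\<lambda>z. indicator {p k<..p (Suc k)} (snd z) *\<^sub>R X k (fst z))"
  proof (rule sq_int_bound[where g="\<lambda>_. K\<^sup>2"])
    show "AE x in MT t. (norm (indicat_real {p k<..p (Suc k)} (snd x) *\<^sub>R X k (fst x)))\<^sup>2 \<le> K\<^sup>2"
      using K by (intro AE_I2 power_mono) (auto simp: indicator_def space_pair_measure)
  qed (auto intro: finite_measure.integrable_const[OF finite_pair])
qed

lemma sq_int_increment:
  assumes "i \<in> I" "0 \<le> a" "a \<le> b" and X: "X \<in> borel_measurable M"
    and K: "\<And>w. w \<in> space M \<Longrightarrow> norm (X w) \<le> K"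
  shows "sq_int M (\<lambda>w. (W i b w - W i a w) *\<^sub>R (X w :: 'v::euclidean_space))"
proof (rule sq_int_bound[where g="\<lambda>w. K\<^sup>2 * (W i b w - W i a w)\<^sup>2"])
  have [measurable]: "X \<in> borel_measurable M" "W i a \<in> borel_measurable M" "W i b \<in> borel_measurable M"
    using X W_M assms(1-3) by auto
  show "(\<lambda>w. (W i b w - W i a w) *\<^sub>R X w) \<in> borel_measurable M"
    by measurable
  show "integrable M (\<lambda>w. K\<^sup>2 * (W i b w - W i a w)\<^sup>2)"
    using increment_moments(3)[OF assms(1-3)] by simp
  show "AE w in M. (norm ((W i b w - W i a w) *\<^sub>R X w))\<^sup>2 \<le> K\<^sup>2 * (W i b w - W i a w)\<^sup>2"
    using K by (intro AE_I2) (auto simp: power_mult_distrib mult.commute intro!: mult_right_mono power_mono)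
qed

lemma sq_int_simple_integral:
  assumes "simple_integrand M F N p X" "i \<in> I" "0 \<le> t"
  shows "sq_int M (simple_integral (W i) N p X t)"
proof -
  have "sq_int M (\<lambda>w. \<Sum>k<N. (W i (min t (p (Suc k))) w - W i (min t (p k)) w) *\<^sub>R X k w)"
  proof (rule sq_int_sum)
    fix k assume k: "k \<in> {..<N}"
    obtain K where K: "0 \<le> K" "\<And>w. w \<in> space M \<Longrightarrow> norm (X k w) \<le> K"
      using simple_integrand_bound[OF assms(1), of k] k by auto
    show "sq_int M (\<lambda>w. (W i (min t (p (Suc k))) w - W i (min t (p k)) w) *\<^sub>R X k w)"
      using k assms simple_integrand_nonneg[OF assms(1), of k] simple_integrand_mono[OF assms(1), of k "Suc k"]
      by (intro sq_int_increment[OF _ _ _ simple_integrand_M[OF assms(1)] K(2)]) auto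
  qed
  then show ?thesis by (simp add: simple_integral_def[abs_def])
qed

lemma integral_product:
  fixes f :: "'a \<Rightarrow> real" and g :: "real \<Rightarrow> real"
  assumes "integrable (MT t) (\<lambda>z. f (fst z) * g (snd z))"
  shows "(\<integral>z. f (fst z) * g (snd z) \<partial>MT t) = expectation f * (\<integral>s. g s \<partial>lb t)"
proof -
  interpret pair_sigma_finite M "lb t" by (rule pair_sigma)
  show ?thesis using integral_fst'[OF assms] by simp
qed

text \<open>Both sides are double sums over pairs of steps and agree term by term. Allowing i and j
  to differ also gives the orthogonality of integrals against different components.\<close>

lemma simple_isometry:
  assumes X: "simple_integrand M F N p X" and \<zeta>: "simple_integrand M F N' q \<zeta>"
    and i: "i \<in> I" and j: "j \<in> I" and t: "0 \<le> t"
  shows "expectation (\<lambda>w. simple_integral (W i) N p X t w \<bullet> simple_integral (W j) N' q \<zeta> t w) =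
    (if i = j then (\<integral>z. proc (simple_process N p X) z \<bullet> proc (simple_process N' q \<zeta>) z \<partial>MT t) else 0)"
proof -
  define L where "L k l w = ((W i (min t (p (Suc k))) w - W i (min t (p k)) w) *\<^sub>R X k w) \<bullet>
      ((W j (min t (q (Suc l))) w - W j (min t (q l)) w) *\<^sub>R \<zeta> l w)" for k l w
  define G where "G k l z = (X k (fst z) \<bullet> \<zeta> l (fst z)) *
      (indicator {p k<..p (Suc k)} (snd z) * indicator {q l<..q (Suc l)} (snd z))" for k l and z :: "'a \<times> real"
  have LG: "integrable M (L k l) \<and> integrable (MT t) (G k l) \<and>
     expectation (L k l) = (if i = j then integral\<^sup>L (MT t) (G k l) else 0)"
    if kl: "k < N" "l < N'" for k l
  proof -
    obtain K where K: "0 \<le> K" "\<And>w. w \<in> space M \<Longrightarrow> norm (X k w) \<le> K"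
      using simple_integrand_bound[OF X, of k] kl by auto
    obtain K' where K': "0 \<le> K'" "\<And>w. w \<in> space M \<Longrightarrow> norm (\<zeta> l w) \<le> K'"
      using simple_integrand_bound[OF \<zeta>, of l] kl by auto
    have p: "0 \<le> p k" "p k \<le> p (Suc k)" and q: "0 \<le> q l" "q l \<le> q (Suc l)"
      using simple_integrand_nonneg[OF X, of k] simple_integrand_mono[OF X, of k "Suc k"]
        simple_integrand_nonneg[OF \<zeta>, of l] simple_integrand_mono[OF \<zeta>, of l "Suc l"] kl by auto
    note [measurable] = simple_integrand_M[OF X kl(1)] simple_integrand_M[OF \<zeta> kl(2)]
    have X_bound: "\<bar>X k w \<bullet> \<zeta> l w\<bar> \<le> K * K'" if "w \<in> space M" for w
      using Cauchy_Schwarz_ineq2[of "X k w" "\<zeta> l w"] mult_mono[OF K(2)[OF that] K'(2)[OF that] K(1)]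
      by simp
    have G_int: "integrable (MT t) (G k l)"
    proof (rule finite_measure.integrable_const_bound[OF finite_pair, where B="K * K'"])
      have [measurable]: "(indicator {p k<..p (Suc k)} :: real \<Rightarrow> real) \<in> borel_measurable (lb t)"
        "(indicator {q l<..q (Suc l)} :: real \<Rightarrow> real) \<in> borel_measurable (lb t)"
        by (intro measurable_lb_borel; auto)+
      show "G k l \<in> borel_measurable (MT t)"
        unfolding G_def by measurable
      show "AE z in MT t. norm (G k l z) \<le> K * K'"
        using X_bound K K' by (intro AE_I2) (auto simp: G_def indicator_def space_pair_measure)
    qed
    have G_eq: "integral\<^sup>L (MT t) (G k l) =
        expectation (\<lambda>w. X k w \<bullet> \<zeta> l w) * max 0 (min t (min (p (Suc k)) (q (Suc l))) - max (p k) (q l))"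
      using integral_product[of t "\<lambda>w. X k w \<bullet> \<zeta> l w"
          "\<lambda>s. indicator {p k<..p (Suc k)} s * indicator {q l<..q (Suc l)} s"] G_int p q
      by (simp add: G_def[abs_def] interval_overlap)
    show ?thesis
    \<comment> \<open>A step that begins after t has both endpoints cut to t, so its increment
      vanishes; its overlap with \<open>{0..t}\<close> is empty as well.\<close>
    proof (cases "p k \<le> t \<and> q l \<le> t")
      case True
      have XF: "(\<lambda>w. X k w \<bullet> \<zeta> l w) \<in> borel_measurable (F (max (p k) (q l)))"
        using simple_integrand_F[OF X kl(1)] simple_integrand_F[OF \<zeta> kl(2)] by auto
      have L: "L k l = (\<lambda>w. (X k w \<bullet> \<zeta> l w) * ((W i (min t (p (Suc k))) w - W i (p k) w)
          * (W j (min t (q (Suc l))) w - W j (q l) w)))"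
        using True by (auto simp: L_def fun_eq_iff min_absorb2)
      have mm: "min (min t (p (Suc k))) (min t (q (Suc l))) = min t (min (p (Suc k)) (q (Suc l)))"
        by (auto simp: min_def)
      show ?thesis
        using two_interval[OF i j p(1) _ q(1) _ XF X_bound, of "min t (p (Suc k))" "min t (q (Suc l))"]
          True p q G_int G_eq
        unfolding L mm by auto
    next
      case False
      then have L: "L k l = (\<lambda>w. 0)" using p q
        by (auto simp: L_def fun_eq_iff min_absorb1)
      have "max 0 (min t (min (p (Suc k)) (q (Suc l))) - max (p k) (q l)) = 0"
        using False by auto
      then show ?thesis using L G_int G_eq by simp
    qed
  qed
  have "expectation (\<lambda>w. simple_integral (W i) N p X t w \<bullet> simple_integral (W j) N' q \<zeta> t w) =
      expectation (\<lambda>w. \<Sum>k<N. \<Sum>l<N'. L k l w)"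
    by (simp only: simple_integral_def L_def inner_sum_left inner_sum_right)
       (subst sum.swap, rule refl)
  also have "\<dots> = (\<Sum>k<N. \<Sum>l<N'. expectation (L k l))"
    using LG by (intro integral_double_sum) auto
  also have "\<dots> = (if i = j then (\<Sum>k<N. \<Sum>l<N'. integral\<^sup>L (MT t) (G k l)) else 0)"
    using LG by simp
  also have "(\<Sum>k<N. \<Sum>l<N'. integral\<^sup>L (MT t) (G k l)) =
      (\<integral>z. (\<Sum>k<N. \<Sum>l<N'. G k l z) \<partial>MT t)"
    using LG by (intro integral_double_sum[symmetric]) auto
  also have "(\<lambda>z. \<Sum>k<N. \<Sum>l<N'. G k l z) =
      (\<lambda>z. proc (simple_process N p X) z \<bullet> proc (simple_process N' q \<zeta>) z)"
    unfolding simple_process_def G_def inner_sum_left inner_sum_right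
    by (subst sum.swap) (auto simp: mult_ac)
  finally show ?thesis .
qed

text \<open>Of each step only the part between s and t enters the difference, and at the left end of
  that part both Z and the coefficient are known. Boundedness of the coefficient lets Z be merely
  square integrable.\<close>

lemma simple_martingale:
  assumes X: "simple_integrand M F N p X" and i: "i \<in> I" and st: "0 \<le> s" "s \<le> t"
    and Z: "Z \<in> borel_measurable (F s)" "sq_int M Z"
  shows "expectation (\<lambda>w. Z w \<bullet> simple_integral (W i) N p X t w) =
    expectation (\<lambda>w. Z w \<bullet> simple_integral (W i) N p X s w)"
proof -
  define L where "L k w = Z w \<bullet> (((W i (min t (p (Suc k))) w - W i (min t (p k)) w)
     - (W i (min s (p (Suc k))) w - W i (min s (p k)) w)) *\<^sub>R X k w)" for k w
  have L: "integrable M (L k) \<and> expectation (L k) = 0" if k: "k < N" for k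
  proof (cases "p k \<le> t")
    case False
    then have "L k = (\<lambda>w. 0)" using simple_integrand_mono[OF X, of k "Suc k"] k st
      by (auto simp: L_def fun_eq_iff min_absorb1)
    then show ?thesis by simp
  next
    case True
    obtain K where K: "0 \<le> K" "\<And>w. w \<in> space M \<Longrightarrow> norm (X k w) \<le> K"
      using simple_integrand_bound[OF X, of k] k by auto
    have p: "0 \<le> p k" "p k \<le> p (Suc k)"
      using simple_integrand_nonneg[OF X, of k] simple_integrand_mono[OF X, of k "Suc k"] k by auto
    \<comment> \<open>The step intersected with the interval from s to t; it degenerates to the
      point s when the step ends before s.\<close>
    define a b where "a = max s (p k)" and "b = max s (min t (p (Suc k)))"
    have ab: "0 \<le> a" "a \<le> b" using p st True by (auto simp: a_def b_def)
    have eq: "L k = (\<lambda>w. (Z w \<bullet> X k w) * (W i b w - W i a w))"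
      using p st True by (auto simp: L_def a_def b_def fun_eq_iff min_def max_def)
    have m: "(\<lambda>w. Z w \<bullet> X k w) \<in> borel_measurable (F a)"
      using measurable_F_mono[OF st(1) _ Z(1), of a] simple_integrand_F[OF X k, of a]
      by (auto simp: a_def)
    have "sq_int M (X k)"
      by (rule sq_int_bound[where g="\<lambda>_. K\<^sup>2"])
        (use K in \<open>auto intro!: AE_I2 power_mono simple_integrand_M[OF X k] simp: integrable_const\<close>)
    then have "integrable M (\<lambda>w. Z w \<bullet> X k w)"
      using Z by (intro sq_int_inner)
    then show ?thesis
      unfolding eq using increment_orthogonal_F[OF i ab m] by simp
  qed
  have "expectation (\<lambda>w. Z w \<bullet> simple_integral (W i) N p X t w) -
    expectation (\<lambda>w. Z w \<bullet> simple_integral (W i) N p X s w) =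
    expectation (\<lambda>w. Z w \<bullet> simple_integral (W i) N p X t w - Z w \<bullet> simple_integral (W i) N p X s w)"
    using Z st i by (intro Bochner_Integration.integral_diff[symmetric] sq_int_inner sq_int_simple_integral[OF X]) auto
  also have "(\<lambda>w. Z w \<bullet> simple_integral (W i) N p X t w - Z w \<bullet> simple_integral (W i) N p X s w) =
     (\<lambda>w. \<Sum>k<N. L k w)"
    by (simp add: L_def simple_integral_def fun_eq_iff scaleR_diff_left inner_diff_right
        flip: inner_diff_right inner_sum_right sum_subtractf)
  also have "expectation \<dots> = 0" using L by simp
  finally show ?thesis by simp
qed

end

section \<open>Truncation and approximation\<close>

lemma sq_norm_diff_expand:
  assumes f: "sq_int Q f" and g: "sq_int Q g"
  shows "sq_norm Q (\<lambda>x. f x - g x) =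
     (\<integral>x. f x \<bullet> f x \<partial>Q) - 2 * (\<integral>x. f x \<bullet> g x \<partial>Q) + (\<integral>x. g x \<bullet> g x \<partial>Q)"
proof -
  have eq: "(norm (f x - g x))\<^sup>2 = f x \<bullet> f x - 2 * (f x \<bullet> g x) + g x \<bullet> g x" for x
    by (simp add: power2_norm_eq_inner inner_diff_left inner_diff_right inner_commute)
  show ?thesis
    unfolding sq_norm_def eq
    using sq_int_inner[OF f f] sq_int_inner[OF f g] sq_int_inner[OF g g] by simp
qed

definition truncate ::
    "real \<Rightarrow> real \<Rightarrow> (nat \<Rightarrow> real) \<Rightarrow> (nat \<Rightarrow> 'a \<Rightarrow> 'v::euclidean_space) \<Rightarrow> nat \<Rightarrow> 'a \<Rightarrow> 'v" where
  "truncate t c p X k w =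
     (if (\<Sum>j\<le>k. (min t (p (Suc j)) - min t (p j)) * (norm (X j w))\<^sup>2) \<le> c then X k w else 0)"

text \<open>The intervals of the partition are disjoint, so at any time at most one summand is
  nonzero and no mixed products arise.\<close>

lemma norm_simple_process:
  assumes p: "\<And>k. k < N \<Longrightarrow> p k \<le> p (Suc k)"
  shows "(norm (simple_process N p X s w))\<^sup>2 =
    (\<Sum>k<N. indicator {p k<..p (Suc k)} s * (norm (X k w))\<^sup>2)"
proof (cases "\<exists>k<N. s \<in> {p k<..p (Suc k)}")
  case True
  then obtain k where k: "k < N" "s \<in> {p k<..p (Suc k)}" by blast
  have mono: "p a \<le> p b" if "a \<le> b" "b \<le> N" for a b
    using that
  proof (induction b rule: dec_induct)
    case (step n)
    then show ?case using p[of n] by simp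
  qed simp
  have nk: "s \<notin> {p l<..p (Suc l)}" if "l < N" "l \<noteq> k" for l
    using k mono[of "Suc l" k] mono[of "Suc k" l] that by (cases "l < k") auto
  have "simple_process N p X s w = (\<Sum>l<N. if l = k then X k w else 0)"
    unfolding simple_process_def by (intro sum.cong) (use nk k in auto)
  moreover have "(\<Sum>k<N. indicator {p k<..p (Suc k)} s * (norm (X k w))\<^sup>2) =
     (\<Sum>l<N. if l = k then (norm (X k w))\<^sup>2 else 0)"
    by (intro sum.cong) (use nk k in auto)
  ultimately show ?thesis using k by simp
next
  case False
  then have "simple_process N p X s w = (\<Sum>k<N. 0)"
    unfolding simple_process_def by (intro sum.cong) auto
  moreover have "(\<Sum>k<N. indicator {p k<..p (Suc k)} s * (norm (X k w))\<^sup>2) = (\<Sum>k<N. 0)"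
    using False by (intro sum.cong) auto
  ultimately show ?thesis by simp
qed

lemma sq_int_simple_path: "sq_int (lb t) (\<lambda>s. simple_process N p X s w)"
  unfolding simple_process_def
proof (rule sq_int_sum)
  fix k
  have "(\<lambda>s. indicat_real {p k<..p (Suc k)} s *\<^sub>R X k w) \<in> borel_measurable (lb t)"
    by (intro measurable_lb_borel) auto
  then show "sq_int (lb t) (\<lambda>s. indicator {p k<..p (Suc k)} s *\<^sub>R X k w)"
    by (rule sq_int_bound[where g="\<lambda>_. (norm (X k w))\<^sup>2"])
      (auto simp: finite_measure.integrable_const intro!: AE_I2 split: split_indicator)
qed

lemma sq_norm_simple_path:
  assumes X: "simple_integrand M F N p X" and t: "0 \<le> t"
  shows "sq_norm (lb t) (\<lambda>s. simple_process N p X s w) =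
    (\<Sum>k<N. (min t (p (Suc k)) - min t (p k)) * (norm (X k w))\<^sup>2)"
proof -
  have p: "p k \<le> p (Suc k)" if "k < N" for k using X that by (simp add: simple_integrand_def)
  have ind: "integrable (lb t) (indicat_real {p k<..p (Suc k)}) \<and>
      integral\<^sup>L (lb t) (indicat_real {p k<..p (Suc k)}) = min t (p (Suc k)) - min t (p k)"
    if k: "k < N" for k
  proof
    show "integrable (lb t) (indicat_real {p k<..p (Suc k)})"
      by (rule finite_measure.integrable_const_bound[where B=1])
         (auto simp: indicator_def intro!: measurable_lb_borel)
    show "integral\<^sup>L (lb t) (indicat_real {p k<..p (Suc k)}) = min t (p (Suc k)) - min t (p k)"
    proof -
      have "(\<lambda>s. indicat_real {p k<..p (Suc k)} s * indicat_real {p k<..p (Suc k)} s) = indicat_real {p k<..p (Suc k)}"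
        by (auto simp: indicator_def)
      then have "integral\<^sup>L (lb t) (indicat_real {p k<..p (Suc k)}) = max 0 (min t (p (Suc k)) - p k)"
        using interval_overlap[of "p k" "p k" t "p (Suc k)" "p (Suc k)"]
          simple_integrand_nonneg[OF X, of k] k by (simp only: min.idem max.idem)
      also have "\<dots> = min t (p (Suc k)) - min t (p k)"
        using p[OF k] by (auto simp: max_def min_def)
      finally show ?thesis .
    qed
  qed
  have "sq_norm (lb t) (\<lambda>s. simple_process N p X s w) =
      (\<integral>s. (\<Sum>k<N. indicator {p k<..p (Suc k)} s * (norm (X k w))\<^sup>2) \<partial>lb t)"
    by (simp add: sq_norm_def norm_simple_process[of N p, OF p])
  also have "\<dots> = (\<Sum>k<N. \<integral>s. indicator {p k<..p (Suc k)} s * (norm (X k w))\<^sup>2 \<partial>lb t)"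
    using ind by (intro Bochner_Integration.integral_sum integrable_mult_left) auto
  also have "\<dots> = (\<Sum>k<N. (min t (p (Suc k)) - min t (p k)) * (norm (X k w))\<^sup>2)"
    using ind by (intro sum.cong) auto
  finally show ?thesis .
qed

lemma truncate_eq:
  assumes X: "simple_integrand M F N p X" and t: "0 \<le> t"
    and le: "sq_norm (lb t) (\<lambda>s. simple_process N p X s w) \<le> c" and k: "k < N"
  shows "truncate t c p X k w = X k w"
proof -
  have "(\<Sum>j\<le>k. (min t (p (Suc j)) - min t (p j)) * (norm (X j w))\<^sup>2)
     \<le> (\<Sum>j<N. (min t (p (Suc j)) - min t (p j)) * (norm (X j w))\<^sup>2)"
    using X k by (intro sum_mono2) (auto simp: simple_integrand_def)
  also have "\<dots> \<le> c" using le sq_norm_simple_path[OF X t] by simp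
  finally show ?thesis by (simp add: truncate_def)
qed

text \<open>The substitute for localisation: where the energy of a path stays at or below c,
  truncation changes neither the path nor, pathwise, its integral.\<close>

lemma truncate_process_eq:
  assumes "simple_integrand M F N p X" "0 \<le> t"
    "sq_norm (lb t) (\<lambda>s. simple_process N p X s w) \<le> c"
  shows "simple_process N p (truncate t c p X) s w = simple_process N p X s w"
    "simple_integral B N p (truncate t c p X) r w = simple_integral B N p X r w"
  using truncate_eq[OF assms] by (simp_all add: simple_process_def simple_integral_def)

lemma sum_stopped_le:
  fixes a :: "nat \<Rightarrow> real"
  assumes "\<And>k. k < N \<Longrightarrow> 0 \<le> a k" "0 \<le> c"
  shows "(\<Sum>k<N. if (\<Sum>j\<le>k. a j) \<le> c then a k else 0) \<le> min c (\<Sum>k<N. a k)"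
  using assms(1)
proof (induction N)
  case (Suc N)
  then have IH: "(\<Sum>k<N. if (\<Sum>j\<le>k. a j) \<le> c then a k else 0) \<le> min c (\<Sum>k<N. a k)" and aN: "0 \<le> a N"
    by auto
  have eq: "(\<Sum>j\<le>N. a j) = (\<Sum>k<N. a k) + a N" by (simp add: lessThan_Suc_atMost[symmetric])
  show ?case using IH aN eq by auto
qed (use assms in auto)

context wiener
begin

lemma simple_integrand_truncate:
  assumes X: "simple_integrand M F N p X"
  shows "simple_integrand M F N p (truncate t c p X)"
  unfolding simple_integrand_def
proof (intro conjI allI impI)
  fix k assume k: "k < N"
  have *: "X j \<in> borel_measurable (F (p k))" if "j \<le> k" for j
    using that k simple_integrand_mono[OF X, of j k] by (intro simple_integrand_F[OF X]) auto
  show "truncate t c p X k \<in> borel_measurable (F (p k))"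
    unfolding truncate_def by (intro measurable_If borel_measurable_le measurable_const
      borel_measurable_sum borel_measurable_times borel_measurable_power measurable_compose[OF _ borel_measurable_norm] * pred_intros_logic) auto
  obtain K where K: "0 \<le> K" "\<And>w. w \<in> space M \<Longrightarrow> norm (X k w) \<le> K"
    using simple_integrand_bound[OF X, of k] k by auto
  show "bounded (truncate t c p X k ` space M)"
    using K by (auto intro!: boundedI[where B=K] simp: truncate_def)
qed (use X in \<open>auto simp: simple_integrand_def\<close>)

lemma truncate_path_le:
  assumes X: "simple_integrand M F N p X" and t: "0 \<le> t" and c: "0 \<le> c"
  shows "sq_norm (lb t) (\<lambda>s. simple_process N p (truncate t c p X) s w) \<le>
     min c (sq_norm (lb t) (\<lambda>s. simple_process N p X s w))"
proof -
  let ?a = "\<lambda>k. (min t (p (Suc k)) - min t (p k)) * (norm (X k w))\<^sup>2"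
  have "(\<Sum>k<N. (min t (p (Suc k)) - min t (p k)) * (norm (truncate t c p X k w))\<^sup>2) =
     (\<Sum>k<N. if (\<Sum>j\<le>k. ?a j) \<le> c then ?a k else 0)"
    by (intro sum.cong) (auto simp: truncate_def)
  also have "\<dots> \<le> min c (\<Sum>k<N. ?a k)"
    using X c by (intro sum_stopped_le) (auto simp: simple_integrand_def)
  finally show ?thesis
    by (simp add: sq_norm_simple_path[OF X t] sq_norm_simple_path[OF simple_integrand_truncate[OF X] t])
qed

lemma path_measurable:
  assumes "G \<in> borel_measurable (MT t)" "w \<in> space M"
  shows "(\<lambda>s. G (w, s)) \<in> borel_measurable (lb t)"
  using measurable_compose[OF measurable_Pair1'[OF assms(2)] assms(1)] by simp

lemma borel_measurable_path_sq_norm: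
  assumes [measurable]: "proc H \<in> borel_measurable (MT t)"
  shows "(\<lambda>w. sq_norm (lb t) (\<lambda>s. H s w)) \<in> borel_measurable M"
proof -
  interpret L: sigma_finite_measure "lb t" by simp
  have "(\<lambda>(w, s). (norm (H s w))\<^sup>2) \<in> borel_measurable (MT t)"
    unfolding split_beta' by measurable
  then show ?thesis unfolding sq_norm_def
    by (rule L.borel_measurable_lebesgue_integral)
qed

lemma sq_norm_product:
  assumes "sq_int (MT t) (proc H)"
  shows "sq_norm (MT t) (proc H) = expectation (\<lambda>w. sq_norm (lb t) (\<lambda>s. H s w))"
    and "integrable M (\<lambda>w. sq_norm (lb t) (\<lambda>s. H s w))"
    and "AE w in M. sq_int (lb t) (\<lambda>s. H s w)"
proof -
  interpret pair_sigma_finite M "lb t" by (rule pair_sigma)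
  have i: "integrable (MT t) (\<lambda>z. (norm (proc H z))\<^sup>2)"
    using assms by (rule sq_int_integrable)
  show "sq_norm (MT t) (proc H) = expectation (\<lambda>w. sq_norm (lb t) (\<lambda>s. H s w))"
    using integral_fst'[OF i] by (simp add: sq_norm_def)
  show "integrable M (\<lambda>w. sq_norm (lb t) (\<lambda>s. H s w))"
    using integrable_fst'[OF i] by (simp add: sq_norm_def)
  have "AE w in M. integrable (lb t) (\<lambda>s. (norm (H s w))\<^sup>2)"
    using AE_integrable_fst'[OF i] by simp
  then show "AE w in M. sq_int (lb t) (\<lambda>s. H s w)"
    using path_measurable[OF sq_int_measurable[OF assms]]
    by (auto simp: sq_int_def)
qed

lemma simple_isometry_norm:
  assumes X: "simple_integrand M F N p X" and i: "i \<in> I" and t: "0 \<le> t"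
  shows "sq_norm M (simple_integral (W i) N p X t) =
    sq_norm (MT t) (proc (simple_process N p X))"
  using simple_isometry[OF X X i i t] by (simp add: sq_norm_def power2_norm_eq_inner)

text \<open>For variables between 0 and 1 convergence to 0 in probability is convergence in L1, and
  an L1 null sequence has an almost surely null subsequence.\<close>

lemma AE_subsequence:
  fixes Y :: "nat \<Rightarrow> 'a \<Rightarrow> real"
  assumes [measurable]: "\<And>n. Y n \<in> borel_measurable M"
    and Y: "\<And>n w. w \<in> space M \<Longrightarrow> 0 \<le> Y n w" "\<And>n w. w \<in> space M \<Longrightarrow> Y n w \<le> 1"
    and P: "\<And>\<epsilon>. 0 < \<epsilon> \<Longrightarrow> (\<lambda>n. prob {w\<in>space M. \<epsilon> < Y n w}) \<longlonglongrightarrow> 0"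
  shows "\<exists>r. strict_mono r \<and> (AE w in M. (\<lambda>n. Y (r n) w) \<longlonglongrightarrow> 0)"
proof -
  have int: "integrable M (Y n)" for n
    by (rule integrable_const_bound[where B=1]) (use Y in auto)
  have "(\<lambda>n. expectation (\<lambda>w. norm (Y n w))) \<longlonglongrightarrow> 0"
  proof (rule LIMSEQ_I)
    fix e :: real assume e: "0 < e"
    then have "eventually (\<lambda>n. prob {w\<in>space M. e / 2 < Y n w} < e / 2) sequentially"
      using P[of "e / 2"] by (intro order_tendstoD(2)) auto
    then obtain n0 where n0: "\<And>n. n \<ge> n0 \<Longrightarrow> prob {w\<in>space M. e / 2 < Y n w} < e / 2"
      by (auto simp: eventually_sequentially)
    have "norm (expectation (\<lambda>w. norm (Y n w)) - 0) < e" if "n \<ge> n0" for n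
    proof -
      have i2: "integrable M (\<lambda>w. e / 2 + indicat_real {w\<in>space M. e / 2 < Y n w} w)"
        by (intro Bochner_Integration.integrable_add integrable_const integrable_const_bound[where B=1]) auto
      \<comment> \<open>Where Y is at most e / 2 the first summand suffices; elsewhere Y is at most
        1, which the indicator pays for.\<close>
      have "expectation (\<lambda>w. norm (Y n w)) \<le> expectation (\<lambda>w. e / 2 + indicat_real {w\<in>space M. e / 2 < Y n w} w)"
      proof (intro integral_mono integrable_norm int i2)
        fix w assume "w \<in> space M"
        then show "norm (Y n w) \<le> e / 2 + indicat_real {w\<in>space M. e / 2 < Y n w} w"
          using Y[of w n] e by (cases "e / 2 < Y n w") auto
      qed
      also have "\<dots> = e / 2 + prob {w\<in>space M. e / 2 < Y n w}"
        by (subst Bochner_Integration.integral_add) (auto simp: prob_space intro!: integrable_const_bound[where B=1])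
      finally show ?thesis using n0[OF that] by simp
    qed
    then show "\<exists>n0. \<forall>n\<ge>n0. norm (expectation (\<lambda>w. norm (Y n w)) - 0) < e" by blast
  qed
  with int show ?thesis by (rule tendsto_L1_AE_subseq)
qed

end

section \<open>The Ito isometry\<close>

lemma tendsto_0_of_min:
  fixes D :: "nat \<Rightarrow> real"
  assumes "(\<lambda>n. min 1 (D n)) \<longlonglongrightarrow> 0"
  shows "D \<longlonglongrightarrow> 0"
proof (rule Lim_transform_eventually[OF assms])
  have "eventually (\<lambda>n. min 1 (D n) < 1) sequentially"
    using assms by (rule order_tendstoD(2)) simp
  then show "eventually (\<lambda>n. min 1 (D n) = D n) sequentially"
    by eventually_elim auto
qed

lemma has_ito_integral_measurable:
  assumes "has_ito_integral M F w t H J"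
  shows "proc H \<in> borel_measurable (M \<Otimes>\<^sub>M lb r)"
proof -
  have "measurable_adapted M F H" using assms by (simp add: has_ito_integral_def)
  then show ?thesis by (rule borel_measurable_proc)
qed

section \<open>Almost sure approximation and the truncated Ito inequality\<close>

context wiener
begin

text \<open>The approximation in \<open>has_ito_integral\<close> with both limits in probability
  replaced by almost sure ones. Truncation acts path by path, so pathwise limits are what it can be
  combined with.\<close>

definition path_approx :: "'i \<Rightarrow> real \<Rightarrow> (real \<Rightarrow> 'a \<Rightarrow> 'v::euclidean_space) \<Rightarrow> ('a \<Rightarrow> 'v) \<Rightarrow>
    (nat \<Rightarrow> nat) \<Rightarrow> (nat \<Rightarrow> nat \<Rightarrow> real) \<Rightarrow> (nat \<Rightarrow> nat \<Rightarrow> 'a \<Rightarrow> 'v) \<Rightarrow> bool" where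
  "path_approx i t H J N p X \<longleftrightarrow>
     (\<forall>n. simple_integrand M F (N n) (p n) (X n)) \<and>
     (AE w in M. sq_int (lb t) (\<lambda>s. H s w) \<and>
        (\<lambda>n. sq_norm (lb t) (\<lambda>s. H s w - simple_process (N n) (p n) (X n) s w)) \<longlonglongrightarrow> 0 \<and>
        (\<lambda>n. simple_integral (W i) (N n) (p n) (X n) t w) \<longlonglongrightarrow> J w)"

lemma has_ito_integral_path_approx:
  assumes ito: "has_ito_integral M F (W i) t H J" and i: "i \<in> I" and t: "0 \<le> t"
  shows "\<exists>N p X. path_approx i t H J N p X"
proof -
  have Hm [measurable]: "proc H \<in> borel_measurable (MT t)"
    by (rule has_ito_integral_measurable[OF ito])
  have J [measurable]: "J \<in> borel_measurable M" using ito by (simp add: has_ito_integral_def)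
  from ito obtain N p X where X: "\<And>n. simple_integrand M F (N n) (p n) (X n)"
    and D0: "\<And>\<epsilon>. \<epsilon> > 0 \<Longrightarrow> (\<lambda>n. prob {w\<in>space M. ennreal \<epsilon> <
            (\<integral>\<^sup>+s\<in>{0..t}. ennreal ((norm (H s w - simple_process (N n) (p n) (X n) s w))\<^sup>2)
               \<partial>lborel)}) \<longlonglongrightarrow> 0"
    and J0: "\<And>\<epsilon>. \<epsilon> > 0 \<Longrightarrow> (\<lambda>n. prob {w\<in>space M. \<epsilon> <
            norm (J w - simple_integral (W i) (N n) (p n) (X n) t w)}) \<longlonglongrightarrow> 0"
    unfolding has_ito_integral_def by blast
  define S where "S n = simple_process (N n) (p n) (X n)" for n
  define V where "V n = simple_integral (W i) (N n) (p n) (X n) t" for n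
  have S [measurable]: "(proc (S n)) \<in> borel_measurable (MT t)" for n
    using sq_int_simple_process[OF X, of t n] by (simp add: S_def sq_int_def)
  have V [measurable]: "V n \<in> borel_measurable M" for n
    using sq_int_simple_integral[OF X i t] by (simp add: V_def sq_int_def)
  have nn: "(\<integral>\<^sup>+s\<in>{0..t}. f s \<partial>lborel) = (\<integral>\<^sup>+s. f s \<partial>lb t)" for f
    by (simp add: nn_integral_restrict_space)
  define D where "D n w = sq_norm (lb t) (\<lambda>s. H s w - S n s w)" for n w
  have D [measurable]: "D n \<in> borel_measurable M" for n
    unfolding D_def by (intro borel_measurable_path_sq_norm[of "\<lambda>s w. H s w - S n s w"]) measurable
  have Hs: "AE w in M. sq_int (lb t) (\<lambda>s. H s w)"
  proof -
    have "AE w in M. (\<integral>\<^sup>+s. ennreal ((norm (H s w))\<^sup>2) \<partial>lb t) < \<infinity>"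
      using ito by (simp add: has_ito_integral_def nn)
    then show ?thesis
    proof (rule AE_mp[OF _ AE_I2[OF impI]])
      fix w assume "w \<in> space M" "(\<integral>\<^sup>+s. ennreal ((norm (H s w))\<^sup>2) \<partial>lb t) < \<infinity>"
      then show "sq_int (lb t) (\<lambda>s. H s w)"
        using path_measurable[OF Hm] by (intro sq_intI_nn) auto
    qed
  qed
  \<comment> \<open>A single variable controls both errors, so that one subsequence serves the
    integrands and the integrals at once; the cuts at 1 keep it bounded.\<close>
  define Y where "Y n w = max (min 1 (D n w)) (min 1 (norm (J w - V n w)))" for n w
  have "\<exists>r. strict_mono r \<and> (AE w in M. (\<lambda>n. Y (r n) w) \<longlonglongrightarrow> 0)"
  proof (rule AE_subsequence)
    show "Y n \<in> borel_measurable M" for n unfolding Y_def by measurable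
    show "0 \<le> Y n w" "Y n w \<le> 1" for n w by (simp_all add: Y_def D_def le_max_iff_disj)
    fix \<epsilon> :: real assume \<epsilon>: "0 < \<epsilon>"
    let ?A = "\<lambda>n. {w\<in>space M. ennreal \<epsilon> < (\<integral>\<^sup>+s. ennreal ((norm (H s w - S n s w))\<^sup>2) \<partial>lb t)}"
    let ?B = "\<lambda>n. {w\<in>space M. \<epsilon> < norm (J w - V n w)}"
    have Am: "?A n \<in> events" for n
    proof -
      interpret L: sigma_finite_measure "lb t" by simp
      have "(\<lambda>(w, s). ennreal ((norm (H s w - S n s w))\<^sup>2)) \<in> borel_measurable (MT t)"
        unfolding split_beta' by measurable
      from L.borel_measurable_nn_integral[OF this] show ?thesis by measurable
    qed
    have le: "prob {w\<in>space M. \<epsilon> < Y n w} \<le> prob (?A n) + prob (?B n)" for n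
    proof -
      \<comment> \<open>Only almost everywhere: \<open>D\<close> is a Bochner integral and agrees
        with the nonnegative integral in \<open>?A\<close> only along square integrable
        paths.\<close>
      have "AE w in M. w \<in> {w\<in>space M. \<epsilon> < Y n w} \<longrightarrow> w \<in> ?A n \<union> ?B n"
        using Hs
      proof (rule AE_mp[OF _ AE_I2[OF impI]], intro impI)
        fix w assume w: "w \<in> space M" "sq_int (lb t) (\<lambda>s. H s w)" "w \<in> {w\<in>space M. \<epsilon> < Y n w}"
        have "sq_int (lb t) (\<lambda>s. H s w - S n s w)"
          unfolding S_def by (intro sq_int_diff w sq_int_simple_path)
        then have "(\<integral>\<^sup>+s. ennreal ((norm (H s w - S n s w))\<^sup>2) \<partial>lb t) = ennreal (D n w)"
          by (simp add: D_def nn_integral_sq_norm)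
        then show "w \<in> ?A n \<union> ?B n" using w \<epsilon> by (auto simp: Y_def ennreal_less_iff)
      qed
      then have "prob {w\<in>space M. \<epsilon> < Y n w} \<le> prob (?A n \<union> ?B n)"
        using Am[of n] by (intro finite_measure_mono_AE) auto
      also have "\<dots> \<le> prob (?A n) + prob (?B n)"
        using Am[of n] by (intro measure_Un_le) auto
      finally show ?thesis .
    qed
    have lim: "(\<lambda>n. prob (?A n) + prob (?B n)) \<longlonglongrightarrow> 0"
      using tendsto_add[OF D0[OF \<epsilon>] J0[OF \<epsilon>]] by (simp add: nn S_def V_def)
    show "(\<lambda>n. prob {w\<in>space M. \<epsilon> < Y n w}) \<longlonglongrightarrow> 0"
    proof (rule tendsto_sandwich[OF _ _ tendsto_const lim])
      show "eventually (\<lambda>n. 0 \<le> prob {w\<in>space M. \<epsilon> < Y n w}) sequentially"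
        by (rule always_eventually) simp
      show "eventually (\<lambda>n. prob {w\<in>space M. \<epsilon> < Y n w} \<le> prob (?A n) + prob (?B n)) sequentially"
        by (rule always_eventually, rule allI, rule le)
    qed
  qed
  then obtain r where r: "AE w in M. (\<lambda>n. Y (r n) w) \<longlonglongrightarrow> 0" by blast
  have "AE w in M. (\<lambda>n. D (r n) w) \<longlonglongrightarrow> 0 \<and> (\<lambda>n. V (r n) w) \<longlonglongrightarrow> J w"
    using r
  proof (rule AE_mp[OF _ AE_I2[OF impI]])
    fix w assume w: "(\<lambda>n. Y (r n) w) \<longlonglongrightarrow> 0"
    have "(\<lambda>n. min 1 (D (r n) w)) \<longlonglongrightarrow> 0"
      by (rule tendsto_sandwich[OF _ _ tendsto_const w]) (auto simp: Y_def D_def)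
    moreover have "(\<lambda>n. min 1 (norm (J w - V (r n) w))) \<longlonglongrightarrow> 0"
      by (rule tendsto_sandwich[OF _ _ tendsto_const w]) (auto simp: Y_def D_def)
    ultimately have "(\<lambda>n. D (r n) w) \<longlonglongrightarrow> 0" "(\<lambda>n. norm (J w - V (r n) w)) \<longlonglongrightarrow> 0"
      by (auto intro: tendsto_0_of_min)
    then show "(\<lambda>n. D (r n) w) \<longlonglongrightarrow> 0 \<and> (\<lambda>n. V (r n) w) \<longlonglongrightarrow> J w"
      by (subst (asm) norm_minus_commute) (auto simp: tendsto_norm_zero_iff LIM_zero_iff)
  qed
  then have "path_approx i t H J (\<lambda>n. N (r n)) (\<lambda>n. p (r n)) (\<lambda>n. X (r n))"
    unfolding path_approx_def using X Hs by (auto simp: D_def S_def V_def)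
  then show ?thesis by blast
qed

lemma path_approx_sq_norm:
  assumes "sq_int (lb t) h" "\<And>n. sq_int (lb t) (g n)"
    "(\<lambda>n. sq_norm (lb t) (\<lambda>s. h s - g n s)) \<longlonglongrightarrow> 0"
  shows "(\<lambda>n. sq_norm (lb t) (g n)) \<longlonglongrightarrow> sq_norm (lb t) h"
  using assms by (intro sq_norm_tendsto) (simp_all add: sq_norm_commute[of "lb t" _ h])

text \<open>The isometry holds for the truncated simple integrals, whose energy is at most
  \<open>min c (a n w)\<close>. On the event Q < c they converge to J, so Fatou bounds the left
  side; on the right the cut at c allows dominated convergence without any moment assumption on
  H.\<close>

lemma stopped_ito_bound:
  assumes ito: "has_ito_integral M F (W i) t H J" and i: "i \<in> I" and t: "0 \<le> t" and c: "0 < c"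
  shows "(\<integral>\<^sup>+w. indicator {w. sq_norm (lb t) (\<lambda>s. H s w) < c} w * ennreal ((norm (J w))\<^sup>2) \<partial>M) \<le>
    (\<integral>\<^sup>+w. ennreal (min c (sq_norm (lb t) (\<lambda>s. H s w))) \<partial>M)"
proof -
  obtain N p X where pa: "path_approx i t H J N p X"
    using has_ito_integral_path_approx[OF ito i t] by blast
  then have X: "simple_integrand M F (N n) (p n) (X n)" for n by (simp add: path_approx_def)
  define \<eta> where "\<eta> n = truncate t c (p n) (X n)" for n
  have \<eta>: "simple_integrand M F (N n) (p n) (\<eta> n)" for n
    unfolding \<eta>_def by (rule simple_integrand_truncate[OF X])
  define q where "q w = sq_norm (lb t) (\<lambda>s. H s w)" for w
  define a where "a n w = sq_norm (lb t) (\<lambda>s. simple_process (N n) (p n) (X n) s w)" for n w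
  define V where "V n = simple_integral (W i) (N n) (p n) (\<eta> n) t" for n
  have Hm [measurable]: "proc H \<in> borel_measurable (MT t)"
    by (rule has_ito_integral_measurable[OF ito])
  have q [measurable]: "q \<in> borel_measurable M"
    unfolding q_def by (intro borel_measurable_path_sq_norm Hm)
  have a [measurable]: "a n \<in> borel_measurable M" for n
    unfolding a_def by (intro borel_measurable_path_sq_norm sq_int_measurable sq_int_simple_process X)
  have Vs: "sq_int M (V n)" for n unfolding V_def by (rule sq_int_simple_integral[OF \<eta> i t])
  then have [measurable]: "V n \<in> borel_measurable M" for n by (auto simp: sq_int_def)
  have AEa: "AE w in M. (\<lambda>n. a n w) \<longlonglongrightarrow> q w \<and> (q w < c \<longrightarrow> (\<lambda>n. V n w) \<longlonglongrightarrow> J w)"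
    using pa[unfolded path_approx_def, THEN conjunct2]
  proof (rule AE_mp[OF _ AE_I2[OF impI]], elim conjE, intro conjI impI)
    fix w assume w: "sq_int (lb t) (\<lambda>s. H s w)"
      "(\<lambda>n. sq_norm (lb t) (\<lambda>s. H s w - simple_process (N n) (p n) (X n) s w)) \<longlonglongrightarrow> 0"
      "(\<lambda>n. simple_integral (W i) (N n) (p n) (X n) t w) \<longlonglongrightarrow> J w"
    show aq: "(\<lambda>n. a n w) \<longlonglongrightarrow> q w"
      unfolding a_def q_def by (intro path_approx_sq_norm w sq_int_simple_path)
    assume "q w < c"
    \<comment> \<open>The strict inequality matters here: the approximating energies are eventually
      below c too, so truncation is eventually inactive on this path.\<close>
    then have "eventually (\<lambda>n. a n w < c) sequentially" using aq by (intro order_tendstoD)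
    then have "eventually (\<lambda>n. simple_integral (W i) (N n) (p n) (X n) t w = V n w) sequentially"
      by eventually_elim (use truncate_process_eq(2)[OF X t] in \<open>auto simp: V_def \<eta>_def a_def\<close>)
    with w(3) show "(\<lambda>n. V n w) \<longlonglongrightarrow> J w" by (rule Lim_transform_eventually)
  qed
  have "(\<integral>\<^sup>+w. indicator {w. q w < c} w * ennreal ((norm (J w))\<^sup>2) \<partial>M)
      \<le> (\<integral>\<^sup>+w. liminf (\<lambda>n. ennreal ((norm (V n w))\<^sup>2)) \<partial>M)"
  proof (rule nn_integral_mono_AE, use AEa in eventually_elim)
    fix w assume w: "(\<lambda>n. a n w) \<longlonglongrightarrow> q w \<and> (q w < c \<longrightarrow> (\<lambda>n. V n w) \<longlonglongrightarrow> J w)"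
    show "indicator {w. q w < c} w * ennreal ((norm (J w))\<^sup>2) \<le> liminf (\<lambda>n. ennreal ((norm (V n w))\<^sup>2))"
    proof (cases "q w < c")
      case True
      with w have "(\<lambda>n. ennreal ((norm (V n w))\<^sup>2)) \<longlonglongrightarrow> ennreal ((norm (J w))\<^sup>2)"
        by (intro tendsto_ennrealI tendsto_intros) auto
      then have "liminf (\<lambda>n. ennreal ((norm (V n w))\<^sup>2)) = ennreal ((norm (J w))\<^sup>2)"
        by (intro lim_imp_Liminf) auto
      then show ?thesis using True by simp
    qed simp
  qed
  also have "\<dots> \<le> liminf (\<lambda>n. \<integral>\<^sup>+w. ennreal ((norm (V n w))\<^sup>2) \<partial>M)"
    by (rule nn_integral_liminf) measurable
  \<comment> \<open>The isometry turns each second moment into an expected truncated energy, which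
    is bounded path by path.\<close>
  also have "\<dots> \<le> liminf (\<lambda>n. \<integral>\<^sup>+w. ennreal (min c (a n w)) \<partial>M)"
  proof (rule Liminf_mono, rule always_eventually, rule allI)
    fix n
    have s: "sq_int (MT t) (proc (simple_process (N n) (p n) (\<eta> n)))"
      by (rule sq_int_simple_process[OF \<eta>])
    note sp = sq_norm_product[OF s]
    have "(\<integral>\<^sup>+w. ennreal ((norm (V n w))\<^sup>2) \<partial>M) = ennreal (sq_norm M (V n))"
      by (rule nn_integral_sq_norm[OF Vs])
    also have "\<dots> = ennreal (expectation (\<lambda>w. sq_norm (lb t) (\<lambda>s. simple_process (N n) (p n) (\<eta> n) s w)))"
      using simple_isometry_norm[OF \<eta> i t] sp(1) by (simp add: V_def)
    also have "\<dots> = (\<integral>\<^sup>+w. ennreal (sq_norm (lb t) (\<lambda>s. simple_process (N n) (p n) (\<eta> n) s w)) \<partial>M)"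
      using sp(2) by (simp add: nn_integral_eq_integral)
    also have "\<dots> \<le> (\<integral>\<^sup>+w. ennreal (min c (a n w)) \<partial>M)"
      unfolding \<eta>_def a_def using c by (intro nn_integral_mono ennreal_leI truncate_path_le X t) auto
    finally show "(\<integral>\<^sup>+w. ennreal ((norm (V n w))\<^sup>2) \<partial>M) \<le> (\<integral>\<^sup>+w. ennreal (min c (a n w)) \<partial>M)" .
  qed
  also have "\<dots> = (\<integral>\<^sup>+w. ennreal (min c (q w)) \<partial>M)"
  proof (rule lim_imp_Liminf)
    show "(\<lambda>n. \<integral>\<^sup>+w. ennreal (min c (a n w)) \<partial>M) \<longlonglongrightarrow> (\<integral>\<^sup>+w. ennreal (min c (q w)) \<partial>M)"
    proof (rule nn_integral_dominated_convergence[where w="\<lambda>_. ennreal c"])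
      show "AE w in M. (\<lambda>n. ennreal (min c (a n w))) \<longlonglongrightarrow> ennreal (min c (q w))"
        using AEa by eventually_elim (auto intro!: tendsto_ennrealI tendsto_min)
    qed (auto simp: ennreal_leI emeasure_space_1)
  qed simp
  finally show ?thesis by (simp add: q_def)
qed

end

lemma sq_norm_linear_tendsto:
  assumes T: "bounded_linear T" and f: "\<And>n. sq_int Q (\<lambda>x. f n x - g x)"
    and lim: "(\<lambda>n. sq_norm Q (\<lambda>x. f n x - g x)) \<longlonglongrightarrow> 0"
  shows "(\<lambda>n. sq_norm Q (\<lambda>x. T (f n x) - T (g x))) \<longlonglongrightarrow> 0"
proof -
  interpret T: bounded_linear T by fact
  obtain K where K: "\<And>x. norm (T x) \<le> K * norm x" using T.bounded by (metis mult.commute)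
  have lim': "(\<lambda>n. K\<^sup>2 * sq_norm Q (\<lambda>x. f n x - g x)) \<longlonglongrightarrow> 0"
    using tendsto_mult_right_zero[OF lim] by simp
  have "sq_norm Q (\<lambda>x. T (f n x) - T (g x)) \<le> K\<^sup>2 * sq_norm Q (\<lambda>x. f n x - g x)" for n
    unfolding T.diff[symmetric] by (intro sq_norm_scaled_le f sq_int_linear[OF T] K)
  then show ?thesis
    by (intro tendsto_sandwich[OF _ _ tendsto_const lim'] always_eventually allI) simp_all
qed

lemma sq_int_lb_mono:
  assumes h: "sq_int (lb t) h" and st: "s \<le> t"
  shows "sq_int (lb s) h" and "sq_norm (lb s) h \<le> sq_norm (lb t) h"
proof -
  have t: "integrable lborel (\<lambda>x. indicator {0..t} x *\<^sub>R (norm (h x))\<^sup>2)"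
    using h by (simp add: sq_int_def integrable_restrict_space)
  have "integrable lborel (\<lambda>x. indicator {0..s} x *\<^sub>R (indicator {0..t} x *\<^sub>R (norm (h x))\<^sup>2))"
    by (rule Bochner_Integration.integrable_bound[OF t]) (use t in \<open>auto simp: indicator_def\<close>)
  moreover have "(\<lambda>x. indicator {0..s} x *\<^sub>R (indicator {0..t} x *\<^sub>R (norm (h x))\<^sup>2)) =
      (\<lambda>x. indicator {0..s} x *\<^sub>R (norm (h x))\<^sup>2)"
    using st by (auto simp: indicator_def)
  ultimately have s: "integrable lborel (\<lambda>x. indicator {0..s} x *\<^sub>R (norm (h x))\<^sup>2)" by simp
  have "h \<in> borel_measurable (lb s)"
    using sq_int_measurable[OF h] by (rule measurable_restrict_mono) (use st in auto)
  with s show "sq_int (lb s) h"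
    by (simp add: sq_int_def integrable_restrict_space)
  have "(\<integral>x. indicator {0..s} x *\<^sub>R (norm (h x))\<^sup>2 \<partial>lborel) \<le> (\<integral>x. indicator {0..t} x *\<^sub>R (norm (h x))\<^sup>2 \<partial>lborel)"
    using st by (intro integral_mono s t) (auto simp: indicator_def)
  then show "sq_norm (lb s) h \<le> sq_norm (lb t) h"
    by (simp add: sq_norm_def integral_restrict_space)
qed

section \<open>Square integrable integrands: isometry, identification of the limit, martingale
  property\<close>

context wiener
begin

text \<open>\<open>J = \<integral>\<^sub>0\<^sup>t H dW\<^sub>i\<close> as a limit in \<open>L\<^sup>2\<close> rather than in probability.\<close>

definition sq_approx :: "'i \<Rightarrow> real \<Rightarrow> (real \<Rightarrow> 'a \<Rightarrow> 'v::euclidean_space) \<Rightarrow> ('a \<Rightarrow> 'v) \<Rightarrow>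
    (nat \<Rightarrow> nat) \<Rightarrow> (nat \<Rightarrow> nat \<Rightarrow> real) \<Rightarrow> (nat \<Rightarrow> nat \<Rightarrow> 'a \<Rightarrow> 'v) \<Rightarrow> bool" where
  "sq_approx i t H J N p X \<longleftrightarrow> (\<forall>n. simple_integrand M F (N n) (p n) (X n)) \<and>
     (\<lambda>n. sq_norm (MT t) (\<lambda>z. proc (simple_process (N n) (p n) (X n)) z - proc H z)) \<longlonglongrightarrow> 0 \<and>
     (\<lambda>n. sq_norm M (\<lambda>w. simple_integral (W i) (N n) (p n) (X n) t w - J w)) \<longlonglongrightarrow> 0"

definition ito_sq :: "'i \<Rightarrow> real \<Rightarrow> (real \<Rightarrow> 'a \<Rightarrow> 'v::euclidean_space) \<Rightarrow> ('a \<Rightarrow> 'v) \<Rightarrow> bool" where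
  "ito_sq i t H J \<longleftrightarrow> sq_int (MT t) (proc H) \<and> sq_int M J \<and> (\<exists>N p X. sq_approx i t H J N p X)"

lemma sq_approxD:
  assumes "sq_approx i t H J N p X"
  shows "simple_integrand M F (N n) (p n) (X n)"
    "(\<lambda>n. sq_norm (MT t) (\<lambda>z. proc (simple_process (N n) (p n) (X n)) z - proc H z)) \<longlonglongrightarrow> 0"
    "(\<lambda>n. sq_norm M (\<lambda>w. simple_integral (W i) (N n) (p n) (X n) t w - J w)) \<longlonglongrightarrow> 0"
  using assms by (simp_all add: sq_approx_def)

lemma ito_sq_sq_int:
  assumes "ito_sq i t H J"
  shows "sq_int (MT t) (proc H)" "sq_int M J"
  using assms by (simp_all add: ito_sq_def)

text \<open>Both sides are limits of the corresponding expressions for simple processes. For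
  distinct components the left sequence is constantly 0.\<close>

lemma ito_isometry:
  assumes H: "ito_sq i t H J" and G: "ito_sq j t G K" and i: "i \<in> I" and j: "j \<in> I" and t: "0 \<le> t"
  shows "expectation (\<lambda>w. J w \<bullet> K w) =
    (if i = j then (\<integral>z. proc H z \<bullet> proc G z \<partial>MT t) else 0)"
proof -
  obtain N p X where "sq_approx i t H J N p X" using H ito_sq_def by blast
  note X = sq_approxD[OF this]
  obtain N' q \<zeta> where "sq_approx j t G K N' q \<zeta>" using G ito_sq_def by blast
  note \<zeta> = sq_approxD[OF this]
  have 1: "(\<lambda>n. expectation (\<lambda>w. simple_integral (W i) (N n) (p n) (X n) t w \<bullet> simple_integral (W j) (N' n) (q n) (\<zeta> n) t w))
     \<longlonglongrightarrow> expectation (\<lambda>w. J w \<bullet> K w)"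
    by (rule inner_integral_tendsto[OF sq_int_simple_integral[OF X(1) i t] _ X(3)
          sq_int_simple_integral[OF \<zeta>(1) j t] _ \<zeta>(3)])
      (fact ito_sq_sq_int[OF H] ito_sq_sq_int[OF G])+
  have "(\<lambda>n. \<integral>z. proc (simple_process (N n) (p n) (X n)) z \<bullet>
        proc (simple_process (N' n) (q n) (\<zeta> n)) z \<partial>MT t)
     \<longlonglongrightarrow> (\<integral>z. proc H z \<bullet> proc G z \<partial>MT t)"
    by (rule inner_integral_tendsto[OF sq_int_simple_process[OF X(1)] _ X(2)
          sq_int_simple_process[OF \<zeta>(1)] _ \<zeta>(2)])
      (fact ito_sq_sq_int[OF H] ito_sq_sq_int[OF G])+
  with 1 show ?thesis
    unfolding simple_isometry[OF X(1) \<zeta>(1) i j t] by (cases "i = j") (auto intro: LIMSEQ_unique simp: LIMSEQ_const_iff)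
qed

text \<open>Expanding both squares leaves three inner products on each side, which agree by the
  isometry. The integral of H - G is never formed; that would require putting two approximating
  simple processes on a common partition.\<close>

lemma ito_sq_diff_isometry:
  assumes H: "ito_sq i t H J" and G: "ito_sq i t G K" and i: "i \<in> I" and t: "0 \<le> t"
  shows "sq_norm M (\<lambda>w. J w - K w) = sq_norm (MT t) (\<lambda>z. proc H z - proc G z)"
proof -
  have s: "sq_int (MT t) (proc H)" "sq_int M J"
    "sq_int (MT t) (proc G)" "sq_int M K"
    by (fact ito_sq_sq_int[OF H] ito_sq_sq_int[OF G])+
  show ?thesis
    unfolding sq_norm_diff_expand[OF s(2) s(4)] sq_norm_diff_expand[OF s(1) s(3)]
    using ito_isometry[OF H H i i t] ito_isometry[OF H G i i t] ito_isometry[OF G G i i t] by simp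
qed

lemma ito_sq_simple:
  assumes "simple_integrand M F N p X" "i \<in> I" "0 \<le> t"
  shows "ito_sq i t (simple_process N p X) (simple_integral (W i) N p X t)"
  unfolding ito_sq_def sq_approx_def
  by (intro conjI sq_int_simple_process sq_int_simple_integral assms
      exI[of _ "\<lambda>_. N"] exI[of _ "\<lambda>_. p"] exI[of _ "\<lambda>_. X"] allI)
    (simp_all add: sq_norm_def)

text \<open>The isometry makes the simple integrals a Cauchy sequence in L2. Fatou in the second
  index m, along the almost sure limit, identifies their L2 limit with J and gives the error bound
  \<open>2 * d n\<close>.\<close>

lemma ito_sq_of_convergence:
  assumes i: "i \<in> I" and t: "0 \<le> t" and \<eta>: "\<And>n. simple_integrand M F (N n) (p n) (\<eta> n)"
    and H: "sq_int (MT t) (proc H)" and J: "J \<in> borel_measurable M"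
    and d0: "(\<lambda>n. sq_norm (MT t)
          (\<lambda>z. proc (simple_process (N n) (p n) (\<eta> n)) z - proc H z)) \<longlonglongrightarrow> 0"
    and AE: "AE w in M. (\<lambda>n. simple_integral (W i) (N n) (p n) (\<eta> n) t w) \<longlonglongrightarrow> J w"
  shows "ito_sq i t H J"
proof -
  define V where "V n = simple_integral (W i) (N n) (p n) (\<eta> n) t" for n
  define S where "S n z = proc (simple_process (N n) (p n) (\<eta> n)) z" for n and z :: "'a \<times> real"
  define d where "d n = sq_norm (MT t) (\<lambda>z. S n z - proc H z)" for n
  have d: "d \<longlonglongrightarrow> 0" using d0 by (simp add: d_def[abs_def] S_def)
  have V: "sq_int M (V n)" for n unfolding V_def by (rule sq_int_simple_integral[OF \<eta> i t])
  have S: "sq_int (MT t) (S n)" for n unfolding S_def by (rule sq_int_simple_process[OF \<eta>])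
  note [measurable] = J sq_int_measurable[OF V]
  have cauchy: "sq_norm M (\<lambda>w. V n w - V m w) \<le> 2 * d n + 2 * d m" for n m
  proof -
    have "sq_norm M (\<lambda>w. V n w - V m w) = sq_norm (MT t) (\<lambda>z. S n z - S m z)"
      unfolding V_def S_def by (rule ito_sq_diff_isometry[OF ito_sq_simple[OF \<eta> i t] ito_sq_simple[OF \<eta> i t] i t])
    also have "\<dots> \<le> 2 * d n + 2 * d m"
      using sq_norm_triangle[OF S[of n] H S[of m]]
      by (simp add: d_def sq_norm_commute[of _ "S m"])
    finally show ?thesis .
  qed
  have bound: "(\<integral>\<^sup>+w. ennreal ((norm (V n w - J w))\<^sup>2) \<partial>M) \<le> ennreal (2 * d n)" for n
  proof -
    have "(\<integral>\<^sup>+w. ennreal ((norm (V n w - J w))\<^sup>2) \<partial>M)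
       \<le> (\<integral>\<^sup>+w. liminf (\<lambda>m. ennreal ((norm (V n w - V m w))\<^sup>2)) \<partial>M)"
    proof (rule nn_integral_mono_AE, use AE in eventually_elim)
      fix w assume "(\<lambda>n. simple_integral (W i) (N n) (p n) (\<eta> n) t w) \<longlonglongrightarrow> J w"
      then have "(\<lambda>m. V m w) \<longlonglongrightarrow> J w" by (simp add: V_def)
      then have "(\<lambda>m. ennreal ((norm (V n w - V m w))\<^sup>2)) \<longlonglongrightarrow> ennreal ((norm (V n w - J w))\<^sup>2)"
        by (intro tendsto_ennrealI tendsto_intros)
      then have "liminf (\<lambda>m. ennreal ((norm (V n w - V m w))\<^sup>2)) = ennreal ((norm (V n w - J w))\<^sup>2)"
        by (intro lim_imp_Liminf) auto
      then show "ennreal ((norm (V n w - J w))\<^sup>2) \<le> liminf (\<lambda>m. ennreal ((norm (V n w - V m w))\<^sup>2))" by simp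
    qed
    also have "\<dots> \<le> liminf (\<lambda>m. \<integral>\<^sup>+w. ennreal ((norm (V n w - V m w))\<^sup>2) \<partial>M)"
      by (rule nn_integral_liminf) measurable
    also have "\<dots> \<le> liminf (\<lambda>m. ennreal (2 * d n + 2 * d m))"
      using cauchy by (intro Liminf_mono always_eventually allI)
        (simp add: nn_integral_sq_norm[OF sq_int_diff[OF V V]] ennreal_leI)
    also have "\<dots> = ennreal (2 * d n)"
    proof (rule lim_imp_Liminf)
      have "(\<lambda>m. 2 * d n + 2 * d m) \<longlonglongrightarrow> 2 * d n + 2 * 0" by (intro tendsto_intros d)
      then show "(\<lambda>m. ennreal (2 * d n + 2 * d m)) \<longlonglongrightarrow> ennreal (2 * d n)"
        by (intro tendsto_ennrealI) simp
    qed simp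
    finally show ?thesis .
  qed
  have VJ: "sq_int M (\<lambda>w. V n w - J w)" for n
    using bound[of n] by (intro sq_intI_nn) (auto simp: top.extremum_strict order_le_less_trans[OF _ ennreal_less_top])
  have le: "sq_norm M (\<lambda>w. V n w - J w) \<le> 2 * d n" for n
    using bound[of n] by (simp add: nn_integral_sq_norm[OF VJ] d_def)
  have d2: "(\<lambda>n. 2 * d n) \<longlonglongrightarrow> 0" using tendsto_mult_right_zero[OF d, of 2] by simp
  have "(\<lambda>n. sq_norm M (\<lambda>w. V n w - J w)) \<longlonglongrightarrow> 0"
    by (rule tendsto_sandwich[OF _ _ tendsto_const d2]) (simp_all add: le)
  moreover have "sq_int M J"
    using sq_int_diff[OF V[of 0] VJ[of 0]] by simp
  ultimately show ?thesis
    unfolding ito_sq_def sq_approx_def V_def using H \<eta> d0 by blast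
qed

text \<open>Truncating at growing levels costs nothing pathwise in the limit. The mean square error is controlled
  by pairing the level \<open>n\<close> with the \<open>k n\<close>-th approximation, where \<open>k\<close> grows fast enough for the convergence
  in probability to outweigh \<open>n\<close>.\<close>

lemma has_ito_integral_ito_sq:
  assumes ito: "has_ito_integral M F (W i) t H J" and i: "i \<in> I" and t: "0 \<le> t"
    and H: "sq_int (MT t) (proc H)"
  shows "ito_sq i t H J"
proof -
  obtain N p X where pa: "path_approx i t H J N p X"
    using has_ito_integral_path_approx[OF ito i t] by blast
  then have X: "simple_integrand M F (N n) (p n) (X n)" for n by (simp add: path_approx_def)
  define q where "q w = sq_norm (lb t) (\<lambda>s. H s w)" for w
  define a where "a n w = sq_norm (lb t) (\<lambda>s. simple_process (N n) (p n) (X n) s w)" for n w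
  define V where "V n = simple_integral (W i) (N n) (p n) (X n) t" for n
  define E where "E n w = sq_norm (lb t) (\<lambda>s. H s w - simple_process (N n) (p n) (X n) s w)" for n w
  have q0: "0 \<le> q w" for w by (simp add: q_def)
  have q_int: "integrable M q" unfolding q_def using sq_norm_product(2)[OF H] .
  then have [measurable]: "q \<in> borel_measurable M" by auto
  have [measurable]: "a n \<in> borel_measurable M" for n
    unfolding a_def by (intro borel_measurable_path_sq_norm sq_int_measurable sq_int_simple_process X)
  have AE: "AE w in M. sq_int (lb t) (\<lambda>s. H s w) \<and> (\<lambda>n. E n w) \<longlonglongrightarrow> 0 \<and> (\<lambda>n. V n w) \<longlonglongrightarrow> J w"
    using pa unfolding path_approx_def E_def V_def by blast
  have aq: "AE w in M. (\<lambda>n. a n w) \<longlonglongrightarrow> q w"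
    using AE
  proof eventually_elim
    case (elim w)
    then show ?case
      unfolding a_def q_def E_def by (intro path_approx_sq_norm sq_int_simple_path) auto
  qed
  \<comment> \<open>The bad events, on which the energy of the n-th approximation exceeds that of H
    by more than 1. Their probabilities tend to 0, at no known rate.\<close>
  let ?B = "\<lambda>n. {w\<in>space M. q w + 1 < a n w}"
  have P: "(\<lambda>n. prob (?B n)) \<longlonglongrightarrow> 0"
  proof -
    have "(\<lambda>n. expectation (indicat_real (?B n))) \<longlonglongrightarrow> expectation (\<lambda>w. 0)"
    proof (rule integral_dominated_convergence[where w="\<lambda>_. 1"])
      show "AE w in M. (\<lambda>n. indicat_real (?B n) w) \<longlonglongrightarrow> 0"
        using aq
      proof eventually_elim
        case (elim w)
        then have "eventually (\<lambda>n. a n w < q w + 1) sequentially" by (rule order_tendstoD) simp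
        then have "eventually (\<lambda>n. indicat_real (?B n) w = 0) sequentially" by eventually_elim auto
        then show ?case by (rule tendsto_eventually)
      qed
    qed (auto simp: indicator_def)
    then show ?thesis by simp
  qed
  \<comment> \<open>On a bad event the energy truncated at level n is bounded only by n, so the
    probability has to be small against 1 / n. The condition that k is at least n makes the chosen
    indices tend to infinity.\<close>
  have "\<exists>k\<ge>n. real n * prob (?B k) < inverse (real (Suc n))" for n
  proof -
    have "(\<lambda>k. real n * prob (?B k)) \<longlonglongrightarrow> real n * 0" by (intro tendsto_intros P)
    then have "eventually (\<lambda>k. real n * prob (?B k) < inverse (real (Suc n))) sequentially"
      by (rule order_tendstoD) simp
    with eventually_ge_at_top[of n] have "eventually (\<lambda>k. k \<ge> n \<and> real n * prob (?B k) < inverse (real (Suc n))) sequentially"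
      by (rule eventually_conj)
    then show ?thesis by (auto simp: eventually_sequentially)
  qed
  then obtain k where k: "\<And>n. n \<le> k n" "\<And>n. real n * prob (?B (k n)) < inverse (real (Suc n))" by metis
  have k_top: "filterlim k at_top sequentially"
    by (rule filterlim_at_top_mono[OF filterlim_ident]) (simp add: k(1))
  define \<eta> where "\<eta> n = truncate t (real n) (p (k n)) (X (k n))" for n
  have \<eta>: "simple_integrand M F (N (k n)) (p (k n)) (\<eta> n)" for n
    unfolding \<eta>_def by (rule simple_integrand_truncate[OF X])
  define S where "S n = simple_process (N (k n)) (p (k n)) (\<eta> n)" for n
  define D where "D n w = sq_norm (lb t) (\<lambda>s. S n s w - H s w)" for n w
  have SH: "sq_int (MT t) (proc (\<lambda>s w. S n s w - H s w))" for n
    unfolding S_def by (intro sq_int_diff H sq_int_simple_process[OF \<eta>])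
  have D_int: "integrable M (D n)" for n unfolding D_def by (rule sq_norm_product(2)[OF SH])
  then have [measurable]: "D n \<in> borel_measurable M" for n by auto
  have lim: "AE w in M. (\<lambda>n. D n w) \<longlonglongrightarrow> 0 \<and> (\<lambda>n. simple_integral (W i) (N (k n)) (p (k n)) (\<eta> n) t w) \<longlonglongrightarrow> J w"
    using AE aq
  proof eventually_elim
    case (elim w)
    have "eventually (\<lambda>n. a (k n) w < q w + 1) sequentially"
      using filterlim_compose[OF elim(2) k_top] by (rule order_tendstoD) simp
    moreover have "eventually (\<lambda>n. q w + 1 \<le> real n) sequentially"
      using filterlim_real_sequentially by (simp add: filterlim_at_top)
    ultimately have "eventually (\<lambda>n. a (k n) w \<le> real n) sequentially" by eventually_elim simp
    then have ev: "eventually (\<lambda>n. E (k n) w = D n w \<and>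
        V (k n) w = simple_integral (W i) (N (k n)) (p (k n)) (\<eta> n) t w) sequentially"
    proof eventually_elim
      case (elim n)
      note eq = truncate_process_eq[OF X t elim[unfolded a_def], folded \<eta>_def]
      show ?case by (simp add: E_def D_def S_def V_def eq sq_norm_commute[of _ "\<lambda>s. H s w"])
    qed
    have "(\<lambda>n. E (k n) w) \<longlonglongrightarrow> 0" "(\<lambda>n. V (k n) w) \<longlonglongrightarrow> J w"
      using elim(1) k_top by (auto intro: filterlim_compose)
    then show ?case
      by (intro conjI; elim Lim_transform_eventually) (use ev in \<open>auto elim!: eventually_mono\<close>)
  qed
  \<comment> \<open>Off the bad event the truncated energy is at most q + 1, which gives 2 (q + 1) +
    2 q; on it the truncation level n takes the place of q + 1.\<close>
  have D_le: "AE w in M. D n w \<le> 4 * q w + 2 + 2 * (real n * indicator (?B (k n)) w)" for n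
    using AE AE_space
  proof eventually_elim
    case (elim w)
    have "D n w \<le> 2 * sq_norm (lb t) (\<lambda>s. S n s w) + 2 * sq_norm (lb t) (\<lambda>s. - H s w)"
      using sq_norm_add_le[OF sq_int_simple_path
          sq_int_linear[OF bounded_linear_minus[OF bounded_linear_ident] conjunct1[OF elim(1)]]]
      by (simp add: D_def S_def)
    also have "sq_norm (lb t) (\<lambda>s. - H s w) = q w" by (simp add: sq_norm_def q_def)
    finally show ?case
      using truncate_path_le[OF X[of "k n"] t, of "real n" w] elim q0[of w]
      by (cases "w \<in> ?B (k n)") (auto simp: S_def \<eta>_def a_def)
  qed
  \<comment> \<open>The error without the share of the bad event: this part is dominated by the
    integrable \<open>4 * q w + 2\<close>, while the removed part has expectation below 2 / (n +
    1).\<close>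
  define f where "f n w = max 0 (D n w - 2 * (real n * indicator (?B (k n)) w))" for n w
  have f: "(\<lambda>n. expectation (f n)) \<longlonglongrightarrow> expectation (\<lambda>w. 0)"
  proof (rule integral_dominated_convergence[where w="\<lambda>w. 4 * q w + 2"])
    show "AE w in M. (\<lambda>n. f n w) \<longlonglongrightarrow> 0"
      using lim
    proof eventually_elim
      case (elim w)
      have "0 \<le> D n w" for n by (simp add: D_def)
      then have "f n w \<le> D n w" for n by (simp add: f_def)
      moreover have "0 \<le> f n w" for n by (simp add: f_def)
      ultimately show ?case
        using tendsto_sandwich[OF _ _ tendsto_const conjunct1[OF elim], of "\<lambda>n. f n w"] by simp
    qed
    show "AE w in M. norm (f n w) \<le> 4 * q w + 2" for n
      using D_le[of n] by eventually_elim (use q0 in \<open>auto simp: f_def add_nonneg_nonneg\<close>)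
    show "f n \<in> borel_measurable M" for n unfolding f_def by measurable
  qed (use q_int in \<open>auto simp: integrable_const\<close>)
  have B_int: "integrable M (\<lambda>w. 2 * (real n * indicat_real (?B (k n)) w))" for n
    by (intro integrable_mult_right integrable_const_bound[where B=1]) auto
  have ED: "expectation (D n) \<le> expectation (f n) + 2 * inverse (real (Suc n))" for n
  proof -
    have f_int: "integrable M (f n)"
      unfolding f_def by (intro integrable_max integrable_zero Bochner_Integration.integrable_diff D_int B_int)
    have "expectation (D n) \<le> expectation (\<lambda>w. f n w + 2 * (real n * indicator (?B (k n)) w))"
      by (intro integral_mono D_int Bochner_Integration.integrable_add f_int B_int) (simp add: f_def)
    also have "\<dots> = expectation (f n) + expectation (\<lambda>w. 2 * (real n * indicator (?B (k n)) w))"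
      by (rule Bochner_Integration.integral_add[OF f_int B_int])
    also have "expectation (\<lambda>w. 2 * (real n * indicator (?B (k n)) w)) = 2 * (real n * prob (?B (k n)))" by simp
    finally show ?thesis using k(2)[of n] by simp
  qed
  show ?thesis
  proof (rule ito_sq_of_convergence[OF i t \<eta> H])
    have "(\<lambda>n. expectation (D n)) \<longlonglongrightarrow> 0"
    proof (rule tendsto_sandwich[OF _ _ tendsto_const])
      show "(\<lambda>n. expectation (f n) + 2 * inverse (real (Suc n))) \<longlonglongrightarrow> 0"
        using tendsto_add[OF f tendsto_mult_right_zero[OF LIMSEQ_inverse_real_of_nat, of 2]] by simp
    qed (simp_all add: ED[unfolded of_nat_Suc] D_def integral_nonneg_AE)
    moreover have "sq_norm (MT t) (\<lambda>z. proc (S n) z - proc H z) = expectation (D n)" for n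
      using sq_norm_product(1)[OF SH] by (simp add: D_def[abs_def])
    ultimately show "(\<lambda>n. sq_norm (MT t) (\<lambda>z. proc (simple_process (N (k n)) (p (k n)) (\<eta> n)) z - proc H z)) \<longlonglongrightarrow> 0"
      by (simp add: S_def)
    show "AE w in M. (\<lambda>n. simple_integral (W i) (N (k n)) (p (k n)) (\<eta> n) t w) \<longlonglongrightarrow> J w"
      using lim by eventually_elim blast
    show "J \<in> borel_measurable M" using ito by (simp add: has_ito_integral_def)
  qed
qed

text \<open>Used for S, so that the expectation of m . S m becomes a sum of inner products of two
  Ito integrals, to which the isometry applies.\<close>

lemma ito_sq_linear:
  assumes H: "ito_sq i t H J" and T: "bounded_linear T" and i: "i \<in> I" and t: "0 \<le> t"
  shows "ito_sq i t (\<lambda>s w. T (H s w)) (\<lambda>w. T (J w))"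
proof -
  interpret T: bounded_linear T by fact
  have Tm [measurable]: "T \<in> borel_measurable borel"
    by (intro borel_measurable_continuous_onI linear_continuous_on T)
  obtain N p X where "sq_approx i t H J N p X" using H ito_sq_def by blast
  note X = sq_approxD[OF this]
  have HJ: "sq_int (MT t) (proc H)" "sq_int M J"
    by (fact ito_sq_sq_int[OF H])+
  define \<zeta> where "\<zeta> n k w = T (X n k w)" for n k w
  have "simple_integrand M F (N n) (p n) (\<zeta> n)" for n
    using X(1)[of n] unfolding simple_integrand_def \<zeta>_def
    by (auto intro: measurable_compose[OF _ Tm] bounded_linear_image[OF _ T, of "_ ` _", unfolded image_image])
  moreover have "simple_process (N n) (p n) (\<zeta> n) s w = T (simple_process (N n) (p n) (X n) s w)" for n s w
    by (simp add: simple_process_def \<zeta>_def T.sum T.scaleR)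
  moreover have "simple_integral B (N n) (p n) (\<zeta> n) s w = T (simple_integral B (N n) (p n) (X n) s w)" for n B s w
    by (simp add: simple_integral_def \<zeta>_def T.sum T.scaleR)
  moreover note sq_norm_linear_tendsto[OF T sq_int_diff[OF sq_int_simple_process[OF X(1)] HJ(1)] X(2)]
    sq_norm_linear_tendsto[OF T sq_int_diff[OF sq_int_simple_integral[OF X(1) i t] HJ(2)] X(3)]
    sq_int_linear[OF T HJ(1)] sq_int_linear[OF T HJ(2)]
  ultimately show ?thesis
    unfolding ito_sq_def sq_approx_def by (intro conjI exI[of _ N] exI[of _ p] exI[of _ \<zeta>]) auto
qed

text \<open>The martingale property in tested form: no conditional expectation is taken, and the
  integrals themselves need only be measurable with respect to \<open>M\<close>.\<close>

lemma ito_martingale: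
  assumes Jt: "ito_sq i t H Jt" and Js: "ito_sq i s H Js" and i: "i \<in> I" and st: "0 \<le> s" "s \<le> t"
    and Z: "Z \<in> borel_measurable (F s)" "sq_int M Z"
  shows "expectation (\<lambda>w. Z w \<bullet> Jt w) = expectation (\<lambda>w. Z w \<bullet> Js w)"
proof -
  have t: "0 \<le> t" using st by simp
  obtain N p X where "sq_approx i t H Jt N p X" using Jt ito_sq_def by blast
  note X = sq_approxD[OF this]
  have H: "sq_int (MT s) (proc H)" "sq_int (MT t) (proc H)"
    "sq_int M Js" "sq_int M Jt"
    by (fact ito_sq_sq_int[OF Js] ito_sq_sq_int[OF Jt])+
  have Zt: "(\<lambda>n. expectation (\<lambda>w. Z w \<bullet> simple_integral (W i) (N n) (p n) (X n) t w)) \<longlonglongrightarrow> expectation (\<lambda>w. Z w \<bullet> Jt w)"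
    by (rule inner_integral_tendsto[OF Z(2) Z(2) _ sq_int_simple_integral[OF X(1) i t] H(4) X(3)])
      (simp add: sq_norm_def)
  \<comment> \<open>The approximations chosen for t also serve s: by the isometry the error at s is
    the energy of the difference on \<open>{0..s}\<close>, which is at most that on
    \<open>{0..t}\<close>. Both limits therefore run along one sequence.\<close>
  have lim_s: "(\<lambda>n. sq_norm M (\<lambda>w. simple_integral (W i) (N n) (p n) (X n) s w - Js w)) \<longlonglongrightarrow> 0"
  proof (rule tendsto_sandwich[OF _ _ tendsto_const X(2)])
    show "eventually (\<lambda>n. sq_norm M (\<lambda>w. simple_integral (W i) (N n) (p n) (X n) s w - Js w) \<le>
      sq_norm (MT t) (\<lambda>z. proc (simple_process (N n) (p n) (X n)) z - proc H z)) sequentially"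
    proof (rule always_eventually, rule allI)
      fix n
      define h where "h r w = simple_process (N n) (p n) (X n) r w - H r w" for r w
      have hs: "sq_int (MT s) (proc h)" and ht: "sq_int (MT t) (proc h)"
        unfolding h_def by (intro sq_int_diff sq_int_simple_process[OF X(1)] H)+
      have "sq_norm M (\<lambda>w. simple_integral (W i) (N n) (p n) (X n) s w - Js w) =
          sq_norm (MT s) (proc h)"
        unfolding h_def by (rule ito_sq_diff_isometry[OF ito_sq_simple[OF X(1) i st(1)] Js i st(1)])
      also have "\<dots> = expectation (\<lambda>w. sq_norm (lb s) (\<lambda>r. h r w))" by (rule sq_norm_product(1)[OF hs])
      also have "\<dots> \<le> expectation (\<lambda>w. sq_norm (lb t) (\<lambda>r. h r w))"
        using sq_norm_product(3)[OF ht]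
        by (intro integral_mono_AE sq_norm_product(2) hs ht) (auto elim!: eventually_mono intro: sq_int_lb_mono(2) st)
      also have "\<dots> = sq_norm (MT t) (proc h)" by (rule sq_norm_product(1)[OF ht, symmetric])
      finally show "sq_norm M (\<lambda>w. simple_integral (W i) (N n) (p n) (X n) s w - Js w) \<le>
        sq_norm (MT t) (\<lambda>z. proc (simple_process (N n) (p n) (X n)) z - proc H z)"
        by (simp add: h_def)
    qed
  qed auto
  have Zs: "(\<lambda>n. expectation (\<lambda>w. Z w \<bullet> simple_integral (W i) (N n) (p n) (X n) s w)) \<longlonglongrightarrow> expectation (\<lambda>w. Z w \<bullet> Js w)"
    by (rule inner_integral_tendsto[OF Z(2) Z(2) _ sq_int_simple_integral[OF X(1) i st(1)] H(3) lim_s])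
      (simp add: sq_norm_def)
  show ?thesis
    using Zt Zs unfolding simple_martingale[OF X(1) i st Z] by (rule LIMSEQ_unique)
qed

end

section \<open>Finite second moments\<close>

text \<open>A contraction argument in an exponentially weighted supremum norm, which asks for no
  continuity of \<open>\<psi>\<close>. The bound N only makes the supremum finite and is absent from
  the conclusion; this gives uniformity in the truncation level.\<close>

lemma gronwall_ennreal:
  fixes \<psi> :: "real \<Rightarrow> ennreal"
  assumes le: "\<And>t. 0 \<le> t \<Longrightarrow> t \<le> T \<Longrightarrow> \<psi> t \<le> ennreal \<alpha> + ennreal \<gamma> * (\<integral>\<^sup>+s. \<psi> s \<partial>lb t)"
    and bdd: "\<And>t. 0 \<le> t \<Longrightarrow> t \<le> T \<Longrightarrow> \<psi> t \<le> ennreal N"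
    and nonneg: "0 \<le> \<alpha>" "0 \<le> \<gamma>" "0 \<le> N" and t: "0 \<le> t" "t \<le> T"
  shows "\<psi> t \<le> ennreal (2 * \<alpha> * exp ((2 * \<gamma> + 1) * t))"
proof -
  \<comment> \<open>The rate is chosen so that \<open>\<gamma> / l\<close> is at most 1 / 2, and the
    summand 1 keeps it positive. The supremum K below then satisfies K <= \<open>\<alpha>\<close> +
    K / 2, the origin of the factor 2 in the conclusion.\<close>
  define l where "l = 2 * \<gamma> + 1"
  have l: "l > 0" "\<gamma> / l \<le> 1 / 2" using nonneg by (auto simp: l_def field_simps)
  define k where "k s = exp (- l * s) * enn2real (\<psi> s)" for s
  have fin: "\<psi> s = ennreal (enn2real (\<psi> s))" if "0 \<le> s" "s \<le> T" for s
    using bdd[OF that] by (intro ennreal_enn2real[symmetric]) (simp add: order_le_less_trans[OF _ ennreal_less_top])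
  have kN: "k s \<le> N" if "0 \<le> s" "s \<le> T" for s
  proof -
    have "enn2real (\<psi> s) \<le> N" using bdd[OF that] nonneg by (intro enn2real_leI)
    moreover have "exp (- l * s) \<le> 1" using l that by simp
    ultimately show ?thesis unfolding k_def
      using mult_mono[of "exp (- l * s)" 1 "enn2real (\<psi> s)" N] by simp
  qed
  define K where "K = (SUP s\<in>{0..T}. k s)"
  have bddK: "bdd_above (k ` {0..T})" using kN by (intro bdd_aboveI[of _ N]) auto
  have kK: "k s \<le> K" if "0 \<le> s" "s \<le> T" for s
    unfolding K_def using that by (intro cSUP_upper bddK) auto
  have k0: "0 \<le> k s" for s by (simp add: k_def)
  have K0: "0 \<le> K" using kK[of t] k0[of t] t by simp
  have step: "k s \<le> \<alpha> + K / 2" if s: "0 \<le> s" "s \<le> T" for s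
  proof -
    have "(\<integral>\<^sup>+r. \<psi> r \<partial>lb s) \<le> (\<integral>\<^sup>+r. ennreal (K * exp (l * r)) \<partial>lb s)"
    proof (rule nn_integral_mono)
      fix r assume "r \<in> space (lb s)"
      then have r: "0 \<le> r" "r \<le> T" using s by (auto simp: space_restrict_space)
      have "enn2real (\<psi> r) = k r * exp (l * r)"
        by (simp add: k_def mult.commute mult.left_commute exp_minus field_simps)
      also have "\<dots> \<le> K * exp (l * r)" using kK[OF r] by (intro mult_right_mono) auto
      finally show "\<psi> r \<le> ennreal (K * exp (l * r))"
        by (subst fin[OF r]) (rule ennreal_leI)
    qed
    also have "\<dots> = (\<integral>\<^sup>+r. ennreal (K * exp (l * r)) * indicator {0..s} r \<partial>lborel)"
      by (simp add: nn_integral_restrict_space)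
    also have "\<dots> = ennreal (K * exp (l * s) / l - K * exp (l * 0) / l)"
      using s K0 l by (intro nn_integral_FTC_Icc) (auto intro!: derivative_eq_intros simp: field_simps)
    also have "\<dots> \<le> ennreal (K * exp (l * s) / l)"
      using K0 l by (intro ennreal_leI) simp
    finally have "\<psi> s \<le> ennreal \<alpha> + ennreal \<gamma> * ennreal (K * exp (l * s) / l)"
      using le[OF s] by (meson add_left_mono mult_left_mono order_trans zero_le)
    also have "\<dots> = ennreal (\<alpha> + \<gamma> * (K * exp (l * s) / l))"
      using nonneg K0 l by (simp del: times_divide_eq_right flip: ennreal_mult ennreal_plus)
    finally have "enn2real (\<psi> s) \<le> \<alpha> + \<gamma> * (K * exp (l * s) / l)"
      using nonneg K0 l by (intro enn2real_leI) auto
    also have "\<gamma> * (K * exp (l * s) / l) = (\<gamma> / l) * (K * exp (l * s))" by simp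
    also have "\<dots> \<le> 1 / 2 * (K * exp (l * s))"
      using l K0 by (intro mult_right_mono) auto
    finally have "k s \<le> exp (- l * s) * (\<alpha> + 1 / 2 * (K * exp (l * s)))"
      unfolding k_def by (intro mult_left_mono) auto
    also have "\<dots> = exp (- l * s) * \<alpha> + K / 2"
      by (simp add: exp_minus field_simps)
    also have "exp (- l * s) * \<alpha> \<le> 1 * \<alpha>" using l s nonneg by (intro mult_right_mono) auto
    finally show ?thesis by simp
  qed
  have "K \<le> \<alpha> + K / 2"
    unfolding K_def using t step by (intro cSUP_least) (auto simp: K_def)
  then have "k t \<le> 2 * \<alpha>" using kK[OF t] by simp
  then have "exp (l * t) * k t \<le> exp (l * t) * (2 * \<alpha>)" by (intro mult_left_mono) auto
  then have "enn2real (\<psi> t) \<le> 2 * \<alpha> * exp (l * t)" by (simp add: k_def exp_minus field_simps)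
  then show ?thesis
    unfolding l_def by (subst fin[OF t]) (rule ennreal_leI)
qed

lemma sq_int_continuous_path:
  fixes y :: "real \<Rightarrow> 'v::euclidean_space"
  assumes y: "continuous_on {0..} y"
  shows "sq_int (lb t) y"
    and "0 \<le> t \<Longrightarrow> sq_norm (lb t) y = integral {0..t} (\<lambda>s. (norm (y s))\<^sup>2)"
proof -
  have c: "continuous_on {0..t} y" using y by (rule continuous_on_subset) auto
  then have c2: "continuous_on {0..t} (\<lambda>s. (norm (y s))\<^sup>2)" by (intro continuous_intros)
  have si: "set_integrable lborel {0..t} (\<lambda>s. (norm (y s))\<^sup>2)"
    by (rule borel_integrable_atLeastAtMost'[OF c2])
  have "y \<in> borel_measurable (restrict_space borel {0..t})"
    using c by (rule borel_measurable_continuous_on_restrict)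
  then have "y \<in> borel_measurable (lb t)"
    by (simp add: measurable_def space_restrict_space sets_restrict_space)
  then show "sq_int (lb t) y"
    using si by (simp add: sq_int_def integrable_restrict_space set_integrable_def)
  show "sq_norm (lb t) y = integral {0..t} (\<lambda>s. (norm (y s))\<^sup>2)" if "0 \<le> t"
    using set_borel_integral_eq_integral(2)[OF si]
    by (simp add: sq_norm_def integral_restrict_space set_lebesgue_integral_def)
qed

text \<open>The energy of a continuous path is continuous in time and starts at 0, so at some time r
  it equals \<open>min m (q t)\<close>. Up to r it is at most m, hence below c, and the indicator is
  1 there. This does the work of a stopping time.\<close>

lemma stopped_path_bound:
  fixes y :: "real \<Rightarrow> 'v::euclidean_space"
  assumes y: "continuous_on {0..} y" and m: "0 \<le> m" "m < c" and t: "0 \<le> t"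
  shows "ennreal (min m (sq_norm (lb t) y)) \<le>
    (\<integral>\<^sup>+s. indicator {s. sq_norm (lb s) y < c} s * ennreal ((norm (y s))\<^sup>2) \<partial>lb t)"
proof -
  define q where "q s = sq_norm (lb s) y" for s
  have "continuous_on {0..t} y" using y by (rule continuous_on_subset) auto
  then have "(\<lambda>s. (norm (y s))\<^sup>2) integrable_on {0..t}"
    by (intro integrable_continuous_real continuous_intros)
  then have "continuous_on {0..t} (\<lambda>r. integral {0..r} (\<lambda>s. (norm (y s))\<^sup>2))"
    by (rule indefinite_integral_continuous_1)
  then have cq: "continuous_on {0..t} q"
    by (rule continuous_on_eq) (auto simp: q_def sq_int_continuous_path(2)[OF y])
  have q0: "q 0 = 0" using sq_int_continuous_path(2)[OF y, of 0] by (simp add: q_def)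
  have "q 0 \<le> min m (q t)" "min m (q t) \<le> q t" using m q0 by (auto simp: q_def)
  from IVT'[OF this t cq] obtain r where r: "0 \<le> r" "r \<le> t" "q r = min m (q t)" by auto
  have "ennreal (min m (q t)) = (\<integral>\<^sup>+s. ennreal ((norm (y s))\<^sup>2) \<partial>lb r)"
    using nn_integral_sq_norm[OF sq_int_continuous_path(1)[OF y], of r] r by (simp add: q_def)
  also have "\<dots> = (\<integral>\<^sup>+s. ennreal ((norm (y s))\<^sup>2) * indicator {0..r} s \<partial>lborel)"
    by (simp add: nn_integral_restrict_space)
  also have "\<dots> \<le> (\<integral>\<^sup>+s. indicator {s. q s < c} s * ennreal ((norm (y s))\<^sup>2) * indicator {0..t} s \<partial>lborel)"
  proof (rule nn_integral_mono)
    fix s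
    have "q s < c" if "0 \<le> s" "s \<le> r"
      using sq_int_lb_mono(2)[OF sq_int_continuous_path(1)[OF y] that(2)] r m by (simp add: q_def)
    then show "ennreal ((norm (y s))\<^sup>2) * indicator {0..r} s \<le>
       indicator {s. q s < c} s * ennreal ((norm (y s))\<^sup>2) * indicator {0..t} s"
      using r by (auto simp: indicator_def)
  qed
  also have "\<dots> = (\<integral>\<^sup>+s. indicator {s. q s < c} s * ennreal ((norm (y s))\<^sup>2) \<partial>lb t)"
    by (simp add: nn_integral_restrict_space)
  finally show ?thesis by (simp add: q_def)
qed

lemma norm_integral_lb_sq:
  fixes f :: "real \<Rightarrow> 'v::euclidean_space"
  assumes f: "sq_int (lb t) f" and t: "0 \<le> t"
  shows "(norm (\<integral>s. f s \<partial>lb t))\<^sup>2 \<le> t * sq_norm (lb t) f"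
proof -
  have nf: "sq_int (lb t) (\<lambda>s. norm (f s))"
    using f by (auto simp: sq_int_def)
  have "norm (\<integral>s. f s \<partial>lb t) \<le> (\<integral>s. norm (f s) \<partial>lb t)"
    by (rule integral_norm_bound)
  also have "\<dots> \<le> \<bar>\<integral>s. norm (f s) \<bullet> 1 \<partial>lb t\<bar>" by simp
  also have "\<dots> \<le> sqrt (sq_norm (lb t) (\<lambda>s. norm (f s))) * sqrt (sq_norm (lb t) (\<lambda>s. 1 :: real))"
    by (intro inner_integral_Cauchy_Schwarz nf sq_int_const finite_measure_lb)
  also have "\<dots> = sqrt (t * sq_norm (lb t) f)"
    using measure_lb_UNIV[OF t] by (simp add: sq_norm_def real_sqrt_mult)
  finally have "(norm (\<integral>s. f s \<partial>lb t))\<^sup>2 \<le> (sqrt (t * sq_norm (lb t) f))\<^sup>2"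
    by (intro power_mono) auto
  then show ?thesis using t by simp
qed

lemma norm_sum_sq_le:
  fixes f :: "'i \<Rightarrow> 'v::real_normed_vector"
  shows "(norm (\<Sum>i\<in>A. f i))\<^sup>2 \<le> real (card A) * (\<Sum>i\<in>A. (norm (f i))\<^sup>2)"
proof -
  have "(norm (\<Sum>i\<in>A. f i))\<^sup>2 \<le> (\<Sum>i\<in>A. norm (f i))\<^sup>2"
    by (intro power_mono norm_sum) auto
  also have "\<dots> \<le> real (card A) * (\<Sum>i\<in>A. (norm (f i))\<^sup>2)"
    using sum_squared_le_sum_of_squares[of "\<lambda>i. norm (f i)" A] by (simp add: mult.commute)
  finally show ?thesis .
qed

lemma norm_add3_sq_le:
  fixes a b c :: "'v::real_normed_vector"
  shows "(norm (a + b + c))\<^sup>2 \<le> 3 * (norm a)\<^sup>2 + 3 * (norm b)\<^sup>2 + 3 * (norm c)\<^sup>2"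
proof -
  have "(norm (a + b + c))\<^sup>2 \<le> (norm a + norm b + norm c)\<^sup>2"
    by (intro power_mono order_trans[OF norm_triangle_ineq] add_mono norm_triangle_ineq) auto
  also have "\<dots> \<le> 3 * (norm a)\<^sup>2 + 3 * (norm b)\<^sup>2 + 3 * (norm c)\<^sup>2"
    using sum_squares_bound[of "norm a" "norm b"] sum_squares_bound[of "norm a" "norm c"]
      sum_squares_bound[of "norm b" "norm c"]
    by (simp add: power2_eq_square algebra_simps)
  finally show ?thesis .
qed

text \<open>The measure of integration depends on the point. Moving the variable upper limit into
  the integrand, as a factor over the fixed interval \<open>{0..t}\<close>, turns this into an
  ordinary integral with a parameter.\<close>

lemma (in wiener) running_integral_measurable:
  fixes G :: "real \<Rightarrow> 'a \<Rightarrow> 'v::euclidean_space"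
  assumes G: "proc G \<in> borel_measurable (MT t)"
  shows "(\<lambda>z. \<integral>r. G r (fst z) \<partial>lb (snd z)) \<in> borel_measurable (MT t)"
proof -
  interpret L: sigma_finite_measure "lb t" by simp
  have [measurable]: "(\<lambda>p. G (snd p) (fst (fst p))) \<in> borel_measurable (MT t \<Otimes>\<^sub>M lb t)"
    by (rule measurable_compose[OF _ G, of "\<lambda>p. (fst (fst p), snd p)", simplified]) measurable
  note id = measurable_lb_borel[OF measurable_ident, of t, unfolded id_def]
  have [measurable]: "(\<lambda>p. snd (fst p)) \<in> borel_measurable (MT t \<Otimes>\<^sub>M lb t)"
    by (rule measurable_compose[OF _ id]) measurable
  have [measurable]: "(\<lambda>p. snd p) \<in> borel_measurable (MT t \<Otimes>\<^sub>M lb t)"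
    by (rule measurable_compose[OF _ id]) measurable
  have "(\<lambda>(z, r). (if r \<le> snd z then 1 else 0 :: real) *\<^sub>R G r (fst z)) \<in> borel_measurable (MT t \<Otimes>\<^sub>M lb t)"
    unfolding split_beta' by measurable
  then have "(\<lambda>z. \<integral>r. (if r \<le> snd z then 1 else 0 :: real) *\<^sub>R G r (fst z) \<partial>lb t) \<in> borel_measurable (MT t)"
    by (rule L.borel_measurable_lebesgue_integral)
  then show ?thesis
  proof (rule measurable_cong[THEN iffD1, rotated])
    fix z assume "z \<in> space (MT t)"
    then have z: "0 \<le> snd z" "snd z \<le> t" by (auto simp: space_pair_measure space_restrict_space)
    show "(\<integral>r. (if r \<le> snd z then 1 else 0 :: real) *\<^sub>R G r (fst z) \<partial>lb t) = (\<integral>r. G r (fst z) \<partial>lb (snd z))"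
      using z
      by (simp add: integral_restrict_space) (intro Bochner_Integration.integral_cong; auto simp: indicator_def)
  qed
qed

text \<open>Affine coefficients treat both kinds of noise uniformly: multiplicative components will
  have h = 0, additive ones g = 0. The process v stands for the controlled part B u of the
  drift.\<close>

locale linear_sde = wiener M F I W
  for M :: "'a measure" and F I and W :: "'i \<Rightarrow> real \<Rightarrow> 'a \<Rightarrow> real" +
  fixes a :: "'v::euclidean_space \<Rightarrow> 'v" and v :: "real \<Rightarrow> 'a \<Rightarrow> 'v"
    and g :: "'i \<Rightarrow> 'v \<Rightarrow> 'v" and h :: "'i \<Rightarrow> 'v" and x0 :: 'v and x :: "real \<Rightarrow> 'a \<Rightarrow> 'v"
  assumes finI: "finite I"
    and a: "bounded_linear a" and g: "\<And>i. i \<in> I \<Longrightarrow> bounded_linear (g i)"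
    and v_adapted: "measurable_adapted M F v"
    and v_sq: "\<And>t. 0 \<le> t \<Longrightarrow> sq_int (MT t) (proc v)"
    and sol: "sde_solution M F I W (\<lambda>s w. a (x s w) + v s w) (\<lambda>i s w. g i (x s w) + h i) x0 x"
begin

abbreviation \<sigma> :: "'i \<Rightarrow> real \<Rightarrow> 'a \<Rightarrow> 'v" where
  "\<sigma> i s w \<equiv> g i (x s w) + h i"

lemma x_adapted: "measurable_adapted M F x"
  using sol by (simp add: sde_solution_def)

lemma x_proc [measurable]: "proc x \<in> borel_measurable (MT t)"
  by (rule borel_measurable_proc[OF x_adapted])

lemma x_F: "0 \<le> t \<Longrightarrow> x t \<in> borel_measurable (F t)"
  using x_adapted by (simp add: measurable_adapted_def)

lemma x_M: "0 \<le> t \<Longrightarrow> x t \<in> borel_measurable M"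
  using x_F measurable_F_M by blast

lemma x_cont: "AE w in M. continuous_on {0..} (\<lambda>t. x t w)"
  using sol by (simp add: sde_solution_def)

lemma x_path: "AE w in M. \<forall>t. sq_int (lb t) (\<lambda>s. x s w)"
  using x_cont by eventually_elim (auto intro: sq_int_continuous_path)

definition Q :: "real \<Rightarrow> 'a \<Rightarrow> real" where
  "Q t w = sq_norm (lb t) (\<lambda>s. x s w)"

lemma Q_nonneg [simp]: "0 \<le> Q t w" by (simp add: Q_def)

lemma Q_M [measurable]: "Q t \<in> borel_measurable M"
  unfolding Q_def by (rule borel_measurable_path_sq_norm[OF x_proc])

lemma Q_proc [measurable]: "proc Q \<in> borel_measurable (MT t)"
  unfolding Q_def sq_norm_def
  by (rule running_integral_measurable[of "\<lambda>s w. (norm (x s w))\<^sup>2"]) measurable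

lemma integral_equation:
  assumes t: "0 \<le> t"
  obtains J where "\<And>i. i \<in> I \<Longrightarrow> has_ito_integral M F (W i) t (\<sigma> i) (J i)"
    "AE w in M. x t w = x0 + (\<integral>s. a (x s w) + v s w \<partial>lb t) + (\<Sum>i\<in>I. J i w)"
proof -
  from sol t obtain J where J: "\<forall>i\<in>I. has_ito_integral M F (W i) t (\<sigma> i) (J i)"
    "AE w in M. x t w = x0 + (LINT s:{0..t}|lborel. a (x s w) + v s w) + (\<Sum>i\<in>I. J i w)"
    unfolding sde_solution_def by blast
  show ?thesis
    by (rule that[of J]) (use J in \<open>auto simp: set_lebesgue_integral_def integral_restrict_space\<close>)
qed

lemma coefficient_bound:
  obtains K where "0 \<le> K" "\<And>y. norm (a y) \<le> K * norm y"
    "\<And>i y. i \<in> I \<Longrightarrow> norm (g i y) \<le> K * norm y" "\<And>i. i \<in> I \<Longrightarrow> norm (h i) \<le> K"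
proof -
  define K where "K = onorm a + (\<Sum>i\<in>I. onorm (g i)) + (\<Sum>i\<in>I. norm (h i))"
  have a0: "0 \<le> onorm a" using a by (rule onorm_pos_le)
  have g0: "0 \<le> (\<Sum>i\<in>I. onorm (g i))" using g by (intro sum_nonneg onorm_pos_le)
  have h0: "0 \<le> (\<Sum>i\<in>I. norm (h i))" by (intro sum_nonneg) auto
  show ?thesis
  proof (rule that[of K])
    show "0 \<le> K" using a0 g0 h0 by (simp add: K_def)
    show "norm (a y) \<le> K * norm y" for y
      using onorm[OF a, of y] mult_right_mono[of "onorm a" K "norm y"] g0 h0 by (simp add: K_def)
    show "norm (g i y) \<le> K * norm y" if i: "i \<in> I" for i y
    proof -
      have "onorm (g i) \<le> (\<Sum>i\<in>I. onorm (g i))"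
        using i finI g onorm_pos_le by (intro member_le_sum) auto
      then show ?thesis
        using onorm[OF g[OF i], of y] mult_right_mono[of "onorm (g i)" K "norm y"] a0 h0 by (simp add: K_def)
    qed
    show "norm (h i) \<le> K" if i: "i \<in> I" for i
    proof -
      have "norm (h i) \<le> (\<Sum>i\<in>I. norm (h i))"
        using i finI by (intro member_le_sum) auto
      then show ?thesis using a0 g0 by (simp add: K_def)
    qed
  qed
qed

end

section \<open>The a priori bound on the second moment\<close>

context linear_sde
begin

text \<open>The square of x0 + drift + noise costs a factor 3; Cauchy-Schwarz in time handles the
  drift and \<open>stopped_ito_bound\<close> each noise term. One factor c comes from squaring a sum
  of c terms, the other from adding c equal bounds. The constants must not involve m. The indicator
  uses level m + 1 because \<open>stopped_path_bound\<close> needs a gap, and on that event Q <= 1 +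
  min m Q, so the gap costs only a constant.\<close>

lemma stopped_moment_bound:
  fixes m :: real
  assumes K: "0 \<le> K" "\<And>y. norm (a y) \<le> K * norm y"
    "\<And>i y. i \<in> I \<Longrightarrow> norm (g i y) \<le> K * norm y" "\<And>i. i \<in> I \<Longrightarrow> norm (h i) \<le> K"
    and t: "0 \<le> t" "t \<le> T" and m: "0 \<le> m"
    and c_def: "c = real (card I)"
    and \<alpha>: "\<alpha> = 3 * (norm x0)\<^sup>2 + 6 * T * K\<^sup>2 + 6 * T * sq_norm (MT T) (proc v) + 3 * c * c * (2 * K\<^sup>2 + 2 * K\<^sup>2 * T + 1)"
    and \<gamma>: "\<gamma> = 6 * T * K\<^sup>2 + 3 * c * c * (2 * K\<^sup>2)"
  shows "(\<integral>\<^sup>+w. indicator {w. Q t w < m + 1} w * ennreal ((norm (x t w))\<^sup>2) \<partial>M) \<le>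
    ennreal (\<alpha> + \<gamma> * expectation (\<lambda>w. min m (Q t w)))"
proof -
  have T: "0 \<le> T" using t by simp
  obtain J where J: "\<And>i. i \<in> I \<Longrightarrow> has_ito_integral M F (W i) t (\<sigma> i) (J i)"
    and eq: "AE w in M. x t w = x0 + (\<integral>s. a (x s w) + v s w \<partial>lb t) + (\<Sum>i\<in>I. J i w)"
    using integral_equation[OF t(1)] by blast
  have c0: "0 \<le> c" by (simp add: c_def)
  define V where "V w = sq_norm (lb T) (\<lambda>s. v s w)" for w
  define q where "q i w = sq_norm (lb t) (\<lambda>s. \<sigma> i s w)" for i w
  \<comment> \<open>On the event Q < m + 1 every noise coefficient has energy below this level; the
    final 1 makes the inequality strict and keeps b positive even if K is 0.\<close>
  define b where "b = 2 * K\<^sup>2 * (m + 1) + 2 * K\<^sup>2 * t + 1"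
  define \<psi> where "\<psi> = expectation (\<lambda>w. min m (Q t w))"
  \<comment> \<open>Bounds the contribution of the initial value and the drift on the event Q < m +
    1.\<close>
  define u where "u w = 3 * (norm x0)\<^sup>2 + 6 * t * K\<^sup>2 * (1 + min m (Q t w)) + 6 * t * V w" for w
  have b0: "0 < b" using K m t by (simp add: b_def add_nonneg_pos)
  have V0: "0 \<le> V w" for w by (simp add: V_def)
  have \<psi>0: "0 \<le> \<psi>" unfolding \<psi>_def using m by (intro integral_nonneg_AE AE_I2) auto
  have minQ: "integrable M (\<lambda>w. min m (Q t w))"
    by (rule integrable_const_bound[where B=m]) (use m in auto)
  have V_int: "integrable M V" and EV: "expectation V = sq_norm (MT T) (proc v)"
    using sq_norm_product(1,2)[OF v_sq[OF T]] by (simp_all add: V_def[abs_def])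
  have v_path: "AE w in M. sq_int (lb T) (\<lambda>s. v s w)" by (rule sq_norm_product(3)[OF v_sq[OF T]])
  have [measurable]: "J i \<in> borel_measurable M" if "i \<in> I" for i
    using J[OF that] by (simp add: has_ito_integral_def)
  have [measurable]: "q i \<in> borel_measurable M" if "i \<in> I" for i
    unfolding q_def by (rule borel_measurable_path_sq_norm[OF has_ito_integral_measurable[OF J[OF that]]])
  have q_le: "AE w in M. \<forall>i\<in>I. q i w \<le> 2 * K\<^sup>2 * Q t w + 2 * K\<^sup>2 * t"
    using x_path
  proof eventually_elim
    fix w assume "\<forall>t. sq_int (lb t) (\<lambda>s. x s w)"
    then have X: "sq_int (lb t) (\<lambda>s. x s w)" by blast
    show "\<forall>i\<in>I. q i w \<le> 2 * K\<^sup>2 * Q t w + 2 * K\<^sup>2 * t"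
    proof
      fix i assume i: "i \<in> I"
      have gx: "sq_int (lb t) (\<lambda>s. g i (x s w))" by (rule sq_int_linear[OF g[OF i] X])
      have "q i w \<le> 2 * sq_norm (lb t) (\<lambda>s. g i (x s w)) + 2 * sq_norm (lb t) (\<lambda>s. h i)"
        unfolding q_def by (intro sq_norm_add_le gx sq_int_const) auto
      moreover have "sq_norm (lb t) (\<lambda>s. g i (x s w)) \<le> K\<^sup>2 * Q t w"
        unfolding Q_def by (intro sq_norm_scaled_le X gx K(3) i)
      moreover have "sq_norm (lb t) (\<lambda>s. h i) \<le> K\<^sup>2 * t"
      proof -
        have "(norm (h i))\<^sup>2 \<le> K\<^sup>2" by (intro power_mono K(4) i) auto
        then show ?thesis
          using measure_lb_UNIV[OF t(1)] t by (simp add: sq_norm_def mult.commute mult_left_mono)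
      qed
      ultimately show "q i w \<le> 2 * K\<^sup>2 * Q t w + 2 * K\<^sup>2 * t" by linarith
    qed
  qed
  have bound: "AE w in M. indicator {w. Q t w < m + 1} w * ennreal ((norm (x t w))\<^sup>2) \<le>
     ennreal (u w) + (\<Sum>i\<in>I. ennreal (3 * c) * (indicator {w. q i w < b} w * ennreal ((norm (J i w))\<^sup>2)))"
    using x_path v_path eq q_le
  proof eventually_elim
    fix w assume X: "\<forall>t. sq_int (lb t) (\<lambda>s. x s w)" and v: "sq_int (lb T) (\<lambda>s. v s w)"
      and e: "x t w = x0 + (\<integral>s. a (x s w) + v s w \<partial>lb t) + (\<Sum>i\<in>I. J i w)"
      and q: "\<forall>i\<in>I. q i w \<le> 2 * K\<^sup>2 * Q t w + 2 * K\<^sup>2 * t"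
    show "indicator {w. Q t w < m + 1} w * ennreal ((norm (x t w))\<^sup>2) \<le>
     ennreal (u w) + (\<Sum>i\<in>I. ennreal (3 * c) * (indicator {w. q i w < b} w * ennreal ((norm (J i w))\<^sup>2)))"
    proof (cases "Q t w < m + 1")
      case True
      have X: "sq_int (lb t) (\<lambda>s. x s w)" using X by blast
      have vt: "sq_int (lb t) (\<lambda>s. v s w)" "sq_norm (lb t) (\<lambda>s. v s w) \<le> V w"
        using sq_int_lb_mono[OF v t(2)] by (auto simp: V_def)
      have ax: "sq_int (lb t) (\<lambda>s. a (x s w))" by (rule sq_int_linear[OF a X])
      have qb: "q i w < b" if "i \<in> I" for i
      proof -
        have "q i w \<le> 2 * K\<^sup>2 * Q t w + 2 * K\<^sup>2 * t" using q that by blast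
        also have "\<dots> \<le> 2 * K\<^sup>2 * (m + 1) + 2 * K\<^sup>2 * t"
          using True by (intro add_mono mult_left_mono) auto
        finally show ?thesis by (simp add: b_def)
      qed
      have drift: "(norm (\<integral>s. a (x s w) + v s w \<partial>lb t))\<^sup>2 \<le> 2 * t * K\<^sup>2 * (1 + min m (Q t w)) + 2 * t * V w"
      proof -
        have "(norm (\<integral>s. a (x s w) + v s w \<partial>lb t))\<^sup>2 \<le> t * sq_norm (lb t) (\<lambda>s. a (x s w) + v s w)"
          by (intro norm_integral_lb_sq sq_int_add ax vt t)
        also have "\<dots> \<le> t * (2 * sq_norm (lb t) (\<lambda>s. a (x s w)) + 2 * sq_norm (lb t) (\<lambda>s. v s w))"
          by (intro mult_left_mono sq_norm_add_le ax vt t)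
        also have "\<dots> \<le> t * (2 * (K\<^sup>2 * (1 + min m (Q t w))) + 2 * V w)"
        proof (intro mult_left_mono add_mono vt t)
          have "sq_norm (lb t) (\<lambda>s. a (x s w)) \<le> K\<^sup>2 * Q t w"
            unfolding Q_def by (intro sq_norm_scaled_le X ax K(2))
          also have "\<dots> \<le> K\<^sup>2 * (1 + min m (Q t w))" using True by (intro mult_left_mono) auto
          finally show "sq_norm (lb t) (\<lambda>s. a (x s w)) \<le> K\<^sup>2 * (1 + min m (Q t w))" .
        qed auto
        finally show ?thesis by (simp add: algebra_simps)
      qed
      have "(norm (x t w))\<^sup>2 \<le> 3 * (norm x0)\<^sup>2 + 3 * (norm (\<integral>s. a (x s w) + v s w \<partial>lb t))\<^sup>2 + 3 * (norm (\<Sum>i\<in>I. J i w))\<^sup>2"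
        unfolding e by (rule norm_add3_sq_le)
      also have "\<dots> \<le> u w + 3 * (c * (\<Sum>i\<in>I. (norm (J i w))\<^sup>2))"
        using drift norm_sum_sq_le[of "\<lambda>i. J i w" I] by (simp add: u_def c_def)
      also have "\<dots> = u w + (\<Sum>i\<in>I. 3 * c * (norm (J i w))\<^sup>2)" by (simp add: sum_distrib_left mult.assoc)
      finally have "ennreal ((norm (x t w))\<^sup>2) \<le> ennreal (u w + (\<Sum>i\<in>I. 3 * c * (norm (J i w))\<^sup>2))"
        by (rule ennreal_leI)
      also have "\<dots> = ennreal (u w) + (\<Sum>i\<in>I. ennreal (3 * c) * ennreal ((norm (J i w))\<^sup>2))"
      proof -
        have "0 \<le> u w" using t m V0[of w] by (simp add: u_def)
        then show ?thesis using c0 by (simp add: ennreal_plus sum_nonneg sum_ennreal flip: ennreal_mult)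
      qed
      also have "\<dots> = ennreal (u w) + (\<Sum>i\<in>I. ennreal (3 * c) * (indicator {w. q i w < b} w * ennreal ((norm (J i w))\<^sup>2)))"
        using qb by (intro arg_cong2[where f="(+)"] sum.cong) auto
      finally show ?thesis using True by simp
    qed simp
  qed
  have [measurable]: "u \<in> borel_measurable M"
    unfolding u_def using V_int by measurable
  have u_nn: "(\<integral>\<^sup>+w. ennreal (u w) \<partial>M) = ennreal (3 * (norm x0)\<^sup>2 + 6 * t * K\<^sup>2 * (1 + \<psi>) + 6 * t * expectation V)"
  proof -
    have "integrable M u" "expectation u = 3 * (norm x0)\<^sup>2 + 6 * t * K\<^sup>2 * (1 + \<psi>) + 6 * t * expectation V"
      using minQ V_int by (auto simp: u_def[abs_def] \<psi>_def prob_space integrable_const)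
    moreover have "AE w in M. 0 \<le> u w" using t m V0 by (intro AE_I2) (simp add: u_def)
    ultimately show ?thesis by (simp add: nn_integral_eq_integral)
  qed
  have J_nn: "(\<integral>\<^sup>+w. indicator {w. q i w < b} w * ennreal ((norm (J i w))\<^sup>2) \<partial>M)
      \<le> ennreal (2 * K\<^sup>2 * (1 + \<psi>) + 2 * K\<^sup>2 * t + 1)" if i: "i \<in> I" for i
  proof -
    have "(\<integral>\<^sup>+w. indicator {w. q i w < b} w * ennreal ((norm (J i w))\<^sup>2) \<partial>M) \<le> (\<integral>\<^sup>+w. ennreal (min b (q i w)) \<partial>M)"
      unfolding q_def by (rule stopped_ito_bound[OF J[OF i] i t(1) b0])
    \<comment> \<open>If Q is at most m + 1, then Q <= 1 + min m Q and the bound on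
      \<open>q i\<close> applies; otherwise min m Q = m and the right side is exactly b.\<close>
    also have "\<dots> \<le> (\<integral>\<^sup>+w. ennreal (2 * K\<^sup>2 * (1 + min m (Q t w)) + 2 * K\<^sup>2 * t + 1) \<partial>M)"
    proof (rule nn_integral_mono_AE, use q_le in eventually_elim)
      fix w assume "\<forall>i\<in>I. q i w \<le> 2 * K\<^sup>2 * Q t w + 2 * K\<^sup>2 * t"
      then have q: "q i w \<le> 2 * K\<^sup>2 * Q t w + 2 * K\<^sup>2 * t" using i by blast
      show "ennreal (min b (q i w)) \<le> ennreal (2 * K\<^sup>2 * (1 + min m (Q t w)) + 2 * K\<^sup>2 * t + 1)"
      proof (cases "Q t w \<le> m + 1")
        case True
        have "2 * K\<^sup>2 * Q t w \<le> 2 * K\<^sup>2 * (1 + min m (Q t w))" using True by (intro mult_left_mono) auto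
        then show ?thesis using q by (intro ennreal_leI) auto
      next
        case False
        then show ?thesis by (intro ennreal_leI) (auto simp: b_def min_def add.commute)
      qed
    qed
    also have "\<dots> = ennreal (2 * K\<^sup>2 * (1 + \<psi>) + 2 * K\<^sup>2 * t + 1)"
    proof -
      have "(\<integral>\<^sup>+w. ennreal (2 * K\<^sup>2 * (1 + min m (Q t w)) + 2 * K\<^sup>2 * t + 1) \<partial>M) =
         ennreal (expectation (\<lambda>w. 2 * K\<^sup>2 * (1 + min m (Q t w)) + 2 * K\<^sup>2 * t + 1))"
        using minQ m t by (intro nn_integral_eq_integral) (auto simp: integrable_const)
      also have "expectation (\<lambda>w. 2 * K\<^sup>2 * (1 + min m (Q t w)) + 2 * K\<^sup>2 * t + 1) = 2 * K\<^sup>2 * (1 + \<psi>) + 2 * K\<^sup>2 * t + 1"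
        using minQ by (simp add: \<psi>_def prob_space integrable_const)
      finally show ?thesis .
    qed
    finally show ?thesis .
  qed
  have "(\<integral>\<^sup>+w. indicator {w. Q t w < m + 1} w * ennreal ((norm (x t w))\<^sup>2) \<partial>M) \<le>
    (\<integral>\<^sup>+w. ennreal (u w) + (\<Sum>i\<in>I. ennreal (3 * c) * (indicator {w. q i w < b} w * ennreal ((norm (J i w))\<^sup>2))) \<partial>M)"
    using bound by (rule nn_integral_mono_AE)
  also have "\<dots> = (\<integral>\<^sup>+w. ennreal (u w) \<partial>M) +
     (\<Sum>i\<in>I. ennreal (3 * c) * (\<integral>\<^sup>+w. indicator {w. q i w < b} w * ennreal ((norm (J i w))\<^sup>2) \<partial>M))"
    by (simp add: nn_integral_add nn_integral_sum nn_integral_cmult)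
  also have "\<dots> \<le> ennreal (3 * (norm x0)\<^sup>2 + 6 * t * K\<^sup>2 * (1 + \<psi>) + 6 * t * expectation V) +
     (\<Sum>i\<in>I. ennreal (3 * c) * ennreal (2 * K\<^sup>2 * (1 + \<psi>) + 2 * K\<^sup>2 * t + 1))"
    unfolding u_nn using J_nn by (intro add_left_mono sum_mono mult_left_mono) auto
  also have "\<dots> = ennreal (3 * (norm x0)\<^sup>2 + 6 * t * K\<^sup>2 * (1 + \<psi>) + 6 * t * expectation V +
      c * (3 * c * (2 * K\<^sup>2 * (1 + \<psi>) + 2 * K\<^sup>2 * t + 1)))"
  proof -
    have "0 \<le> expectation V" using V0 by (intro integral_nonneg_AE AE_I2)
    then show ?thesis
      using \<psi>0 t c0 by (simp add: ennreal_plus ennreal_mult c_def ennreal_of_nat_eq_real_of_nat)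
  qed
  also have "\<dots> \<le> ennreal (3 * (norm x0)\<^sup>2 + 6 * T * K\<^sup>2 * (1 + \<psi>) + 6 * T * expectation V +
      c * (3 * c * (2 * K\<^sup>2 * (1 + \<psi>) + 2 * K\<^sup>2 * T + 1)))"
  proof -
    have "0 \<le> expectation V" using V0 by (intro integral_nonneg_AE AE_I2)
    then show ?thesis
      using \<psi>0 t c0 by (intro ennreal_leI add_mono mult_mono order_refl) auto
  qed
  finally show ?thesis
    unfolding EV \<psi>_def[symmetric] \<alpha> \<gamma> by (simp add: algebra_simps)
qed

text \<open>The expectation of \<open>min m (Q T w)\<close> is bounded free of m, and m tends to
  infinity. The time-integrated form already makes all integrands square integrable; finiteness at a
  fixed time is then part of \<open>energy_identity\<close>.\<close>

lemma finite_energy: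
  assumes T: "0 \<le> T"
  shows "sq_int (MT T) (proc x)"
proof -
  interpret P: pair_sigma_finite M "lb T" by (rule pair_sigma)
  obtain K where K: "0 \<le> K" "\<And>y. norm (a y) \<le> K * norm y"
    "\<And>i y. i \<in> I \<Longrightarrow> norm (g i y) \<le> K * norm y" "\<And>i. i \<in> I \<Longrightarrow> norm (h i) \<le> K"
    using coefficient_bound by blast
  define c where "c = real (card I)"
  define \<alpha> where "\<alpha> = 3 * (norm x0)\<^sup>2 + 6 * T * K\<^sup>2 + 6 * T * sq_norm (MT T) (proc v) + 3 * c * c * (2 * K\<^sup>2 + 2 * K\<^sup>2 * T + 1)"
  define \<gamma> where "\<gamma> = 6 * T * K\<^sup>2 + 3 * c * c * (2 * K\<^sup>2)"
  have nonneg: "0 \<le> \<alpha>" "0 \<le> \<gamma>" using T by (auto simp: \<alpha>_def \<gamma>_def c_def)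
  define C where "C = 2 * (\<alpha> * T) * exp ((2 * \<gamma> + 1) * T)"
  have main: "(\<integral>\<^sup>+w. ennreal (min m (Q T w)) \<partial>M) \<le> ennreal C" if m: "0 \<le> m" for m
  proof -
    define \<psi> where "\<psi> t = (\<integral>\<^sup>+w. ennreal (min m (Q t w)) \<partial>M)" for t
    have \<psi>_exp: "\<psi> t = ennreal (expectation (\<lambda>w. min m (Q t w)))" for t
      unfolding \<psi>_def
      by (intro nn_integral_eq_integral integrable_const_bound[where B=m]) (use m in auto)
    have step: "\<psi> t \<le> ennreal (\<alpha> * T) + ennreal \<gamma> * (\<integral>\<^sup>+s. \<psi> s \<partial>lb t)" if t: "0 \<le> t" "t \<le> T" for t
    proof -
      interpret P: pair_sigma_finite M "lb t" by (rule pair_sigma)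
      have meas: "(\<lambda>z. indicator {z. proc Q z < m + 1} z * ennreal ((norm (proc x z))\<^sup>2))
         \<in> borel_measurable (MT t)"
        by measurable
      \<comment> \<open>The path bound followed by Fubini reduces the energy to stopped moments at
        fixed times, which in turn are bounded by \<open>\<psi>\<close> at those times: this closes
        the loop for Gronwall's lemma.\<close>
      have "\<psi> t \<le> (\<integral>\<^sup>+w. (\<integral>\<^sup>+s. indicator {s. Q s w < m + 1} s * ennreal ((norm (x s w))\<^sup>2) \<partial>lb t) \<partial>M)"
        unfolding \<psi>_def
      proof (rule nn_integral_mono_AE, use x_cont in eventually_elim)
        fix w assume "continuous_on {0..} (\<lambda>t. x t w)"
        from stopped_path_bound[OF this m _ t(1), of "m + 1"]
        show "ennreal (min m (Q t w)) \<le> (\<integral>\<^sup>+s. indicator {s. Q s w < m + 1} s * ennreal ((norm (x s w))\<^sup>2) \<partial>lb t)"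
          by (simp add: Q_def)
      qed
      also have "\<dots> = (\<integral>\<^sup>+s. (\<integral>\<^sup>+w. indicator {w. Q s w < m + 1} w * ennreal ((norm (x s w))\<^sup>2) \<partial>M) \<partial>lb t)"
        using P.Fubini[OF meas] by (simp add: indicator_def)
      also have "\<dots> \<le> (\<integral>\<^sup>+s. ennreal \<alpha> + ennreal \<gamma> * \<psi> s \<partial>lb t)"
      proof (rule nn_integral_mono)
        fix s assume "s \<in> space (lb t)"
        then have s: "0 \<le> s" "s \<le> T" using t by (auto simp: space_restrict_space)
        have E: "0 \<le> expectation (\<lambda>w. min m (Q s w))" using m by (intro integral_nonneg_AE AE_I2) auto
        have "(\<integral>\<^sup>+w. indicator {w. Q s w < m + 1} w * ennreal ((norm (x s w))\<^sup>2) \<partial>M) \<le>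
            ennreal (\<alpha> + \<gamma> * expectation (\<lambda>w. min m (Q s w)))"
          by (rule stopped_moment_bound[OF K s m c_def \<alpha>_def \<gamma>_def])
        then show "(\<integral>\<^sup>+w. indicator {w. Q s w < m + 1} w * ennreal ((norm (x s w))\<^sup>2) \<partial>M) \<le> ennreal \<alpha> + ennreal \<gamma> * \<psi> s"
          using nonneg E by (simp add: \<psi>_exp ennreal_plus ennreal_mult)
      qed
      also have "\<dots> = ennreal \<alpha> * emeasure (lb t) (space (lb t)) + ennreal \<gamma> * (\<integral>\<^sup>+s. \<psi> s \<partial>lb t)"
      proof -
        have [measurable]: "\<psi> \<in> borel_measurable (lb t)"
        proof -
          have "(\<lambda>z. ennreal (min m (proc Q z))) \<in> borel_measurable (MT t)" by measurable
          from measurable_pair_swap[OF this]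
          have "(\<lambda>(s, w). ennreal (min m (Q s w))) \<in> borel_measurable (lb t \<Otimes>\<^sub>M M)" by (simp add: split_beta')
          then show ?thesis unfolding \<psi>_def by (rule borel_measurable_nn_integral)
        qed
        show ?thesis by (simp add: nn_integral_add nn_integral_cmult)
      qed
      also have "emeasure (lb t) (space (lb t)) = ennreal t"
        using t by (simp add: emeasure_restrict_space space_restrict_space)
      also have "ennreal \<alpha> * ennreal t \<le> ennreal (\<alpha> * T)"
        using t nonneg by (simp add: ennreal_leI mult_left_mono flip: ennreal_mult)
      finally show ?thesis by (simp add: add_right_mono)
    qed
    have bdd: "\<psi> t \<le> ennreal m" for t
    proof -
      have "\<psi> t \<le> (\<integral>\<^sup>+w. ennreal m \<partial>M)" unfolding \<psi>_def by (intro nn_integral_mono ennreal_leI) auto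
      then show ?thesis by (simp add: emeasure_space_1)
    qed
    have "\<psi> T \<le> ennreal (2 * (\<alpha> * T) * exp ((2 * \<gamma> + 1) * T))"
      by (rule gronwall_ennreal[where T=T and N=m]) (use step bdd nonneg T m in auto)
    then show ?thesis by (simp add: \<psi>_def C_def)
  qed
  have "(\<integral>\<^sup>+z. ennreal ((norm (proc x z))\<^sup>2) \<partial>MT T) =
     (\<integral>\<^sup>+w. (\<integral>\<^sup>+s. ennreal ((norm (x s w))\<^sup>2) \<partial>lb T) \<partial>M)"
  proof -
    have "(\<lambda>z. ennreal ((norm (proc x z))\<^sup>2)) \<in> borel_measurable (MT T)" by measurable
    from P.M2.nn_integral_fst[OF this] show ?thesis by simp
  qed
  also have "\<dots> = (\<integral>\<^sup>+w. ennreal (Q T w) \<partial>M)"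
    using x_path by (intro nn_integral_cong_AE) (auto elim!: eventually_mono simp: Q_def nn_integral_sq_norm)
  also have "\<dots> = (\<integral>\<^sup>+w. liminf (\<lambda>n. ennreal (min (real n) (Q T w))) \<partial>M)"
  proof (rule nn_integral_cong)
    fix w
    obtain n0 :: nat where "Q T w \<le> real n0" using real_arch_simple by blast
    then have "eventually (\<lambda>n. ennreal (min (real n) (Q T w)) = ennreal (Q T w)) sequentially"
      by (intro eventually_sequentiallyI[of n0]) (auto simp: min_def)
    then have "(\<lambda>n. ennreal (min (real n) (Q T w))) \<longlonglongrightarrow> ennreal (Q T w)" by (rule tendsto_eventually)
    then show "ennreal (Q T w) = liminf (\<lambda>n. ennreal (min (real n) (Q T w)))"
      by (intro lim_imp_Liminf[symmetric]) auto
  qed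
  also have "\<dots> \<le> liminf (\<lambda>n. \<integral>\<^sup>+w. ennreal (min (real n) (Q T w)) \<partial>M)"
    by (rule nn_integral_liminf) measurable
  also have "\<dots> \<le> liminf (\<lambda>n :: nat. ennreal C)"
    using main by (intro Liminf_mono always_eventually allI) auto
  also have "\<dots> = ennreal C" by (simp add: Liminf_const)
  also have "\<dots> < \<infinity>" by simp
  finally show ?thesis by (intro sq_intI_nn x_proc)
qed

end

section \<open>The energy identity\<close>

lemma sq_int_fst:
  assumes f: "sq_int N f" and L: "finite_measure L"
  shows "sq_int (N \<Otimes>\<^sub>M L) (\<lambda>z. f (fst z))"
proof (rule sq_intI_nn)
  interpret L: finite_measure L by fact
  have [measurable]: "f \<in> borel_measurable N" using f by (rule sq_int_measurable)
  show "(\<lambda>z. f (fst z)) \<in> borel_measurable (N \<Otimes>\<^sub>M L)" by measurable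
  have "(\<integral>\<^sup>+z. ennreal ((norm (f (fst z)))\<^sup>2) \<partial>(N \<Otimes>\<^sub>M L)) = (\<integral>\<^sup>+y. (\<integral>\<^sup>+s. ennreal ((norm (f y))\<^sup>2) \<partial>L) \<partial>N)"
    by (subst L.nn_integral_fst[symmetric]) auto
  also have "\<dots> = ennreal (sq_norm N f) * emeasure L (space L)"
    by (simp add: nn_integral_multc nn_integral_sq_norm[OF f])
  also have "\<dots> < \<infinity>"
    by (simp add: ennreal_mult_eq_top_iff less_top[symmetric])
  finally show "(\<integral>\<^sup>+z. ennreal ((norm (f (fst z)))\<^sup>2) \<partial>(N \<Otimes>\<^sub>M L)) < \<infinity>" .
qed

lemma sq_int_snd:
  assumes f: "sq_int L f" and N: "finite_measure N" and L: "finite_measure L"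
  shows "sq_int (N \<Otimes>\<^sub>M L) (\<lambda>z. f (snd z))"
proof -
  interpret P: pair_sigma_finite N L
    using N L by (intro pair_sigma_finite.intro finite_measure.axioms(1))
  have [measurable]: "f \<in> borel_measurable L" using f by (rule sq_int_measurable)
  show ?thesis
    using P.integrable_product_swap_iff[of "\<lambda>z. (norm (f (snd z)))\<^sup>2"] sq_int_fst[OF f N]
    by (simp add: sq_int_def split_beta')
qed

lemma integral_lb_cut:
  fixes f :: "real \<Rightarrow> 'v::euclidean_space"
  assumes "0 \<le> s" "s \<le> t"
  shows "(\<integral>r. (if r \<le> s then f r else 0) \<partial>lb t) = (\<integral>r. f r \<partial>lb s)"
  using assms
  by (simp add: integral_restrict_space) (intro Bochner_Integration.integral_cong; auto simp: indicator_def)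

text \<open>The product rule without differentiation: the left side is a double integral over a
  square, whose two triangles contribute equally because S is symmetric.\<close>

lemma running_integral_quadratic:
  fixes f :: "real \<Rightarrow> 'v::euclidean_space" and S :: "'v \<Rightarrow> 'v"
  assumes f: "sq_int (lb t) f" and S: "bounded_linear S" and sym: "\<And>u w. u \<bullet> S w = w \<bullet> S u"
  shows "(\<integral>s. f s \<partial>lb t) \<bullet> S (\<integral>s. f s \<partial>lb t) = 2 * (\<integral>s. f s \<bullet> S (\<integral>r. f r \<partial>lb s) \<partial>lb t)"
proof -
  interpret P: pair_sigma_finite "lb t" "lb t" by (simp add: pair_sigma_finite_def)
  note fin = finite_measure_lb[of t]
  have fi: "integrable (lb t) f" using sq_int_imp_integrable[OF fin f] .
  have Sf: "sq_int (lb t) (\<lambda>s. S (f s))" by (rule sq_int_linear[OF S f])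
  have Si: "integrable (lb t) (\<lambda>s. S (f s))" using sq_int_imp_integrable[OF fin Sf] .
  define H where "H z = f (fst z) \<bullet> S (f (snd z))" for z
  have H: "integrable (lb t \<Otimes>\<^sub>M lb t) H"
    unfolding H_def by (intro sq_int_inner sq_int_fst sq_int_snd f Sf fin)
  note id = measurable_lb_borel[OF measurable_ident, of t, unfolded id_def]
  have [measurable]: "fst \<in> borel_measurable (lb t \<Otimes>\<^sub>M lb t)" "snd \<in> borel_measurable (lb t \<Otimes>\<^sub>M lb t)"
    using measurable_compose[OF measurable_fst id, of "lb t"] measurable_compose[OF measurable_snd id, of "lb t"] by auto
  have H1: "integrable (lb t \<Otimes>\<^sub>M lb t) (\<lambda>(s, r). if r \<le> s then H (s, r) else 0)"
    by (rule Bochner_Integration.integrable_bound[OF H]) (use H in \<open>auto simp: split_beta'\<close>)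
  have H2: "integrable (lb t \<Otimes>\<^sub>M lb t) (\<lambda>(s, r). if s < r then H (s, r) else 0)"
    by (rule Bochner_Integration.integrable_bound[OF H]) (use H in \<open>auto simp: split_beta'\<close>)
  define A where "A = (\<integral>s. \<integral>r. (if r \<le> s then H (s, r) else 0) \<partial>lb t \<partial>lb t)"
  have A1: "(\<integral>z. (case z of (s, r) \<Rightarrow> if r \<le> s then H (s, r) else 0) \<partial>(lb t \<Otimes>\<^sub>M lb t)) = A"
    unfolding A_def using P.integral_fst'[OF H1] by simp
  have A2: "(\<integral>z. (case z of (s, r) \<Rightarrow> if s < r then H (s, r) else 0) \<partial>(lb t \<Otimes>\<^sub>M lb t)) = A"
  proof -
    have "(\<integral>z. (case z of (s, r) \<Rightarrow> if s < r then H (s, r) else 0) \<partial>(lb t \<Otimes>\<^sub>M lb t)) =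
       (\<integral>r. \<integral>s. (if s < r then H (s, r) else 0) \<partial>lb t \<partial>lb t)"
      using P.integral_snd[OF H2] by simp
    also have "\<dots> = A"
      unfolding A_def
    proof (rule Bochner_Integration.integral_cong[OF refl])
      fix r
      \<comment> \<open>Exchanging the variables maps the triangle s < r to the other one up to the
        diagonal, which for each r is a single null point.\<close>
      have ne: "AE s in lb t. s \<noteq> r"
        using AE_lborel_singleton[of r] by (auto simp: AE_restrict_space_iff elim!: eventually_mono)
      have Hm: "(\<lambda>s. H (s, r)) \<in> borel_measurable (lb t)" "(\<lambda>s. H (r, s)) \<in> borel_measurable (lb t)"
        unfolding H_def using fi Si by auto
      show "(\<integral>s. (if s < r then H (s, r) else 0) \<partial>lb t) = (\<integral>s. (if s \<le> r then H (r, s) else 0) \<partial>lb t)"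
      proof (rule integral_cong_AE)
        show "(\<lambda>s. if s < r then H (s, r) else 0) \<in> borel_measurable (lb t)"
          using id Hm by (intro measurable_If borel_measurable_less) auto
        show "(\<lambda>s. if s \<le> r then H (r, s) else 0) \<in> borel_measurable (lb t)"
          using id Hm by (intro measurable_If borel_measurable_le) auto
        show "AE s in lb t. (if s < r then H (s, r) else 0) = (if s \<le> r then H (r, s) else 0)"
          using ne
        proof eventually_elim
          case (elim s)
          then show ?case using sym[of "f s" "f r"] by (auto simp: H_def)
        qed
      qed
    qed
    finally show ?thesis .
  qed
  have "(\<integral>s. f s \<partial>lb t) \<bullet> S (\<integral>s. f s \<partial>lb t) = (\<integral>s. \<integral>r. H (s, r) \<partial>lb t \<partial>lb t)"
    unfolding H_def using fi Si integral_bounded_linear[OF S fi] by simp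
  also have "\<dots> = (\<integral>z. H z \<partial>(lb t \<Otimes>\<^sub>M lb t))" using P.integral_fst'[OF H] .
  also have "\<dots> = (\<integral>z. (case z of (s, r) \<Rightarrow> if r \<le> s then H (s, r) else 0) +
      (case z of (s, r) \<Rightarrow> if s < r then H (s, r) else 0) \<partial>(lb t \<Otimes>\<^sub>M lb t))"
    by (intro Bochner_Integration.integral_cong) auto
  also have "\<dots> = 2 * A" using H1 H2 A1 A2 by simp
  also have "A = (\<integral>s. f s \<bullet> S (\<integral>r. f r \<partial>lb s) \<partial>lb t)"
    unfolding A_def
  proof (rule Bochner_Integration.integral_cong[OF refl])
    fix s assume "s \<in> space (lb t)"
    then have s: "0 \<le> s" "s \<le> t" by (auto simp: space_restrict_space)
    have fs: "integrable (lb s) f" using sq_int_imp_integrable[OF finite_measure_lb sq_int_lb_mono(1)[OF f s(2)]] .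
    have Ss: "integrable (lb s) (\<lambda>r. S (f r))" by (rule integrable_bounded_linear[OF S fs])
    have "(\<integral>r. (if r \<le> s then H (s, r) else 0) \<partial>lb t) = (\<integral>r. f s \<bullet> S (f r) \<partial>lb s)"
      unfolding H_def fst_conv snd_conv by (rule integral_lb_cut[OF s])
    also have "\<dots> = f s \<bullet> S (\<integral>r. f r \<partial>lb s)"
      by (simp only: integral_inner_right[OF Ss] integral_bounded_linear[OF S fs])
    finally show "(\<integral>r. (if r \<le> s then H (s, r) else 0) \<partial>lb t) = f s \<bullet> S (\<integral>r. f r \<partial>lb s)" .
  qed
  finally show ?thesis .
qed

section \<open>Splitting the solution into a drift part and a martingale part\<close>

context linear_sde
begin

definition b :: "real \<Rightarrow> 'a \<Rightarrow> 'v" where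
  "b s w = a (x s w) + v s w"

definition y :: "real \<Rightarrow> 'a \<Rightarrow> 'v" where
  "y s w = x0 + (\<integral>r. b r w \<partial>lb s)"

lemma b_sq: "0 \<le> t \<Longrightarrow> sq_int (MT t) (proc b)"
  unfolding b_def by (intro sq_int_add sq_int_linear[OF a] finite_energy v_sq)

lemma \<sigma>_sq: "0 \<le> t \<Longrightarrow> i \<in> I \<Longrightarrow> sq_int (MT t) (proc (\<sigma> i))"
  by (intro sq_int_add sq_int_linear[OF g] finite_energy sq_int_const finite_pair)

lemma b_F: "0 \<le> s \<Longrightarrow> b s \<in> borel_measurable (F s)"
proof -
  assume s: "0 \<le> s"
  have am: "a \<in> borel_measurable borel"
    by (intro borel_measurable_continuous_onI linear_continuous_on a)
  have "v s \<in> borel_measurable (F s)" using v_adapted s by (simp add: measurable_adapted_def)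
  then show ?thesis
    unfolding b_def using measurable_compose[OF x_F[OF s] am] by (rule borel_measurable_add[rotated])
qed

lemma y_proc: "0 \<le> t \<Longrightarrow> (proc y) \<in> borel_measurable (MT t)"
  unfolding y_def
  by (intro borel_measurable_add borel_measurable_const running_integral_measurable sq_int_measurable b_sq)

lemma y_bound:
  assumes b: "sq_int (lb t) (\<lambda>s. b s w)" and s: "0 \<le> s" "s \<le> t"
  shows "(norm (y s w))\<^sup>2 \<le> 2 * (norm x0)\<^sup>2 + 2 * t * sq_norm (lb t) (\<lambda>s. b s w)"
proof -
  have "(norm (\<integral>r. b r w \<partial>lb s))\<^sup>2 \<le> s * sq_norm (lb s) (\<lambda>s. b s w)"
    by (intro norm_integral_lb_sq sq_int_lb_mono(1)[OF b] s)
  also have "\<dots> \<le> t * sq_norm (lb t) (\<lambda>s. b s w)"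
    using s by (intro mult_mono sq_int_lb_mono(2)[OF b]) auto
  finally show ?thesis
    unfolding y_def using norm_add_sq_le[of x0 "\<integral>r. b r w \<partial>lb s"] by simp
qed

lemma y_sq: assumes t: "0 \<le> t" shows "sq_int (MT t) (proc y)"
proof (rule sq_intI_nn)
  interpret L: finite_measure "lb t" by simp
  show m: "proc y \<in> borel_measurable (MT t)" by (rule y_proc[OF t])
  define B where "B w = 2 * (norm x0)\<^sup>2 + 2 * t * sq_norm (lb t) (\<lambda>s. b s w)" for w
  have B: "integrable M B" "\<And>w. 0 \<le> B w"
    using sq_norm_product(2)[OF b_sq[OF t]] t by (auto simp: B_def[abs_def] integrable_const)
  have "(\<integral>\<^sup>+z. ennreal ((norm (proc y z))\<^sup>2) \<partial>MT t) =
      (\<integral>\<^sup>+w. (\<integral>\<^sup>+s. ennreal ((norm (y s w))\<^sup>2) \<partial>lb t) \<partial>M)"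
    using m by (subst L.nn_integral_fst[symmetric]) auto
  also have "\<dots> \<le> (\<integral>\<^sup>+w. (\<integral>\<^sup>+s. ennreal (B w) \<partial>lb t) \<partial>M)"
  proof (rule nn_integral_mono_AE, use sq_norm_product(3)[OF b_sq[OF t]] in eventually_elim)
    fix w assume "sq_int (lb t) (\<lambda>s. b s w)"
    then show "(\<integral>\<^sup>+s. ennreal ((norm (y s w))\<^sup>2) \<partial>lb t) \<le> (\<integral>\<^sup>+s. ennreal (B w) \<partial>lb t)"
      unfolding B_def by (intro nn_integral_mono ennreal_leI y_bound) (auto simp: space_restrict_space)
  qed
  also have "\<dots> = (\<integral>\<^sup>+w. ennreal (B w) \<partial>M) * emeasure (lb t) (space (lb t))"
    using B by (simp add: nn_integral_multc)
  also have "\<dots> < \<infinity>"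
    using B by (simp add: nn_integral_eq_integral ennreal_mult_eq_top_iff less_top[symmetric])
  finally show "(\<integral>\<^sup>+z. ennreal ((norm (proc y z))\<^sup>2) \<partial>MT t) < \<infinity>" .
qed

lemma drift_sq: assumes t: "0 \<le> t" shows "sq_int M (\<lambda>w. \<integral>r. b r w \<partial>lb t)"
proof (rule sq_int_bound[where g="\<lambda>w. t * sq_norm (lb t) (\<lambda>s. b s w)"])
  interpret L: sigma_finite_measure "lb t" by simp
  have "(\<lambda>(w, s). b s w) \<in> borel_measurable (MT t)"
    using sq_int_measurable[OF b_sq[OF t]] by (simp add: split_beta')
  then show "(\<lambda>w. \<integral>r. b r w \<partial>lb t) \<in> borel_measurable M"
    by (rule L.borel_measurable_lebesgue_integral)
  show "integrable M (\<lambda>w. t * sq_norm (lb t) (\<lambda>s. b s w))"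
    using sq_norm_product(2)[OF b_sq[OF t]] by simp
  show "AE w in M. (norm (\<integral>r. b r w \<partial>lb t))\<^sup>2 \<le> t * sq_norm (lb t) (\<lambda>s. b s w)"
    using sq_norm_product(3)[OF b_sq[OF t]] by eventually_elim (intro norm_integral_lb_sq t)
qed

lemma y_sq_M: "0 \<le> t \<Longrightarrow> sq_int M (y t)"
  unfolding y_def[abs_def] by (intro sq_int_add drift_sq sq_int_const finite_measure_axioms)

text \<open>The integrals are chosen separately for each t. They depend on t in no controlled way,
  and the equation holds outside a null set that may vary with t.\<close>

lemma martingale_part:
  obtains J where "\<And>t i. 0 \<le> t \<Longrightarrow> i \<in> I \<Longrightarrow> ito_sq i t (\<sigma> i) (J t i)"
    "\<And>t. 0 \<le> t \<Longrightarrow> AE w in M. x t w = y t w + (\<Sum>i\<in>I. J t i w)"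
proof -
  have "\<exists>J. 0 \<le> t \<longrightarrow> (\<forall>i\<in>I. ito_sq i t (\<sigma> i) (J i)) \<and>
      (AE w in M. x t w = y t w + (\<Sum>i\<in>I. J i w))" for t
  proof (cases "0 \<le> t")
    case t: True
    obtain J where J: "\<And>i. i \<in> I \<Longrightarrow> has_ito_integral M F (W i) t (\<sigma> i) (J i)"
      "AE w in M. x t w = x0 + (\<integral>s. a (x s w) + v s w \<partial>lb t) + (\<Sum>i\<in>I. J i w)"
      using integral_equation[OF t] by blast
    have "ito_sq i t (\<sigma> i) (J i)" if i: "i \<in> I" for i
      by (rule has_ito_integral_ito_sq[OF J(1)[OF i] i t \<sigma>_sq[OF t i]])
    with J(2) show ?thesis by (auto simp: y_def b_def)
  qed auto
  then have "\<exists>J. \<forall>t. 0 \<le> t \<longrightarrow> (\<forall>i\<in>I. ito_sq i t (\<sigma> i) (J t i)) \<and>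
      (AE w in M. x t w = y t w + (\<Sum>i\<in>I. J t i w))"
    by (intro choice allI)
  then show ?thesis using that by blast
qed

text \<open>Partition times are nonnegative, so at time 0 all increments of the approximating
  integrals are cut to nothing.\<close>

lemma ito_sq_0:
  assumes "ito_sq i 0 H J"
  shows "sq_norm M J = 0"
proof -
  obtain N p X where "sq_approx i 0 H J N p X" using assms ito_sq_def by blast
  note X = sq_approxD[OF this]
  have "simple_integral (W i) (N n) (p n) (X n) 0 w = 0" for n w
    using simple_integrand_nonneg[OF X(1)] by (simp add: simple_integral_def min_absorb1)
  then show ?thesis using X(3) by (simp add: sq_norm_def LIMSEQ_const_iff)
qed

lemma energy_identity:
  assumes t: "0 \<le> t" and S: "bounded_linear S" and sym: "\<And>u w. u \<bullet> S w = w \<bullet> S u"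
  shows "sq_int M (x t)"
    and "expectation (\<lambda>w. x t w \<bullet> S (x t w)) = x0 \<bullet> S x0 +
      (\<integral>z. (2 * (proc b z \<bullet> S (proc x z))
         + (\<Sum>i\<in>I. proc (\<sigma> i) z \<bullet> S (proc (\<sigma> i) z))) \<partial>MT t)"
proof -
  interpret P: pair_sigma_finite M "lb t" by (rule pair_sigma)
  interpret S: bounded_linear S by fact
  obtain J where J: "\<And>t i. 0 \<le> t \<Longrightarrow> i \<in> I \<Longrightarrow> ito_sq i t (\<sigma> i) (J t i)"
    and xJ: "\<And>t. 0 \<le> t \<Longrightarrow> AE w in M. x t w = y t w + (\<Sum>i\<in>I. J t i w)"
    using martingale_part by blast
  \<comment> \<open>Defined by subtraction to obtain joint measurability; at each time it equals the
    sum of the Ito integrals almost surely, and only this is used about them.\<close>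
  define m where "m s w = x s w - y s w" for s w
  have xm: "x s w = y s w + m s w" for s w by (simp add: m_def)
  have SJ: "ito_sq i s (\<lambda>r w. S (g i (x r w) + h i)) (\<lambda>w. S (J s i w))" if "0 \<le> s" "i \<in> I" for s i
    by (rule ito_sq_linear[OF J[OF that] S that(2,1)])
  have J_sq: "sq_int M (J s i)" if "0 \<le> s" "i \<in> I" for s i using ito_sq_sq_int(2)[OF J[OF that]] .
  have m_sq: "sq_int M (m s)" if s: "0 \<le> s" for s
  proof (rule sq_int_bound[where g="\<lambda>w. (norm (\<Sum>i\<in>I. J s i w))\<^sup>2"])
    show "AE w in M. (norm (m s w))\<^sup>2 \<le> (norm (\<Sum>i\<in>I. J s i w))\<^sup>2"
      using xJ[OF s] by eventually_elim (simp add: m_def)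
    show "m s \<in> borel_measurable M"
      unfolding m_def[abs_def] using x_M[OF s] sq_int_measurable[OF y_sq_M[OF s]] by simp
  qed (intro sq_int_integrable sq_int_sum J_sq s)
  note S_sq = sq_int_linear[OF S] and yt = y_sq_M[OF t] and mt = m_sq[OF t]
  show "sq_int M (x t)" using sq_int_add[OF yt mt] by (simp add: m_def)
  have inner_m: "expectation (\<lambda>w. Z w \<bullet> S (m s w)) = (\<Sum>i\<in>I. expectation (\<lambda>w. Z w \<bullet> S (J s i w)))"
    if Z: "sq_int M Z" and s: "0 \<le> s" for Z s
  proof -
    note i = sq_int_inner[OF Z S_sq[OF J_sq[OF s]]]
    have "expectation (\<lambda>w. Z w \<bullet> S (m s w)) = expectation (\<lambda>w. \<Sum>i\<in>I. Z w \<bullet> S (J s i w))"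
    proof (rule integral_cong_AE)
      show "AE w in M. Z w \<bullet> S (m s w) = (\<Sum>i\<in>I. Z w \<bullet> S (J s i w))"
        using xJ[OF s] by eventually_elim (simp add: m_def S.sum inner_sum_right)
    qed (use sq_int_inner[OF Z S_sq[OF m_sq[OF s]]] i in auto)
    then show ?thesis using Bochner_Integration.integral_sum[OF i] by simp
  qed
  \<comment> \<open>The martingale property of m under S: tested against what is known at time s,
    the value at t may be replaced by the value at s.\<close>
  have orth: "expectation (\<lambda>w. Z w \<bullet> S (m t w)) = expectation (\<lambda>w. Z w \<bullet> S (m s w))"
    if Z: "Z \<in> borel_measurable (F s)" "sq_int M Z" and s: "0 \<le> s" "s \<le> t" for Z s
    unfolding inner_m[OF Z(2) t] inner_m[OF Z(2) s(1)]
    by (intro sum.cong refl ito_martingale[OF SJ SJ _ s Z] t s)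
  have c: "sq_int M (\<lambda>w. x0)" by (intro sq_int_const finite_measure_axioms)
  have x0_m: "expectation (\<lambda>w. x0 \<bullet> S (m t w)) = 0"
  proof -
    have "expectation (\<lambda>w. x0 \<bullet> S (m t w)) = expectation (\<lambda>w. x0 \<bullet> S (m 0 w))"
      by (rule orth) (use t c in auto)
    also have "\<dots> = 0"
      unfolding inner_m[OF c order_refl]
    proof (rule sum.neutral, rule ballI)
      fix i assume i: "i \<in> I"
      have "\<bar>expectation (\<lambda>w. x0 \<bullet> S (J 0 i w))\<bar> \<le> sqrt (sq_norm M (\<lambda>w. x0)) * sqrt (sq_norm M (\<lambda>w. S (J 0 i w)))"
        by (intro inner_integral_Cauchy_Schwarz c S_sq J_sq i order_refl)
      then show "expectation (\<lambda>w. x0 \<bullet> S (J 0 i w)) = 0"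
        using ito_sq_0[OF SJ[OF order_refl i]] by simp
    qed
    finally show ?thesis .
  qed
  have xs: "sq_int (MT t) (proc x)" by (rule finite_energy[OF t])
  note ys = y_sq[OF t] and bs = b_sq[OF t]
  have ms: "sq_int (MT t) (proc m)" unfolding m_def by (intro sq_int_diff xs ys)
  note ib_y = sq_int_inner[OF bs S_sq[OF ys]] and ib_m = sq_int_inner[OF bs S_sq[OF ms]]
  have drift_m: "expectation (\<lambda>w. (\<integral>s. b s w \<partial>lb t) \<bullet> S (m t w)) = (\<integral>z. proc b z \<bullet> S (proc m z) \<partial>MT t)"
  proof -
    have i1: "integrable (MT t) (\<lambda>z. proc b z \<bullet> S (m t (fst z)))"
      by (intro sq_int_inner bs sq_int_fst[OF S_sq[OF mt]] finite_measure_lb)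
    have "expectation (\<lambda>w. (\<integral>s. b s w \<partial>lb t) \<bullet> S (m t w)) = expectation (\<lambda>w. \<integral>s. b s w \<bullet> S (m t w) \<partial>lb t)"
    proof (rule integral_cong_AE)
      show "AE w in M. (\<integral>s. b s w \<partial>lb t) \<bullet> S (m t w) = (\<integral>s. b s w \<bullet> S (m t w) \<partial>lb t)"
        using sq_norm_product(3)[OF bs]
        by eventually_elim (simp add: sq_int_imp_integrable[OF finite_measure_lb])
    qed (use sq_int_inner[OF drift_sq[OF t] S_sq[OF mt]] P.integrable_fst'[OF i1] in auto)
    also have "\<dots> = (\<integral>z. proc b z \<bullet> S (m t (fst z)) \<partial>MT t)"
      using P.integral_fst'[OF i1] by simp
    also have "\<dots> = (\<integral>s. expectation (\<lambda>w. b s w \<bullet> S (m t w)) \<partial>lb t)"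
      using P.integral_snd[of "\<lambda>w s. b s w \<bullet> S (m t w)"] i1 by (simp add: split_beta')
    \<comment> \<open>Since b_s is known at time s, m_t may be replaced by m_s. \<open>orth\<close>
      needs b_s square integrable, which Fubini grants for almost every s only.\<close>
    also have "\<dots> = (\<integral>s. expectation (\<lambda>w. b s w \<bullet> S (m s w)) \<partial>lb t)"
    proof (rule integral_cong_AE)
      have "AE s in lb t. integrable M (\<lambda>w. (norm (b s w))\<^sup>2)"
        using P.AE_integrable_snd[of "\<lambda>w s. (norm (b s w))\<^sup>2"] sq_int_integrable[OF bs] by (simp add: split_beta')
      then show "AE s in lb t. expectation (\<lambda>w. b s w \<bullet> S (m t w)) = expectation (\<lambda>w. b s w \<bullet> S (m s w))"
        using AE_space
      proof eventually_elim
        case (elim s)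
        then have s: "0 \<le> s" "s \<le> t" by (auto simp: space_restrict_space)
        then show ?case
          using elim measurable_F_M[OF s(1) b_F[OF s(1)]] by (intro orth b_F) (simp_all add: sq_int_def)
      qed
    qed (use P.integrable_snd[of "\<lambda>w s. b s w \<bullet> S (m t w)"] P.integrable_snd[of "\<lambda>w s. b s w \<bullet> S (m s w)"] i1 ib_m
        in \<open>simp_all add: split_beta' borel_measurable_integrable\<close>)
    also have "\<dots> = (\<integral>z. proc b z \<bullet> S (proc m z) \<partial>MT t)"
      using P.integral_snd[of "\<lambda>w s. b s w \<bullet> S (m s w)"] ib_m by (simp add: split_beta')
    finally show ?thesis .
  qed
  have yy: "expectation (\<lambda>w. y t w \<bullet> S (y t w)) = x0 \<bullet> S x0 +
      2 * (\<integral>z. proc b z \<bullet> S (proc y z) \<partial>MT t)"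
  proof -
    have "expectation (\<lambda>w. y t w \<bullet> S (y t w)) = expectation (\<lambda>w. x0 \<bullet> S x0 + 2 * (\<integral>s. b s w \<bullet> S (y s w) \<partial>lb t))"
    proof (rule integral_cong_AE)
      show "AE w in M. y t w \<bullet> S (y t w) = x0 \<bullet> S x0 + 2 * (\<integral>s. b s w \<bullet> S (y s w) \<partial>lb t)"
        using sq_norm_product(3)[OF bs] AE_space P.AE_integrable_fst'[OF ib_y]
      proof eventually_elim
        fix w assume bw: "sq_int (lb t) (\<lambda>s. b s w)"
          and iw: "integrable (lb t) (\<lambda>s. b (snd (w, s)) (fst (w, s)) \<bullet> S (y (snd (w, s)) (fst (w, s))))"
        define p where "p s = (\<integral>r. b r w \<partial>lb s)" for s
        have bi: "integrable (lb t) (\<lambda>s. b s w)" by (rule sq_int_imp_integrable[OF finite_measure_lb bw])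
        \<comment> \<open>Pathwise product rule for the part of y that starts at 0; the terms with
          x0 are linear and are treated separately.\<close>
        have q: "p t \<bullet> S (p t) = 2 * (\<integral>s. b s w \<bullet> S (p s) \<partial>lb t)"
          unfolding p_def by (rule running_integral_quadratic[OF bw S sym])
        have yp: "y s w = x0 + p s" for s by (simp add: y_def p_def)
        have i0: "integrable (lb t) (\<lambda>s. b s w \<bullet> S x0)" using bi by simp
        have ip: "integrable (lb t) (\<lambda>s. b s w \<bullet> S (p s))"
        proof -
          have "integrable (lb t) (\<lambda>s. b s w \<bullet> S (y s w) - b s w \<bullet> S x0)"
            using iw i0 by (intro Bochner_Integration.integrable_diff) auto
          then show ?thesis by (simp add: yp S.add inner_add_right)
        qed
        have "(\<integral>s. b s w \<bullet> S (y s w) \<partial>lb t) = (\<integral>s. b s w \<bullet> S x0 + b s w \<bullet> S (p s) \<partial>lb t)"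
          by (simp add: yp S.add inner_add_right)
        also have "\<dots> = p t \<bullet> S x0 + (\<integral>s. b s w \<bullet> S (p s) \<partial>lb t)"
          using i0 ip bi by (simp add: p_def)
        finally have "2 * (\<integral>s. b s w \<bullet> S (y s w) \<partial>lb t) = 2 * (p t \<bullet> S x0) + p t \<bullet> S (p t)" using q by simp
        then show "y t w \<bullet> S (y t w) = x0 \<bullet> S x0 + 2 * (\<integral>s. b s w \<bullet> S (y s w) \<partial>lb t)"
          using sym[of x0 "p t"] by (simp add: yp S.add inner_add_left inner_add_right)
      qed
    qed (use sq_int_inner[OF yt S_sq[OF yt]] P.integrable_fst'[OF ib_y] in auto)
    also have "\<dots> = x0 \<bullet> S x0 + 2 * expectation (\<lambda>w. \<integral>s. b s w \<bullet> S (y s w) \<partial>lb t)"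
      using P.integrable_fst'[OF ib_y] by (simp add: prob_space integrable_const)
    also have "expectation (\<lambda>w. \<integral>s. b s w \<bullet> S (y s w) \<partial>lb t) = (\<integral>z. proc b z \<bullet> S (proc y z) \<partial>MT t)"
      using P.integral_fst'[OF ib_y] by simp
    finally show ?thesis .
  qed
  have mm: "expectation (\<lambda>w. m t w \<bullet> S (m t w)) = (\<Sum>i\<in>I. \<integral>z. proc (\<sigma> i) z \<bullet> S (proc (\<sigma> i) z) \<partial>MT t)"
  proof -
    \<comment> \<open>\<open>inner_m\<close> expands the second slot only; symmetry of S brings the
      other factor there, so it is applied twice.\<close>
    have "expectation (\<lambda>w. m t w \<bullet> S (m t w)) = (\<Sum>i\<in>I. \<Sum>j\<in>I. expectation (\<lambda>w. J t i w \<bullet> S (J t j w)))"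
      unfolding inner_m[OF mt t] by (subst sym) (simp add: inner_m[OF J_sq[OF t] t])
    also have "\<dots> = (\<Sum>i\<in>I. \<Sum>j\<in>I. if i = j then \<integral>z. proc (\<sigma> i) z \<bullet> S (proc (\<sigma> j) z) \<partial>MT t else 0)"
      by (intro sum.cong refl ito_isometry[OF J SJ] t)
    also have "\<dots> = (\<Sum>i\<in>I. \<integral>z. proc (\<sigma> i) z \<bullet> S (proc (\<sigma> i) z) \<partial>MT t)"
      using finI by (intro sum.cong refl) (simp add: sum.delta)
    finally show ?thesis .
  qed
  have xx: "expectation (\<lambda>w. x t w \<bullet> S (x t w)) =
     expectation (\<lambda>w. y t w \<bullet> S (y t w)) + 2 * expectation (\<lambda>w. y t w \<bullet> S (m t w)) + expectation (\<lambda>w. m t w \<bullet> S (m t w))"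
  proof -
    have "x t w \<bullet> S (x t w) = y t w \<bullet> S (y t w) + 2 * (y t w \<bullet> S (m t w)) + m t w \<bullet> S (m t w)" for w
      using sym[of "m t w" "y t w"] by (simp add: xm S.add inner_add_left inner_add_right)
    then show ?thesis
      using sq_int_inner[OF yt S_sq[OF yt]] sq_int_inner[OF yt S_sq[OF mt]] sq_int_inner[OF mt S_sq[OF mt]] by simp
  qed
  have ym: "expectation (\<lambda>w. y t w \<bullet> S (m t w)) = (\<integral>z. proc b z \<bullet> S (proc m z) \<partial>MT t)"
    using Bochner_Integration.integral_add[OF sq_int_inner[OF c S_sq[OF mt]] sq_int_inner[OF drift_sq[OF t] S_sq[OF mt]]]
      x0_m drift_m by (simp add: y_def inner_add_left)
  \<comment> \<open>The pairings of b with y (from \<open>yy\<close>) and with m (from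
    \<open>ym\<close>) recombine into the pairing with x.\<close>
  have bx: "(\<integral>z. proc b z \<bullet> S (proc x z) \<partial>MT t) =
     (\<integral>z. proc b z \<bullet> S (proc y z) \<partial>MT t) + (\<integral>z. proc b z \<bullet> S (proc m z) \<partial>MT t)"
    using Bochner_Integration.integral_add[OF ib_y ib_m] by (simp only: xm S.add inner_add_right)
  have ib: "integrable (MT t) (\<lambda>z. proc b z \<bullet> S (proc x z))" by (intro sq_int_inner bs S_sq xs)
  have ig: "integrable (MT t) (\<lambda>z. proc (\<sigma> i) z \<bullet> S (proc (\<sigma> i) z))" if "i \<in> I" for i
    by (intro sq_int_inner S_sq \<sigma>_sq t that)
  have "(\<integral>z. (2 * (proc b z \<bullet> S (proc x z)) + (\<Sum>i\<in>I. proc (\<sigma> i) z \<bullet> S (proc (\<sigma> i) z))) \<partial>MT t) =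
     (\<integral>z. 2 * (proc b z \<bullet> S (proc x z)) \<partial>MT t) + (\<integral>z. (\<Sum>i\<in>I. proc (\<sigma> i) z \<bullet> S (proc (\<sigma> i) z)) \<partial>MT t)"
    by (intro Bochner_Integration.integral_add integrable_mult_right ib Bochner_Integration.integrable_sum ig)
  also have "(\<integral>z. 2 * (proc b z \<bullet> S (proc x z)) \<partial>MT t) = 2 * (\<integral>z. proc b z \<bullet> S (proc x z) \<partial>MT t)"
    by (rule integral_mult_right_zero)
  also have "(\<integral>z. (\<Sum>i\<in>I. proc (\<sigma> i) z \<bullet> S (proc (\<sigma> i) z)) \<partial>MT t) = expectation (\<lambda>w. m t w \<bullet> S (m t w))"
    unfolding mm by (rule Bochner_Integration.integral_sum[OF ig])
  also note bx
  finally show "expectation (\<lambda>w. x t w \<bullet> S (x t w)) = x0 \<bullet> S x0 +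
      (\<integral>z. (2 * (proc b z \<bullet> S (proc x z)) + (\<Sum>i\<in>I. proc (\<sigma> i) z \<bullet> S (proc (\<sigma> i) z))) \<partial>MT t)"
    unfolding xx yy ym by (simp only: distrib_left add.assoc add.commute add.left_commute)
qed

end

section \<open>Self-adjoint maps\<close>

text \<open>The quadratic form attains its maximum on the compact unit sphere. A maximiser e is an
  eigenvector: \<open>d\<close> is its residual, and if d were nonzero, a small step along -d would
  violate the maximality.\<close>

lemma self_adjoint_max_eigenvalue:
  fixes T :: "'e::euclidean_space \<Rightarrow> 'e"
  assumes T: "linear T" and sym: "\<And>u w. u \<bullet> T w = T u \<bullet> w"
  obtains \<mu> e where "e \<noteq> 0" "T e = \<mu> *\<^sub>R e" "\<And>w. w \<bullet> T w \<le> \<mu> * (w \<bullet> w)"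
proof -
  interpret T: linear T by fact
  have cont: "continuous_on (sphere 0 1) (\<lambda>w. w \<bullet> T w)"
    by (intro continuous_intros linear_continuous_on linear_conv_bounded_linear[THEN iffD1] T)
  have ne: "sphere (0::'e) 1 \<noteq> {}"
    using vector_choose_size[of 1, where 'a='e] by (auto simp: sphere_def)
  from continuous_attains_sup[OF compact_sphere ne cont]
  obtain e where e: "norm e = 1" and sup: "\<And>w. norm w = 1 \<Longrightarrow> w \<bullet> T w \<le> e \<bullet> T e" by auto
  define \<mu> where "\<mu> = e \<bullet> T e"
  have le: "w \<bullet> T w \<le> \<mu> * (w \<bullet> w)" for w
  proof (cases "w = 0")
    case False
    have "(w /\<^sub>R norm w) \<bullet> T (w /\<^sub>R norm w) \<le> \<mu>"
      unfolding \<mu>_def using False by (intro sup) simp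
    then have "(w \<bullet> T w) / (norm w)\<^sup>2 \<le> \<mu>"
      by (simp add: T.scaleR power2_eq_square divide_inverse mult_ac)
    then show ?thesis using False by (simp add: field_simps power2_norm_eq_inner)
  qed simp
  define d where "d = \<mu> *\<^sub>R e - T e"
  define c where "c = \<mu> * (d \<bullet> d) - d \<bullet> T d"
  have c: "0 \<le> c" using le[of d] by (simp add: c_def)
  have ee: "e \<bullet> e = 1" using e by (simp add: norm_eq_sqrt_inner)
  \<comment> \<open>first-order optimality of \<open>e\<close> along the direction \<open>-d\<close>\<close>
  have var: "2 * \<epsilon> * (d \<bullet> d) \<le> \<epsilon>\<^sup>2 * c" for \<epsilon>
  proof -
    have E1: "(e - \<epsilon> *\<^sub>R d) \<bullet> T (e - \<epsilon> *\<^sub>R d) = \<mu> - 2 * \<epsilon> * (d \<bullet> T e) + \<epsilon>\<^sup>2 * (d \<bullet> T d)"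
      using sym[of e d] by (simp add: T.diff T.scaleR inner_diff_left inner_diff_right \<mu>_def
          power2_eq_square algebra_simps inner_commute)
    have E2: "(e - \<epsilon> *\<^sub>R d) \<bullet> (e - \<epsilon> *\<^sub>R d) = 1 - 2 * \<epsilon> * (d \<bullet> e) + \<epsilon>\<^sup>2 * (d \<bullet> d)"
      using ee by (simp add: inner_diff_left inner_diff_right power2_eq_square algebra_simps inner_commute)
    have dd: "d \<bullet> d = \<mu> * (d \<bullet> e) - d \<bullet> T e"
      by (subst (2) d_def) (simp add: inner_diff_right)
    have "\<mu> - 2 * \<epsilon> * (d \<bullet> T e) + \<epsilon>\<^sup>2 * (d \<bullet> T d) \<le> \<mu> * (1 - 2 * \<epsilon> * (d \<bullet> e) + \<epsilon>\<^sup>2 * (d \<bullet> d))"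
      using le[of "e - \<epsilon> *\<^sub>R d"] unfolding E1 E2 .
    moreover have "2 * \<epsilon> * (d \<bullet> d) = 2 * \<epsilon> * (\<mu> * (d \<bullet> e)) - 2 * \<epsilon> * (d \<bullet> T e)"
      unfolding dd by (simp add: right_diff_distrib)
    ultimately show ?thesis by (simp add: c_def algebra_simps)
  qed
  have "d \<bullet> d \<le> 0"
  proof (rule ccontr)
    assume "\<not> d \<bullet> d \<le> 0"
    then have p: "0 < d \<bullet> d" by (simp only: not_le)
    \<comment> \<open>Small enough that the quadratic term stays at most
      \<open>d \<bullet> d\<close>, half of what the linear term demands; c + 1 avoids division by
      0.\<close>
    define \<epsilon> where "\<epsilon> = (d \<bullet> d) / (c + 1)"
    have "0 < \<epsilon>" using p c by (simp add: \<epsilon>_def)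
    have "\<epsilon> * (2 * (d \<bullet> d)) \<le> \<epsilon> * (\<epsilon> * c)" using var[of \<epsilon>] by (simp add: power2_eq_square algebra_simps)
    then have "2 * (d \<bullet> d) \<le> \<epsilon> * c" using \<open>0 < \<epsilon>\<close> by simp
    also have "\<dots> \<le> d \<bullet> d" using p c by (simp add: \<epsilon>_def field_simps)
    finally show False using p by simp
  qed
  then have "d = 0" by (metis inner_eq_zero_iff inner_ge_zero order_antisym)
  then have "T e = \<mu> *\<^sub>R e" by (simp add: d_def)
  moreover have "e \<noteq> 0" using e by auto
  ultimately show ?thesis using le that by blast
qed

text \<open>Eigenvectors of distinct eigenvalues are orthogonal, hence independent, and the
  dimension is finite. Finiteness is what gives \<open>Max\<close> in \<open>lambda_max\<close> its
  meaning.\<close>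

lemma self_adjoint_finite_eigenvalues:
  fixes T :: "'e::euclidean_space \<Rightarrow> 'e"
  assumes sym: "\<And>u w. u \<bullet> T w = T u \<bullet> w"
  shows "finite {r. \<exists>e. e \<noteq> 0 \<and> T e = r *\<^sub>R e}" (is "finite ?E")
proof -
  obtain f where f: "\<And>r. r \<in> ?E \<Longrightarrow> f r \<noteq> 0 \<and> T (f r) = r *\<^sub>R f r"
    using bchoice[of ?E "\<lambda>r e. e \<noteq> 0 \<and> T e = r *\<^sub>R e"] by blast
  have orth: "f r \<bullet> f s = 0" if "r \<in> ?E" "s \<in> ?E" "r \<noteq> s" for r s
    using sym[of "f r" "f s"] f[OF that(1)] f[OF that(2)] that(3) by simp
  have "inj_on f ?E"
  proof (rule inj_onI, rule ccontr)
    fix r s assume a: "r \<in> ?E" "s \<in> ?E" "f r = f s" "r \<noteq> s"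
    then show False using orth[OF a(1,2,4)] f[OF a(1)] by simp
  qed
  moreover have "finite (f ` ?E)"
  proof (rule independent_imp_finite, rule pairwise_orthogonal_independent)
    show "pairwise orthogonal (f ` ?E)"
      using orth by (auto simp: pairwise_def orthogonal_def)
    show "0 \<notin> f ` ?E" using f by force
  qed
  ultimately show ?thesis by (rule finite_imageD[rotated])
qed

text \<open>The inner product of \<open>complex^'n\<close> as a real Euclidean space is the real
  part of the Hermitian product. A Hermitian matrix thus acts as a self-adjoint real-linear map, and
  the real spectral argument applies to it.\<close>

lemma real_inner_complex_vec:
  fixes u w :: "complex^'n"
  shows "u \<bullet> w = Re (\<Sum>i\<in>UNIV. cnj (u $ i) * w $ i)"
  by (simp add: inner_vec_def inner_complex_def)

lemma hermitian_inner:
  fixes H :: "complex^'n^'n"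
  assumes "hermitian H"
  shows "u \<bullet> (H *v w) = (H *v u) \<bullet> w"
proof -
  have H: "cnj (H $ i $ j) = H $ j $ i" for i j
  proof -
    have "transpose (map_matrix cnj H) $ j $ i = H $ j $ i" using assms by (simp add: hermitian_def)
    then show ?thesis by (simp add: transpose_def map_matrix_def)
  qed
  have "(\<Sum>i\<in>UNIV. cnj (u $ i) * (H *v w) $ i) = (\<Sum>i\<in>UNIV. \<Sum>j\<in>UNIV. cnj (u $ i) * (H $ i $ j * w $ j))"
    by (simp add: matrix_vector_mult_def sum_distrib_left)
  also have "\<dots> = (\<Sum>j\<in>UNIV. \<Sum>i\<in>UNIV. cnj (u $ i) * (H $ i $ j * w $ j))" by (rule sum.swap)
  also have "\<dots> = (\<Sum>j\<in>UNIV. cnj ((H *v u) $ j) * w $ j)"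
    by (simp add: matrix_vector_mult_def sum_distrib_right sum_distrib_left H mult_ac)
  finally show ?thesis by (simp add: real_inner_complex_vec)
qed

text \<open>The maximum of the form is attained at an eigenvector and is itself a real eigenvalue,
  so it belongs to the finite set whose \<open>Max\<close> is taken.\<close>

lemma hermitian_le_lambda_max:
  fixes H :: "complex^'n^'n"
  assumes H: "hermitian H"
  shows "w \<bullet> (H *v w) \<le> lambda_max H * (w \<bullet> w)"
proof -
  have lin: "linear ((*v) H)"
    by (rule linearI) (simp_all add: matrix_vector_right_distrib vec_eq_iff matrix_vector_mult_def
        scaleR_sum_right sum.distrib algebra_simps)
  have eq: "complex_of_real r *s v = r *\<^sub>R v" for r and v :: "complex^'n"
    by (simp add: vec_eq_iff complex_eq_iff)
  obtain \<mu> e where e: "e \<noteq> 0" "H *v e = \<mu> *\<^sub>R e" "\<And>w. w \<bullet> (H *v w) \<le> \<mu> * (w \<bullet> w)"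
    using self_adjoint_max_eigenvalue[OF lin hermitian_inner[OF H]] by blast
  have "finite {r. \<exists>v. v \<noteq> 0 \<and> H *v v = complex_of_real r *s v}"
    unfolding eq by (rule self_adjoint_finite_eigenvalues[OF hermitian_inner[OF H]])
  then have "\<mu> \<le> lambda_max H"
    unfolding lambda_max_def using e by (intro Max_ge) (auto simp: eq)
  then have "\<mu> * (w \<bullet> w) \<le> lambda_max H * (w \<bullet> w)" by (intro mult_right_mono) auto
  then show ?thesis using e(3)[of w] by simp
qed

section \<open>Real parts of complex matrices\<close>

text \<open>At real vectors the real part of the form sees only this matrix
  (\<open>cvec_form\<close>). Taking real parts commutes with multiplication by real matrices, so
  the congruences by B, C and D pass through.\<close>

abbreviation re_mat :: "complex^'n^'m \<Rightarrow> real^'n^'m" where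
  "re_mat H \<equiv> map_matrix Re H"

lemma re_mat_simps:
  "re_mat (G + H) = re_mat G + re_mat H" "re_mat (G - H) = re_mat G - re_mat H"
  "re_mat (r *\<^sub>R H) = r *\<^sub>R re_mat H"
  by (simp_all add: map_matrix_def vec_eq_iff)

lemma re_mat_sum: "re_mat (\<Sum>i\<in>A. f i) = (\<Sum>i\<in>A. re_mat (f i))"
  by (induction A rule: infinite_finite_induct) (simp_all add: re_mat_simps, simp_all add: map_matrix_def vec_eq_iff)

lemma re_mat_mult_left: "re_mat (cmat A ** H) = A ** re_mat H"
  by (simp add: map_matrix_def matrix_matrix_mult_def vec_eq_iff)

lemma re_mat_mult_right: "re_mat (H ** cmat A) = re_mat H ** A"
  by (simp add: map_matrix_def matrix_matrix_mult_def vec_eq_iff)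

lemma transpose_cmat: "transpose (cmat A) = cmat (transpose A)"
  by (simp add: map_matrix_def transpose_def vec_eq_iff)

lemma re_mat_congruence: "re_mat (transpose (cmat A) ** H ** cmat A) = transpose A ** re_mat H ** A"
  by (simp add: transpose_cmat re_mat_mult_left re_mat_mult_right)

definition cvec :: "real^'n \<Rightarrow> complex^'n" where
  "cvec v = (\<chi> i. complex_of_real (v $ i))"

lemma cvec_form: "cvec v \<bullet> (H *v cvec w) = v \<bullet> (re_mat H *v w)"
  by (simp add: real_inner_complex_vec cvec_def matrix_vector_mult_def inner_vec_def map_matrix_def)

lemma cvec_inner: "cvec v \<bullet> cvec w = v \<bullet> w"
  by (simp add: inner_vec_def cvec_def inner_complex_def)

lemma nonneg_definite_re_mat: "nonneg_definite H \<Longrightarrow> 0 \<le> v \<bullet> (re_mat H *v v)"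
  unfolding nonneg_definite_def cvec_form[symmetric] real_inner_complex_vec by blast

lemma re_mat_symmetric:
  assumes "hermitian H"
  shows "v \<bullet> (re_mat H *v w) = w \<bullet> (re_mat H *v v)"
  unfolding cvec_form[symmetric] using hermitian_inner[OF assms, of "cvec v" "cvec w"] by (simp add: inner_commute)

lemma map_matrix_cnj_mult: "map_matrix cnj (X ** Y) = map_matrix cnj X ** map_matrix cnj Y"
  by (simp add: map_matrix_def matrix_matrix_mult_def vec_eq_iff)

lemma hermitian_congruence:
  assumes "hermitian R"
  shows "hermitian (transpose (cmat B) ** R ** cmat B)"
proof -
  have cnj_B: "map_matrix cnj (cmat B) = cmat B"
    by (simp add: map_matrix_def vec_eq_iff)
  have cnj_tB: "map_matrix cnj (transpose (cmat B)) = transpose (cmat B)"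
    by (simp add: map_matrix_def transpose_def vec_eq_iff)
  have "map_matrix cnj (transpose (cmat B) ** R ** cmat B) = transpose (cmat B) ** map_matrix cnj R ** cmat B"
    unfolding map_matrix_cnj_mult cnj_B cnj_tB ..
  then show ?thesis
    using assms by (simp add: hermitian_def matrix_transpose_mul matrix_mul_assoc)
qed

lemma inner_transpose: "v \<bullet> (transpose A *v z) = (A *v v) \<bullet> z"
  for A :: "real^'m^'n"
  by (metis dot_lmul_matrix vector_transpose_matrix)

lemma congruence_form: "v \<bullet> ((transpose A ** S ** A) *v w) = (A *v v) \<bullet> (S *v (A *v w))"
  for A :: "real^'m^'n"
  unfolding matrix_vector_mul_assoc[symmetric] by (rule inner_transpose)

text \<open>Written as a sum over columns, the trace is the rate at which the additive noise
  components feed energy into the system.\<close>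

lemma trace_congruence:
  fixes D :: "real^'l^'n"
  shows "Re (trace (transpose (cmat D) ** H ** cmat D)) = (\<Sum>j\<in>UNIV. column j D \<bullet> (re_mat H *v column j D))"
proof -
  have "Re (trace (transpose (cmat D) ** H ** cmat D)) = trace (transpose D ** re_mat H ** D)"
    unfolding re_mat_congruence[symmetric] by (simp add: trace_def map_matrix_def)
  also have "\<dots> = (\<Sum>j\<in>UNIV. column j D \<bullet> (re_mat H *v column j D))"
    unfolding trace_def
  proof (rule sum.cong[OF refl])
    fix j
    have "(transpose D ** re_mat H ** D) $ j $ j = axis j 1 \<bullet> ((transpose D ** re_mat H ** D) *v axis j 1)"
      by (simp add: inner_axis' matrix_vector_mul_component inner_axis)
    also have "\<dots> = (D *v axis j 1) \<bullet> (re_mat H *v (D *v axis j 1))" by (rule congruence_form)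
    finally show "(transpose D ** re_mat H ** D) $ j $ j = column j D \<bullet> (re_mat H *v column j D)"
      by (simp add: matrix_vector_mult_basis)
  qed
  finally show ?thesis .
qed

section \<open>Divergence of the second moment\<close>

context linear_sde
begin

lemma energy_lower_bound:
  assumes t: "0 \<le> t" and S: "bounded_linear S" and sym: "\<And>u w. u \<bullet> S w = w \<bullet> S u"
    and psd: "\<And>w. 0 \<le> w \<bullet> S w" and \<phi>: "0 < \<phi>"
    and dissipation: "\<And>w. \<phi> * (w \<bullet> S w) + \<kappa> \<le> 2 * (a w \<bullet> S w) + (\<Sum>i\<in>I. (g i w + h i) \<bullet> S (g i w + h i))"
  shows "\<kappa> * t - (\<integral>z. proc v z \<bullet> S (proc v z) \<partial>MT t) / \<phi> \<le>
    expectation (\<lambda>w. x t w \<bullet> S (x t w))"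
proof -
  interpret S: bounded_linear S by fact
  interpret P: finite_measure "MT t" by (rule finite_pair)
  let ?N = "MT t"
  have mass: "measure ?N (space ?N) = t"
  proof -
    interpret L: sigma_finite_measure "lb t" by simp
    have "emeasure ?N (space ?N) = emeasure M (space M) * emeasure (lb t) (space (lb t))"
      unfolding space_pair_measure by (rule L.emeasure_pair_measure_Times[OF sets.top sets.top])
    also have "\<dots> = ennreal t" using t by (simp add: emeasure_space_1 emeasure_restrict_space)
    finally show ?thesis using t by (simp add: measure_def)
  qed
  have vv: "integrable ?N (\<lambda>z. proc v z \<bullet> S (proc v z))"
    by (intro sq_int_inner sq_int_linear[OF S] v_sq t)
  have bb: "integrable ?N (\<lambda>z. proc b z \<bullet> S (proc x z))"
    by (intro sq_int_inner sq_int_linear[OF S] b_sq finite_energy t)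
  have gg: "integrable ?N (\<lambda>z. \<Sum>i\<in>I. proc (\<sigma> i) z \<bullet> S (proc (\<sigma> i) z))"
    by (intro Bochner_Integration.integrable_sum sq_int_inner sq_int_linear[OF S] \<sigma>_sq t)
  \<comment> \<open>Nonnegativity of the form at \<open>\<phi> *\<^sub>R y + w\<close>, divided by
    \<open>\<phi>\<close>. With this weight the term in y cancels exactly against the one supplied
    by \<open>dissipation\<close>.\<close>
  have ptw: "\<kappa> - (w \<bullet> S w) / \<phi> \<le> 2 * ((a y + w) \<bullet> S y) + (\<Sum>i\<in>I. (g i y + h i) \<bullet> S (g i y + h i))" for y w
  proof -
    have "0 \<le> (\<phi> *\<^sub>R y + w) \<bullet> S (\<phi> *\<^sub>R y + w)" by (rule psd)
    also have "\<dots> = \<phi> * (\<phi> * (y \<bullet> S y) + 2 * (w \<bullet> S y) + (w \<bullet> S w) / \<phi>)"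
      using \<phi> sym[of y w] by (simp add: S.add S.scaleR inner_add_left inner_add_right algebra_simps)
    finally have "0 \<le> \<phi> * (y \<bullet> S y) + 2 * (w \<bullet> S y) + (w \<bullet> S w) / \<phi>"
      using \<phi> by (simp add: zero_le_mult_iff)
    then show ?thesis using dissipation[of y] by (simp add: inner_add_left)
  qed
  have "\<kappa> * t - (\<integral>z. proc v z \<bullet> S (proc v z) \<partial>?N) / \<phi> =
      (\<integral>z. \<kappa> - (proc v z \<bullet> S (proc v z)) / \<phi> \<partial>?N)"
    using vv mass by simp
  also have "\<dots> \<le> (\<integral>z. (2 * (proc b z \<bullet> S (proc x z))
         + (\<Sum>i\<in>I. proc (\<sigma> i) z \<bullet> S (proc (\<sigma> i) z))) \<partial>?N)"
    unfolding b_def[symmetric]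
    by (intro integral_mono Bochner_Integration.integrable_diff Bochner_Integration.integrable_add
        integrable_mult_right bb gg integrable_divide vv P.integrable_const)
      (simp add: b_def ptw)
  also have "\<dots> \<le> expectation (\<lambda>w. x t w \<bullet> S (x t w))"
    using energy_identity(2)[OF t S sym] psd[of x0] by simp
  finally show ?thesis .
qed

text \<open>The weighted energy grows at least like \<open>\<delta> * t\<close>, and boundedness of
  S turns it into a lower bound for the unweighted second moment. No definiteness of S is asked for:
  directions that S annihilates can only add to the norm.\<close>

lemma second_moment_diverges:
  assumes S: "bounded_linear S" and sym: "\<And>u w. u \<bullet> S w = w \<bullet> S u"
    and psd: "\<And>w. 0 \<le> w \<bullet> S w" and \<phi>: "0 < \<phi>" and \<delta>: "0 < \<delta>"
    and dissipation: "\<And>w. \<phi> * (w \<bullet> S w) + \<kappa> \<le> 2 * (a w \<bullet> S w) + (\<Sum>i\<in>I. (g i w + h i) \<bullet> S (g i w + h i))"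
    and control: "\<And>t. 0 < t \<Longrightarrow>
      (\<integral>z. proc v z \<bullet> S (proc v z) \<partial>MT t) / \<phi> \<le> (\<kappa> - \<delta>) * t"
  shows "((\<lambda>t. \<integral>\<^sup>+w. ennreal ((norm (x t w))\<^sup>2) \<partial>M) \<longlongrightarrow> \<infinity>) at_top"
proof -
  obtain K where K: "0 < K" "\<And>w. norm (S w) \<le> norm w * K"
    using bounded_linear.pos_bounded[OF S] by blast
  have lower: "ennreal (\<delta> / K * t) \<le> (\<integral>\<^sup>+w. ennreal ((norm (x t w))\<^sup>2) \<partial>M)" if t: "0 < t" for t
  proof -
    have t0: "0 \<le> t" using t by simp
    note xt = energy_identity(1)[OF t0 S sym]
    have "\<delta> * t \<le> expectation (\<lambda>w. x t w \<bullet> S (x t w))"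
      using energy_lower_bound[OF t0 S sym psd \<phi> dissipation] control[OF t] by (simp add: algebra_simps)
    also have "\<dots> \<le> expectation (\<lambda>w. K * (norm (x t w))\<^sup>2)"
    proof (intro integral_mono sq_int_inner sq_int_linear[OF S] xt integrable_mult_right sq_int_integrable)
      fix w
      have "x t w \<bullet> S (x t w) \<le> norm (x t w) * norm (S (x t w))" by (rule norm_cauchy_schwarz)
      also have "\<dots> \<le> norm (x t w) * (norm (x t w) * K)" by (intro mult_left_mono K) auto
      finally show "x t w \<bullet> S (x t w) \<le> K * (norm (x t w))\<^sup>2" by (simp add: power2_eq_square mult_ac)
    qed
    also have "\<dots> = K * sq_norm M (x t)" by (simp add: sq_norm_def)
    finally have "\<delta> / K * t \<le> sq_norm M (x t)" using K by (simp add: field_simps)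
    then show ?thesis using nn_integral_sq_norm[OF xt] by (simp add: ennreal_leI)
  qed
  have "filterlim (\<lambda>t. \<delta> / K * t) at_top at_top"
    using \<delta> K by (intro filterlim_tendsto_pos_mult_at_top[OF tendsto_const] filterlim_ident) auto
  then have lim: "((\<lambda>t. ennreal (\<delta> / K * t)) \<longlongrightarrow> \<infinity>) at_top"
    by (simp add: ennreal_tendsto_top_eq_at_top)
  show ?thesis
  proof (rule tendsto_sandwich[OF _ _ lim tendsto_const])
    show "eventually (\<lambda>t. ennreal (\<delta> / K * t) \<le> (\<integral>\<^sup>+w. ennreal ((norm (x t w))\<^sup>2) \<partial>M)) at_top"
      using eventually_gt_at_top[of 0] by eventually_elim (rule lower)
  qed auto
qed

end

section \<open>From matrices and controls to the abstract linear system\<close>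

lemma sum_matrix_vector_mult: "(\<Sum>i\<in>I. X i) *v w = (\<Sum>i\<in>I. X i *v w)" for X :: "'i \<Rightarrow> real^'n^'m"
  by (induction I rule: infinite_finite_induct) (simp_all add: matrix_vector_mult_add_rdistrib)

lemma measurable_adapted_linear:
  fixes T :: "'u::euclidean_space \<Rightarrow> 'v::euclidean_space"
  assumes u: "measurable_adapted M F u" and T: "bounded_linear T"
  shows "measurable_adapted M F (\<lambda>s w. T (u s w))"
proof -
  have Tm: "T \<in> borel_measurable borel"
    by (intro borel_measurable_continuous_onI linear_continuous_on T)
  have "(\<lambda>z. T (case z of (s, w) \<Rightarrow> u s w)) \<in> borel_measurable (restrict_space borel {0..} \<Otimes>\<^sub>M M)"
    using u by (intro measurable_compose[OF _ Tm]) (simp add: measurable_adapted_def)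
  moreover have "(\<lambda>w. T (u t w)) \<in> borel_measurable (F t)" if "0 \<le> t" for t
    using u that by (intro measurable_compose[OF _ Tm]) (simp add: measurable_adapted_def)
  ultimately show ?thesis by (simp add: measurable_adapted_def split_beta')
qed

lemma (in wiener) control_energy:
  fixes u :: "real \<Rightarrow> 'a \<Rightarrow> 'u::euclidean_space"
  assumes u: "measurable_adapted M F u" and c: "0 \<le> c" and t: "0 < t"
    and bound: "ennreal (1 / t) * (\<integral>\<^sup>+\<tau>\<in>{0..t}. (\<integral>\<^sup>+w. ennreal ((norm (u \<tau> w))\<^sup>2) \<partial>M) \<partial>lborel) \<le> ennreal c"
  shows "s \<le> t \<Longrightarrow> sq_int (MT s) (proc u)"
    and "sq_norm (MT t) (proc u) \<le> c * t"
proof -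
  define X where "X r = (\<integral>\<^sup>+\<tau>\<in>{0..r}. (\<integral>\<^sup>+w. ennreal ((norm (u \<tau> w))\<^sup>2) \<partial>M) \<partial>lborel)" for r
  note m = borel_measurable_proc[OF u]
  have X: "X r = (\<integral>\<^sup>+z. ennreal ((norm (proc u z))\<^sup>2) \<partial>MT r)" for r
  proof -
    interpret P: pair_sigma_finite M "lb r" by (rule pair_sigma)
    have "X r = (\<integral>\<^sup>+\<tau>. (\<integral>\<^sup>+w. ennreal ((norm (u \<tau> w))\<^sup>2) \<partial>M) \<partial>lb r)"
      by (simp add: X_def nn_integral_restrict_space)
    then show ?thesis
      using P.nn_integral_snd[of "\<lambda>z. ennreal ((norm (proc u z))\<^sup>2)"] m[of r] by simp
  qed
  have "X t = ennreal t * (ennreal (1 / t) * X t)"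
    using t by (simp add: mult.assoc[symmetric] flip: ennreal_mult)
  also have "\<dots> \<le> ennreal t * ennreal c" using bound by (intro mult_left_mono) (auto simp: X_def)
  also have "\<dots> = ennreal (c * t)" using t c by (simp add: mult.commute flip: ennreal_mult)
  finally have le: "X t \<le> ennreal (c * t)" .
  show sq: "sq_int (MT s) (proc u)" if "s \<le> t" for s
  proof (rule sq_intI_nn[OF m])
    have "X s \<le> X t" unfolding X_def using that by (intro nn_integral_mono) (auto simp: indicator_def)
    then show "(\<integral>\<^sup>+z. ennreal ((norm (proc u z))\<^sup>2) \<partial>MT s) < \<infinity>"
      using le by (simp flip: X) (metis ennreal_less_top order_le_less_trans)
  qed
  show "sq_norm (MT t) (proc u) \<le> c * t"
    using le t c unfolding X nn_integral_sq_norm[OF sq[OF order_refl]] by simp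
qed

theorem theorem3p1:
  fixes M :: "'a measure" and F :: "real \<Rightarrow> 'a measure"
    and l1 :: nat and W :: "nat + 'l2::finite \<Rightarrow> real \<Rightarrow> 'a \<Rightarrow> real"
    and A :: "real^'n^'n" and B :: "real^'m^'n"
    and C :: "nat \<Rightarrow> real^'n^'n" and D :: "real^'l2^'n"
    and R :: "complex^'n^'n" and \<phi>L \<beta>U uhat :: real
    and u :: "real \<Rightarrow> 'a \<Rightarrow> real^'m" and x :: "real \<Rightarrow> 'a \<Rightarrow> real^'n" and x0 :: "real^'n"
  assumes "prob_space M" and "is_filtration M F"
    and "wiener_process M F (noise_index l1) W"
    and "nonneg_definite R" and "R \<noteq> 0" and "\<phi>L > 0"
    and "loewner_ge
           (transpose (cmat A) ** R + R ** cmat A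
              + (\<Sum>i=1..l1. transpose (cmat (C i)) ** R ** cmat (C i)))
           (\<phi>L *\<^sub>R R)"
    and "Re (trace (transpose (cmat D) ** R ** cmat D)) > 0"
    and "\<beta>U = lambda_max (transpose (cmat B) ** R ** cmat B)"
    and "measurable_adapted M F u"
    and "uhat \<ge> 0"
    and "\<forall>t>0. ennreal (1 / t) *
           (\<integral>\<^sup>+\<tau>\<in>{0..t}. (\<integral>\<^sup>+\<omega>. ennreal ((norm (u \<tau> \<omega>))\<^sup>2) \<partial>M) \<partial>lborel) \<le> ennreal uhat"
    and "ereal uhat <
           (if \<beta>U \<noteq> 0
            then ereal (\<phi>L * Re (trace (transpose (cmat D) ** R ** cmat D)) / \<beta>U)
            else \<infinity>)"
    and "linear_sde_solution M F l1 W A B C D u x0 x"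
  shows "((\<lambda>t. \<integral>\<^sup>+\<omega>. ennreal ((norm (x t \<omega>))\<^sup>2) \<partial>M) \<longlongrightarrow> \<infinity>) at_top"
proof -
  let ?I = "noise_index l1 :: (nat + 'l2) set"
  interpret wiener M F ?I W
    using assms(1-3) by (simp add: wiener_def wiener_axioms_def)
  define g :: "nat + 'l2 \<Rightarrow> real^'n \<Rightarrow> real^'n" where "g = case_sum (\<lambda>i. (*v) (C i)) (\<lambda>_ _. 0)"
  define h :: "nat + 'l2 \<Rightarrow> real^'n" where "h = case_sum (\<lambda>_. 0) (\<lambda>j. column j D)"
  define v where "v s w = B *v u s w" for s w
  note blin = matrix_vector_mul_bounded_linear
  \<comment> \<open>The energy constraint concerns positive times only; the larger time
    \<open>max t 1\<close> covers t = 0 and negative t as well.\<close>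
  have u_sq: "sq_int (MT t) (proc u)" for t
    by (rule control_energy(1)[OF assms(10,11), of "max t 1"]) (use assms(12) in auto)
  have u_energy: "sq_norm (MT t) (proc u) \<le> uhat * t" if "0 < t" for t
    by (rule control_energy(2)[OF assms(10,11) that]) (use assms(12) that in auto)
  interpret linear_sde M F ?I W "(*v) A" v g h x0 x
  proof (intro linear_sde.intro linear_sde_axioms.intro)
    show "wiener M F ?I W" by (rule wiener_axioms)
    show "finite ?I" by simp
    show "bounded_linear ((*v) A)" by (rule blin)
    show "bounded_linear (g i)" if "i \<in> ?I" for i
      by (cases i) (simp_all add: g_def blin bounded_linear_zero)
    show "measurable_adapted M F v"
      unfolding v_def by (rule measurable_adapted_linear[OF assms(10) blin])
    show "sq_int (MT t) (proc v)" if "0 \<le> t" for t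
      unfolding v_def by (rule sq_int_linear[OF blin u_sq])
    have "(\<lambda>i s w. g i (x s w) + h i) = case_sum (\<lambda>i s w. C i *v x s w) (\<lambda>j s w. column j D)"
      by (auto simp: fun_eq_iff g_def h_def split: sum.split)
    then show "sde_solution M F ?I W (\<lambda>s w. A *v x s w + v s w) (\<lambda>i s w. g i (x s w) + h i) x0 x"
      using assms(14) by (simp add: linear_sde_solution_def v_def)
  qed
  define S where "S = re_mat R"
  define \<kappa> where "\<kappa> = Re (trace (transpose (cmat D) ** R ** cmat D))"
  have herm: "hermitian R" using assms(4) by (simp add: nonneg_definite_def)
  have sym: "w \<bullet> (S *v z) = z \<bullet> (S *v w)" for w z
    unfolding S_def by (rule re_mat_symmetric[OF herm])
  have psd: "0 \<le> w \<bullet> (S *v w)" for w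
    unfolding S_def by (rule nonneg_definite_re_mat[OF assms(4)])
  \<comment> \<open>The matrix inequality tested at a real vector.\<close>
  have dissipation: "\<phi>L * (w \<bullet> (S *v w)) + \<kappa> \<le> 2 * ((A *v w) \<bullet> (S *v w)) + (\<Sum>i\<in>?I. (g i w + h i) \<bullet> (S *v (g i w + h i)))" for w
  proof -
    have "0 \<le> w \<bullet> (re_mat (transpose (cmat A) ** R + R ** cmat A
              + (\<Sum>i=1..l1. transpose (cmat (C i)) ** R ** cmat (C i)) - \<phi>L *\<^sub>R R) *v w)"
      using assms(7) by (intro nonneg_definite_re_mat) (simp add: loewner_ge_def)
    also have "re_mat (transpose (cmat A) ** R + R ** cmat A
              + (\<Sum>i=1..l1. transpose (cmat (C i)) ** R ** cmat (C i)) - \<phi>L *\<^sub>R R) =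
        transpose A ** S + S ** A + (\<Sum>i=1..l1. transpose (C i) ** S ** C i) - \<phi>L *\<^sub>R S"
      by (simp add: re_mat_simps re_mat_sum re_mat_congruence)
         (simp add: transpose_cmat re_mat_mult_left re_mat_mult_right S_def)
    also have "w \<bullet> (\<dots> *v w) = 2 * ((A *v w) \<bullet> (S *v w)) + (\<Sum>i=1..l1. (C i *v w) \<bullet> (S *v (C i *v w))) - \<phi>L * (w \<bullet> (S *v w))"
    proof -
      have "w \<bullet> ((transpose A ** S) *v w) = (A *v w) \<bullet> (S *v w)"
        unfolding matrix_vector_mul_assoc[symmetric] by (rule inner_transpose)
      moreover have "w \<bullet> ((S ** A) *v w) = (A *v w) \<bullet> (S *v w)"
        unfolding matrix_vector_mul_assoc[symmetric] by (rule sym)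
      moreover have "(\<Sum>i=1..l1. transpose (C i) ** S ** C i) *v w = (\<Sum>i=1..l1. (transpose (C i) ** S ** C i) *v w)"
        by (rule sum_matrix_vector_mult)
      ultimately show ?thesis
        by (simp only: matrix_vector_mult_add_rdistrib matrix_vector_mult_diff_rdistrib inner_add_right
            inner_diff_right inner_sum_right congruence_form scaleR_matrix_vector_assoc[symmetric] inner_scaleR_right)
    qed
    finally have 1: "\<phi>L * (w \<bullet> (S *v w)) \<le> 2 * ((A *v w) \<bullet> (S *v w)) + (\<Sum>i=1..l1. (C i *v w) \<bullet> (S *v (C i *v w)))"
      by simp
    \<comment> \<open>The multiplicative indices reproduce the terms with C, while the additive ones
      contribute \<open>\<kappa>\<close>, whatever w is.\<close>
    have "(\<Sum>i\<in>?I. (g i w + h i) \<bullet> (S *v (g i w + h i))) = (\<Sum>i=1..l1. (C i *v w) \<bullet> (S *v (C i *v w))) + \<kappa>"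
      by (simp add: sum.Plus g_def h_def \<kappa>_def trace_congruence S_def)
    then show ?thesis using 1 by simp
  qed
  \<comment> \<open>Real vectors are among the complex ones, so the largest eigenvalue of the
    complex matrix also bounds its form at real controls.\<close>
  note H = hermitian_congruence[OF herm, of B]
  have Bw: "(B *v w) \<bullet> (S *v (B *v w)) \<le> \<beta>U * (norm w)\<^sup>2" for w
    using hermitian_le_lambda_max[OF H, of "cvec w"]
    by (simp add: cvec_form cvec_inner re_mat_congruence congruence_form S_def assms(9) power2_norm_eq_inner)
  \<comment> \<open>A unit vector tested in \<open>Bw\<close> bounds a nonnegative number by
    \<open>\<beta>U\<close>. The sign is needed to clear the denominator in the hypothesis on
    \<open>uhat\<close> and to multiply the energy bound.\<close>
  have \<beta>: "0 \<le> \<beta>U"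
    using Bw[of "axis undefined 1"] psd[of "B *v axis undefined 1"] by (simp add: norm_axis_1)
  \<comment> \<open>The noise input minus the most that a control within its energy budget can
    remove; the hypothesis on \<open>uhat\<close> says that this is positive.\<close>
  define \<delta> where "\<delta> = \<kappa> - \<beta>U * uhat / \<phi>L"
  have \<delta>: "0 < \<delta>"
  proof (cases "\<beta>U = 0")
    case True
    then show ?thesis using assms(8) by (simp add: \<delta>_def \<kappa>_def)
  next
    case False
    then have "uhat < \<phi>L * \<kappa> / \<beta>U" using assms(13) by (simp add: \<kappa>_def)
    then show ?thesis using \<beta> False assms(6) by (simp add: \<delta>_def field_simps)
  qed
  have control: "(\<integral>z. proc v z \<bullet> (S *v proc v z) \<partial>MT t) / \<phi>L \<le> (\<kappa> - \<delta>) * t" if t: "0 < t" for t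
  proof -
    have vs: "sq_int (MT t) (proc v)" using t by (intro v_sq) simp
    have "(\<integral>z. proc v z \<bullet> (S *v proc v z) \<partial>MT t) \<le>
        (\<integral>z. \<beta>U * (norm (proc u z))\<^sup>2 \<partial>MT t)"
      by (intro integral_mono sq_int_inner sq_int_linear[OF blin] vs integrable_mult_right sq_int_integrable u_sq)
         (simp add: v_def Bw)
    also have "\<dots> = \<beta>U * sq_norm (MT t) (proc u)" by (simp add: sq_norm_def)
    also have "\<dots> \<le> \<beta>U * (uhat * t)" by (intro mult_left_mono u_energy t \<beta>)
    finally show ?thesis using assms(6) by (simp add: \<delta>_def field_simps)
  qed
  show ?thesis
    by (rule second_moment_diverges[OF blin sym psd assms(6) \<delta> dissipation control])
qed

end
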